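(* Let $\varphi$ be a Musielak--Orlicz function on $\Omega\times[0,\infty)$ which is of uniformly lower type $p_\varphi^-$ for some $p_\varphi^-\in(0,\infty)$ and of uniformly upper type $p_\varphi^+$ for some $p_\varphi^+\in(0,\infty)$. (i) If $\varphi\in\mathbb S^+$ and $p_\varphi^+\in(0,2)$, then there exists a positive constant $C$ such that, for any $f\in WH_\varphi^s(\Omega)$, $\|f\|_{WH_\varphi^S(\Omega)}\le C\|f\|_{WH_\varphi^s(\Omega)}$. (ii) If $\varphi\in\mathbb A_\infty(\Omega)\cap\mathbb S$ and $p_\varphi^+\in(0,2)$, then there exists a positive constant $C$ such that, for any $f\in WH_\varphi^s(\Omega)$, $\|f\|_{WH_\varphi^M(\Omega)}\le C\|f\|_{WH_\varphi^s(\Omega)}$. (iii) There exists a positive constant $C$ such that, for any $f\in WP_\varphi(\Omega)$ [resp., $f\in WQ_\varphi(\Omega)$], $\|f\|_{WH_\varphi^M(\Omega)}\le C\|f\|_{WP_\varphi(\Omega)}$ [resp., $\|f\|_{WH_\varphi^S(\Omega)}\le C\|f\|_{WQ_\varphi(\Omega)}$]. (iv) If $\varphi\in\mathbb A_\infty(\Omega)\cap\mathbb S$, then there exists a positive constant $C$ such that, for any $f\in WP_\varphi(\Omega)$, $\|f\|_{WH_\varphi^S(\Omega)}\le C\|f\|_{WP_\varphi(\Omega)}$ and $\|f\|_{WH_\varphi^s(\Omega)}\le C\|f\|_{WP_\varphi(\Omega)}$ [resp., for any $f\in WQ_\varphi(\Omega)$, $\|f\|_{WH_\varphi^M(\Omega)}\le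 C\|f\|_{WQ_\varphi(\Omega)}$]. (v) If $\varphi\in\mathbb S^-$, then there exists a positive constant $C$ such that, for any $f\in WQ_\varphi(\Omega)$, $\|f\|_{WH_\varphi^s(\Omega)}\le C\|f\|_{WQ_\varphi(\Omega)}$. (vi) If $\varphi\in\mathbb A_\infty(\Omega)\cap\mathbb S$ and $p_\varphi^+\in(0,2)$, then there exists a positive constant $C$ such that, for any $f\in WQ_\varphi(\Omega)$, $\frac1C\|f\|_{WQ_\varphi(\Omega)}\le\|f\|_{WP_\varphi(\Omega)}\le C\|f\|_{WQ_\varphi(\Omega)}$. Moreover, if $\{\mathcal F_n\}_{n\in\mathbb Z_+}$ is regular and $\varphi\in\mathbb A_\infty(\Omega)$, then $$WH_\varphi^s(\Omega)=WH_\varphi^M(\Omega)=WH_\varphi^S(\Omega)=WP_\varphi(\Omega)=WQ_\varphi(\Omega).$$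
   Context: Setting. $(\Omega,\mathcal F,\mathbb P)$ is a probability space, $\{\mathcal F_n\}_{n\in\mathbb Z_+}$ ($\mathbb Z_+=\{0,1,2,\dots\}$, $\mathbb N=\{1,2,\dots\}$) is an increasing sequence of sub-$\sigma$-algebras of $\mathcal F$, and $\mathbb E_n$ is the conditional expectation given $\mathcal F_n$. The stochastic basis $\{\mathcal F_n\}$ is regular if there is a constant $R>0$ such that $f_n\le Rf_{n-1}$ a.e. for all $n\in\mathbb N$ and every nonnegative martingale $(f_n)_{n\in\mathbb Z_+}$. Musielak--Orlicz functions. $\varphi:\Omega\times[0,\infty)\to[0,\infty)$ is a Musielak--Orlicz function if $\varphi(\cdot,t)$ is measurable for each $t\in[0,\infty)$ and, for each $x\in\Omega$, $\varphi(x,\cdot)$ is non-decreasing, $\varphi(x,0)=0$, $\varphi(x,t)>0$ for $t\in(0,\infty)$, and $\lim_{t\to\infty}\varphi(x,t)=\infty$. It is of uniformly lower (resp. upper) type $p\in(0,\infty)$ if there is a constant $C_{(p)}>0$ with $\varphi(x,st)\le C_{(p)}s^p\varphi(x,t)$ for all $x\in\Omega$, $t\in[0,\infty)$ and $s\in(0,1)$ (resp. $s\in[1,\infty)$). Standing assumption: $\int_\Omega\varphi(x,t)\,d\mathbb P(x)<\infty$ for every $t\in(0,\infty)$. For measurable $E\subseteq\Omega$, $\varphi(E,t):=\int_E\varphi(x,t)\,d\mathbb P(x)$. Weight conditions. Put $\varphi_n(\cdot,t):=\mathbb E_n(\varphi(\cdot,t))$. $\varphi\in\mathbb S^-$ (resp.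 $\varphi\in\mathbb S^+$) means there is a constant $K>0$ such that $\frac1K\varphi_{n-1}(x,t)\le\varphi_n(x,t)$ (resp. $\varphi_n(x,t)\le K\varphi_{n-1}(x,t)$) for all $n\in\mathbb N$, $t\in(0,\infty)$ and almost every $x\in\Omega$; $\mathbb S:=\mathbb S^-\cap\mathbb S^+$. For $q\in(1,\infty)$, $\varphi\in\mathbb A_q(\Omega)$ means there is a constant $K>0$ such that, for all $t\in(0,\infty)$ and $n\in\mathbb Z_+$, $\mathbb E_n(\varphi(\cdot,t))\,[\mathbb E_n(\varphi(\cdot,t)^{-1/(q-1)})]^{q-1}\le K$ $\mathbb P$-a.e.; $\varphi\in\mathbb A_1(\Omega)$ means there is $K>0$ such that, for all $t\in(0,\infty)$ and $n\in\mathbb Z_+$, $\mathbb E_n(\varphi(\cdot,t))\frac1{\varphi(\cdot,t)}\le K$ $\mathbb P$-a.e. $\varphi\in\mathbb A_\infty(\Omega)$ means $\varphi\in\mathbb A_q(\Omega)$ for some $q\in[1,\infty)$. Weak space. $\|f\|_{WL_\varphi(\Omega)}:=\inf\{\lambda\in(0,\infty):\ \sup_{\alpha\in(0,\infty)}\varphi(\{x\in\Omega:|f(x)|>\alpha\},\alpha/\lambda)\le1\}$, and $WL_\varphi(\Omega)$ is the set of measurable $f$ with $\|f\|_{WL_\varphi(\Omega)}<\infty$. Martingale spaces. $\mathcal M$ is the set of martingales $f=(f_n)_{n\in\mathbb Z_+}$ with respect to $\{\mathcal F_n\}$ with $f_0=0$; $d_nf:=f_n-f_{n-1}$ for $n\in\mathbb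 N$; $M(f):=\sup_{n\in\mathbb Z_+}|f_n|$; $S_n(f):=(\sum_{i=1}^n|d_if|^2)^{1/2}$; $S(f):=(\sum_{i=1}^\infty|d_if|^2)^{1/2}$; $s(f):=(\sum_{i=1}^\infty\mathbb E_{i-1}|d_if|^2)^{1/2}$. $WH_\varphi^M(\Omega)$, $WH_\varphi^S(\Omega)$, $WH_\varphi^s(\Omega)$ are the sets of $f\in\mathcal M$ for which, respectively, $\|f\|_{WH_\varphi^M(\Omega)}:=\|M(f)\|_{WL_\varphi(\Omega)}$, $\|f\|_{WH_\varphi^S(\Omega)}:=\|S(f)\|_{WL_\varphi(\Omega)}$, $\|f\|_{WH_\varphi^s(\Omega)}:=\|s(f)\|_{WL_\varphi(\Omega)}$ is finite. Let $\Lambda$ be the set of sequences $(\lambda_n)_{n\in\mathbb Z_+}$ of nonnegative functions, nondecreasing in $n$, with $\lambda_n$ being $\mathcal F_n$-measurable; $\lambda_\infty:=\lim_{n\to\infty}\lambda_n$. For $f\in\mathcal M$ let $\Lambda[WP_\varphi](f)$ (resp. $\Lambda[WQ_\varphi](f)$) be the set of $(\lambda_n)\in\Lambda$ with $|f_n|\le\lambda_{n-1}$ (resp. $S_n(f)\le\lambda_{n-1}$) for all $n\in\mathbb N$ and $\lambda_\infty\in WL_\varphi(\Omega)$. $WP_\varphi(\Omega)$ (resp. $WQ_\varphi(\Omega)$) is the set of $f\in\mathcal M$ for which $\|f\|_{WP_\varphi(\Omega)}:=\inf_{(\lambda_n)\in\Lambda[WP_\varphi](f)}\|\lambda_\infty\|_{WL_\varphi(\Omega)}$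 (resp. $\|f\|_{WQ_\varphi(\Omega)}:=\inf_{(\lambda_n)\in\Lambda[WQ_\varphi](f)}\|\lambda_\infty\|_{WL_\varphi(\Omega)}$) is finite ($\inf\emptyset=\infty$). *)

theory Defs
  imports "HOL-Probability.Probability"
begin

definition stochastic_basis :: "'a measure \<Rightarrow> (nat \<Rightarrow> 'a measure) \<Rightarrow> bool" where
  "stochastic_basis M F \<longleftrightarrow>
     filtration (space M) F \<and> (\<forall>n. subalgebra M (F n))"

definition is_martingale ::
  "'a measure \<Rightarrow> (nat \<Rightarrow> 'a measure) \<Rightarrow> (nat \<Rightarrow> 'a \<Rightarrow> real) \<Rightarrow> bool" where
  "is_martingale M F f \<longleftrightarrow>
     (\<forall>n. f n \<in> borel_measurable (F n)) \<and> (\<forall>n. integrable M (f n)) \<and>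
     (\<forall>m n. m \<le> n \<longrightarrow> (AE x in M. real_cond_exp M (F m) (f n) x = f m x))"

definition regular_basis :: "'a measure \<Rightarrow> (nat \<Rightarrow> 'a measure) \<Rightarrow> bool" where
  "regular_basis M F \<longleftrightarrow>
     (\<exists>R>0. \<forall>f. is_martingale M F f \<and> (\<forall>n. AE x in M. 0 \<le> f n x) \<longrightarrow>
        (\<forall>n\<ge>1. AE x in M. f n x \<le> R * f (n - 1) x))"

definition martingales0 ::
  "'a measure \<Rightarrow> (nat \<Rightarrow> 'a measure) \<Rightarrow> (nat \<Rightarrow> 'a \<Rightarrow> real) set" where
  "martingales0 M F = {f. is_martingale M F f \<and> (AE x in M. f 0 x = 0)}"

text \<open>Only the values \<open>\<phi> x t\<close> with \<open>x \<in> space M\<close> and \<open>t \<ge> 0\<close> are meaningful.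
  The last conjunct is the standing integrability assumption.\<close>

definition musielak_orlicz :: "'a measure \<Rightarrow> ('a \<Rightarrow> real \<Rightarrow> real) \<Rightarrow> bool" where
  "musielak_orlicz M \<phi> \<longleftrightarrow>
     (\<forall>t\<ge>0. (\<lambda>x. \<phi> x t) \<in> borel_measurable M) \<and>
     (\<forall>x\<in>space M. (\<forall>t\<ge>0. 0 \<le> \<phi> x t) \<and> mono_on {0..} (\<phi> x) \<and> \<phi> x 0 = 0 \<and>
        (\<forall>t>0. 0 < \<phi> x t) \<and> filterlim (\<phi> x) at_top at_top) \<and>
     (\<forall>t>0. (\<integral>\<^sup>+x. ennreal (\<phi> x t) \<partial>M) < \<infinity>)"

definition uniformly_lower_type :: "'a measure \<Rightarrow> ('a \<Rightarrow> real \<Rightarrow> real) \<Rightarrow> real \<Rightarrow> bool" where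
  "uniformly_lower_type M \<phi> p \<longleftrightarrow>
     (\<exists>C>0. \<forall>x\<in>space M. \<forall>t\<ge>0. \<forall>s\<in>{0<..<1}. \<phi> x (s * t) \<le> C * s powr p * \<phi> x t)"

definition uniformly_upper_type :: "'a measure \<Rightarrow> ('a \<Rightarrow> real \<Rightarrow> real) \<Rightarrow> real \<Rightarrow> bool" where
  "uniformly_upper_type M \<phi> p \<longleftrightarrow>
     (\<exists>C>0. \<forall>x\<in>space M. \<forall>t\<ge>0. \<forall>s\<ge>1. \<phi> x (s * t) \<le> C * s powr p * \<phi> x t)"

definition phi_meas :: "'a measure \<Rightarrow> ('a \<Rightarrow> real \<Rightarrow> real) \<Rightarrow> 'a set \<Rightarrow> real \<Rightarrow> ennreal" where
  "phi_meas M \<phi> E t = (\<integral>\<^sup>+x\<in>E. ennreal (\<phi> x t) \<partial>M)"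

definition phi_cond ::
  "'a measure \<Rightarrow> (nat \<Rightarrow> 'a measure) \<Rightarrow> ('a \<Rightarrow> real \<Rightarrow> real) \<Rightarrow> nat \<Rightarrow> real \<Rightarrow> 'a \<Rightarrow> ennreal" where
  "phi_cond M F \<phi> n t = nn_cond_exp M (F n) (\<lambda>x. ennreal (\<phi> x t))"

definition S_minus ::
  "'a measure \<Rightarrow> (nat \<Rightarrow> 'a measure) \<Rightarrow> ('a \<Rightarrow> real \<Rightarrow> real) \<Rightarrow> bool" where
  "S_minus M F \<phi> \<longleftrightarrow>
     (\<exists>K>0. \<forall>n\<ge>1. \<forall>t>0. AE x in M.
        ennreal (1 / K) * phi_cond M F \<phi> (n - 1) t x \<le> phi_cond M F \<phi> n t x)"

definition S_plus ::
  "'a measure \<Rightarrow> (nat \<Rightarrow> 'a measure) \<Rightarrow> ('a \<Rightarrow> real \<Rightarrow> real) \<Rightarrow> bool" where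
  "S_plus M F \<phi> \<longleftrightarrow>
     (\<exists>K>0. \<forall>n\<ge>1. \<forall>t>0. AE x in M.
        phi_cond M F \<phi> n t x \<le> ennreal K * phi_cond M F \<phi> (n - 1) t x)"

definition S_class ::
  "'a measure \<Rightarrow> (nat \<Rightarrow> 'a measure) \<Rightarrow> ('a \<Rightarrow> real \<Rightarrow> real) \<Rightarrow> bool" where
  "S_class M F \<phi> \<longleftrightarrow> S_minus M F \<phi> \<and> S_plus M F \<phi>"

text \<open>Real powers on \<open>[0,\<infinity>]\<close>, intended for exponents \<open>a > 0\<close> only.\<close>

definition ennreal_powr :: "ennreal \<Rightarrow> real \<Rightarrow> ennreal" where
  "ennreal_powr u a = (if u = \<infinity> then \<infinity> else ennreal (enn2real u powr a))"

definition A_weight ::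
  "'a measure \<Rightarrow> (nat \<Rightarrow> 'a measure) \<Rightarrow> ('a \<Rightarrow> real \<Rightarrow> real) \<Rightarrow> real \<Rightarrow> bool" where
  "A_weight M F \<phi> q \<longleftrightarrow>
     (if q = 1 then
        (\<exists>K>0. \<forall>t>0. \<forall>n. AE x in M.
           phi_cond M F \<phi> n t x * ennreal (1 / \<phi> x t) \<le> ennreal K)
      else
        (\<exists>K>0. \<forall>t>0. \<forall>n. AE x in M.
           phi_cond M F \<phi> n t x *
           ennreal_powr (nn_cond_exp M (F n) (\<lambda>y. ennreal (\<phi> y t powr (- 1 / (q - 1)))) x) (q - 1)
           \<le> ennreal K))"

definition A_infinity ::
  "'a measure \<Rightarrow> (nat \<Rightarrow> 'a measure) \<Rightarrow> ('a \<Rightarrow> real \<Rightarrow> real) \<Rightarrow> bool" where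
  "A_infinity M F \<phi> \<longleftrightarrow> (\<exists>q\<ge>1. A_weight M F \<phi> q)"

text \<open>Functions are extended-real-valued because maximal and square functions may be infinite;
  a function of finite quasi-norm is finite almost everywhere since \<open>\<phi> x t \<longlonglongrightarrow> \<infinity>\<close> as \<open>t \<longlonglongrightarrow> \<infinity>\<close>.\<close>

definition WL_norm :: "'a measure \<Rightarrow> ('a \<Rightarrow> real \<Rightarrow> real) \<Rightarrow> ('a \<Rightarrow> ereal) \<Rightarrow> ennreal" where
  "WL_norm M \<phi> f =
     Inf {ennreal l | l. 0 < l \<and>
       (SUP \<alpha>\<in>{0<..}. phi_meas M \<phi> {x \<in> space M. \<bar>f x\<bar> > ereal \<alpha>} (\<alpha> / l)) \<le> 1}"

definition WL_space :: "'a measure \<Rightarrow> ('a \<Rightarrow> real \<Rightarrow> real) \<Rightarrow> ('a \<Rightarrow> ereal) set" where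
  "WL_space M \<phi> = {f \<in> borel_measurable M. WL_norm M \<phi> f < \<infinity>}"

definition mdiff :: "(nat \<Rightarrow> 'a \<Rightarrow> real) \<Rightarrow> nat \<Rightarrow> 'a \<Rightarrow> real" where
  "mdiff f n x = f n x - f (n - 1) x"

definition maximal_fun :: "(nat \<Rightarrow> 'a \<Rightarrow> real) \<Rightarrow> 'a \<Rightarrow> ereal" where
  "maximal_fun f x = (SUP n. ereal \<bar>f n x\<bar>)"

definition square_fun_upto :: "(nat \<Rightarrow> 'a \<Rightarrow> real) \<Rightarrow> nat \<Rightarrow> 'a \<Rightarrow> real" where
  "square_fun_upto f n x = sqrt (\<Sum>i=1..n. \<bar>mdiff f i x\<bar>\<^sup>2)"

text \<open>In the two series below the summation index is shifted to start at \<open>0\<close>.\<close>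

definition square_fun :: "(nat \<Rightarrow> 'a \<Rightarrow> real) \<Rightarrow> 'a \<Rightarrow> ereal" where
  "square_fun f x = enn2ereal (ennreal_powr (\<Sum>i. ennreal (\<bar>mdiff f (Suc i) x\<bar>\<^sup>2)) (1 / 2))"

definition cond_square_fun ::
  "'a measure \<Rightarrow> (nat \<Rightarrow> 'a measure) \<Rightarrow> (nat \<Rightarrow> 'a \<Rightarrow> real) \<Rightarrow> 'a \<Rightarrow> ereal" where
  "cond_square_fun M F f x =
     enn2ereal (ennreal_powr
       (\<Sum>i. nn_cond_exp M (F i) (\<lambda>y. ennreal (\<bar>mdiff f (Suc i) y\<bar>\<^sup>2)) x) (1 / 2))"

definition WHM_norm :: "'a measure \<Rightarrow> ('a \<Rightarrow> real \<Rightarrow> real) \<Rightarrow> (nat \<Rightarrow> 'a \<Rightarrow> real) \<Rightarrow> ennreal" where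
  "WHM_norm M \<phi> f = WL_norm M \<phi> (maximal_fun f)"

definition WHS_norm :: "'a measure \<Rightarrow> ('a \<Rightarrow> real \<Rightarrow> real) \<Rightarrow> (nat \<Rightarrow> 'a \<Rightarrow> real) \<Rightarrow> ennreal" where
  "WHS_norm M \<phi> f = WL_norm M \<phi> (square_fun f)"

definition WHs_norm ::
  "'a measure \<Rightarrow> (nat \<Rightarrow> 'a measure) \<Rightarrow> ('a \<Rightarrow> real \<Rightarrow> real) \<Rightarrow> (nat \<Rightarrow> 'a \<Rightarrow> real) \<Rightarrow> ennreal" where
  "WHs_norm M F \<phi> f = WL_norm M \<phi> (cond_square_fun M F f)"

definition WHM_space ::
  "'a measure \<Rightarrow> (nat \<Rightarrow> 'a measure) \<Rightarrow> ('a \<Rightarrow> real \<Rightarrow> real) \<Rightarrow> (nat \<Rightarrow> 'a \<Rightarrow> real) set" where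
  "WHM_space M F \<phi> = {f \<in> martingales0 M F. WHM_norm M \<phi> f < \<infinity>}"

definition WHS_space ::
  "'a measure \<Rightarrow> (nat \<Rightarrow> 'a measure) \<Rightarrow> ('a \<Rightarrow> real \<Rightarrow> real) \<Rightarrow> (nat \<Rightarrow> 'a \<Rightarrow> real) set" where
  "WHS_space M F \<phi> = {f \<in> martingales0 M F. WHS_norm M \<phi> f < \<infinity>}"

definition WHs_space ::
  "'a measure \<Rightarrow> (nat \<Rightarrow> 'a measure) \<Rightarrow> ('a \<Rightarrow> real \<Rightarrow> real) \<Rightarrow> (nat \<Rightarrow> 'a \<Rightarrow> real) set" where
  "WHs_space M F \<phi> = {f \<in> martingales0 M F. WHs_norm M F \<phi> f < \<infinity>}"

definition control_seqs ::
  "'a measure \<Rightarrow> (nat \<Rightarrow> 'a measure) \<Rightarrow> (nat \<Rightarrow> 'a \<Rightarrow> real) set" where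
  "control_seqs M F =
     {l. (\<forall>n. l n \<in> borel_measurable (F n)) \<and>
         (\<forall>x\<in>space M. (\<forall>n. 0 \<le> l n x) \<and> incseq (\<lambda>n. l n x))}"

definition control_limit :: "(nat \<Rightarrow> 'a \<Rightarrow> real) \<Rightarrow> 'a \<Rightarrow> ereal" where
  "control_limit l x = lim (\<lambda>n. ereal (l n x))"

text \<open>The domination is required almost everywhere: martingales are determined only up to null sets,
  and \<open>F (n - 1)\<close> is not assumed to contain the null sets of \<open>M\<close>, so a pointwise requirement
  would depend on the chosen version of \<open>f\<close>. In contrast, a sequence that is nonnegative and
  nondecreasing only almost everywhere can always be replaced by an adapted version for which
  this holds everywhere.\<close>

definition control_WP ::
  "'a measure \<Rightarrow> (nat \<Rightarrow> 'a measure) \<Rightarrow> ('a \<Rightarrow> real \<Rightarrow> real) \<Rightarrow> (nat \<Rightarrow> 'a \<Rightarrow> real)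
     \<Rightarrow> (nat \<Rightarrow> 'a \<Rightarrow> real) set" where
  "control_WP M F \<phi> f =
     {l \<in> control_seqs M F. (\<forall>n\<ge>1. AE x in M. \<bar>f n x\<bar> \<le> l (n - 1) x) \<and>
        control_limit l \<in> WL_space M \<phi>}"

definition control_WQ ::
  "'a measure \<Rightarrow> (nat \<Rightarrow> 'a measure) \<Rightarrow> ('a \<Rightarrow> real \<Rightarrow> real) \<Rightarrow> (nat \<Rightarrow> 'a \<Rightarrow> real)
     \<Rightarrow> (nat \<Rightarrow> 'a \<Rightarrow> real) set" where
  "control_WQ M F \<phi> f =
     {l \<in> control_seqs M F. (\<forall>n\<ge>1. AE x in M. square_fun_upto f n x \<le> l (n - 1) x) \<and>
        control_limit l \<in> WL_space M \<phi>}"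

definition WP_norm ::
  "'a measure \<Rightarrow> (nat \<Rightarrow> 'a measure) \<Rightarrow> ('a \<Rightarrow> real \<Rightarrow> real) \<Rightarrow> (nat \<Rightarrow> 'a \<Rightarrow> real) \<Rightarrow> ennreal" where
  "WP_norm M F \<phi> f = (INF l\<in>control_WP M F \<phi> f. WL_norm M \<phi> (control_limit l))"

definition WQ_norm ::
  "'a measure \<Rightarrow> (nat \<Rightarrow> 'a measure) \<Rightarrow> ('a \<Rightarrow> real \<Rightarrow> real) \<Rightarrow> (nat \<Rightarrow> 'a \<Rightarrow> real) \<Rightarrow> ennreal" where
  "WQ_norm M F \<phi> f = (INF l\<in>control_WQ M F \<phi> f. WL_norm M \<phi> (control_limit l))"

definition WP_space ::
  "'a measure \<Rightarrow> (nat \<Rightarrow> 'a measure) \<Rightarrow> ('a \<Rightarrow> real \<Rightarrow> real) \<Rightarrow> (nat \<Rightarrow> 'a \<Rightarrow> real) set" where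
  "WP_space M F \<phi> = {f \<in> martingales0 M F. WP_norm M F \<phi> f < \<infinity>}"

definition WQ_space ::
  "'a measure \<Rightarrow> (nat \<Rightarrow> 'a measure) \<Rightarrow> ('a \<Rightarrow> real \<Rightarrow> real) \<Rightarrow> (nat \<Rightarrow> 'a \<Rightarrow> real) set" where
  "WQ_space M F \<phi> = {f \<in> martingales0 M F. WQ_norm M F \<phi> f < \<infinity>}"

end

theory Submission
  imports Defs
begin

text \<open>
  All inequalities are reduced to level sets: for a weight \<open>\<phi>(\<cdot>, t)\<close> and a level \<open>\<alpha>\<close> it suffices to
  bound \<open>\<phi>({X > 2\<alpha>}, t)\<close> by \<open>\<epsilon> \<phi>({X > \<alpha>}, t) + B \<phi>({Y > \<delta>\<alpha>}, t)\<close> for an \<open>\<epsilon>\<close> that depends only on the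
  upper type of \<open>\<phi>\<close>; iterating downwards in \<open>\<alpha>\<close> absorbs the first term, because
  \<open>\<phi>(\<Omega>, \<alpha>)\<close> stays bounded as \<open>\<alpha>\<close> decreases. No atomic decomposition is needed.

  Under \<open>A\<^sub>\<infinity>\<close>, such a good-\<open>\<lambda>\<close> inequality for the weight follows from one for \<open>\<P>\<close> conditioned on the
  entrance time into \<open>{X > \<alpha>}\<close>, and the latter is Chebyshev's inequality together with the
  orthogonality of stopped martingale differences. Under \<open>S\<^sup>-\<close> alone the same argument
  works with the weighted measure for the conditional square function. Under \<open>S\<^sup>+\<close> and
  upper type below \<open>2\<close>, a direct estimate of the weighted second moment of the stopped square
  function over dyadic levels bounds \<open>S(f)\<close> by \<open>s(f)\<close>.

  The spaces \<open>WP\<close> and \<open>WQ\<close> are compared through \<open>S\<^sub>n \<le> S\<^bsub>n-1\<^esub> + 2\<lambda>\<^bsub>n-1\<^esub>\<close> and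
  \<open>|f\<^sub>n| \<le> M\<^bsub>n-1\<^esub> + \<lambda>\<^bsub>n-1\<^esub>\<close>. On a regular basis, an adapted process \<open>V\<close> is dominated by the
  predictable process whose value at time \<open>n\<close> is the largest \<open>q\<close> for which the
  conditional probability of \<open>{V\<^bsub>n+1\<^esub> > q}\<close> is at least \<open>1/R\<close>; by the weak-type inequality for Doob's
  maximal function, which only uses \<open>A\<^sub>\<infinity>\<close>, this predictable process has the same weak size as \<open>V\<close>.
\<close>

section \<open>Weak-type bounds from level sets\<close>

text \<open>The weight in the quasi-norm moves with the level: what has to be bounded is the
  \<open>Q (\<alpha> / l)\<close>-mass of the set above \<open>\<alpha>\<close>. Good-lambda
  inequalities are proved for a frozen \<open>t\<close>; returning from
  \<open>2 * \<alpha> / l\<close> to \<open>\<alpha> / l\<close> costs the doubling factor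
  \<open>u\<close> of the upper type, so the factor to be reached is \<open>1 / (2 * u)\<close>,
  fixed before any martingale enters. The lower type acts at the other end: enlarging
  \<open>l\<close> turns a bound by \<open>B\<close> into a bound by 1. Martingales here are merely
  integrable, so second moments are only taken of transforms with predictable indicator
  coefficients, and stopping needs a bound on the last jump. A control gives one, since
  \<open>l i\<close> bounds the process at time \<open>Suc i\<close>, a step ahead; the conditional
  square function does not, which is why \<open>S(f)\<close> assists \<open>s(f)\<close> in bounding
  \<open>M(f)\<close>. In a weighted second moment, trading a squared difference for its conditional
  expectation changes the weight from its expectation at time \<open>Suc i\<close> to that at time
  \<open>i\<close>; S^- and S^+ make this cost a constant.\<close>

locale weighted_basis = prob_space M for M :: "'a measure" +
  fixes F :: "nat \<Rightarrow> 'a measure" and \<phi> :: "'a \<Rightarrow> real \<Rightarrow> real" and pm pp :: real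
  assumes basis: "stochastic_basis M F"
    and mo: "musielak_orlicz M \<phi>"
    and pm_pos: "0 < pm" and lower_type: "uniformly_lower_type M \<phi> pm"
    and pp_pos: "0 < pp" and upper_type: "uniformly_upper_type M \<phi> pp"
begin

section \<open>Filtration, conditional expectations and the weighted measures\<close>

lemma subalg: "subalgebra M (F n)"
  using basis by (simp add: stochastic_basis_def)

lemma space_F [simp]: "space (F n) = space M"
  using subalg by (auto simp: subalgebra_def)

lemma sets_F_M: "A \<in> sets (F n) \<Longrightarrow> A \<in> sets M"
  using subalg by (auto simp: subalgebra_def)

lemma sets_F_mono: "m \<le> n \<Longrightarrow> A \<in> sets (F m) \<Longrightarrow> A \<in> sets (F n)"
  using basis filtration.sets_F_mono[of "space M" F m n] by (auto simp: stochastic_basis_def)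

lemma subalg_mono: "m \<le> n \<Longrightarrow> subalgebra (F n) (F m)"
  using sets_F_mono by (auto simp: subalgebra_def)

lemma measurable_F_M: "f \<in> measurable (F n) N \<Longrightarrow> f \<in> measurable M N"
  using measurable_from_subalg[OF subalg] by blast

lemma measurable_F_mono: "m \<le> n \<Longrightarrow> f \<in> measurable (F m) N \<Longrightarrow> f \<in> measurable (F n) N"
  using measurable_from_subalg[OF subalg_mono] by blast

lemma sigma_finite_F: "sigma_finite_subalgebra M (F n)"
  using subalg finite_measure_subalgebra_is_sigma_finite[of M "F n"] finite_measure_axioms
  by (auto simp: finite_measure_subalgebra_def finite_measure_subalgebra_axioms_def)

lemma nn_cond_exp_mult_integral:
  assumes "f \<in> borel_measurable (F n)" "g \<in> borel_measurable M"
  shows "(\<integral>\<^sup>+x. f x * nn_cond_exp M (F n) g x \<partial>M) = (\<integral>\<^sup>+x. f x * g x \<partial>M)"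
  using sigma_finite_subalgebra.nn_cond_exp_intg[OF sigma_finite_F] assms by blast

lemma phi_measurable [measurable]: "0 \<le> t \<Longrightarrow> (\<lambda>x. \<phi> x t) \<in> borel_measurable M"
  using mo by (simp add: musielak_orlicz_def)

lemma phi_nonneg: "x \<in> space M \<Longrightarrow> 0 \<le> t \<Longrightarrow> 0 \<le> \<phi> x t"
  using mo by (simp add: musielak_orlicz_def)

lemma phi_pos: "x \<in> space M \<Longrightarrow> 0 < t \<Longrightarrow> 0 < \<phi> x t"
  using mo by (simp add: musielak_orlicz_def)

lemma phi_mono: "x \<in> space M \<Longrightarrow> 0 \<le> s \<Longrightarrow> s \<le> t \<Longrightarrow> \<phi> x s \<le> \<phi> x t"
  using mo by (auto simp: musielak_orlicz_def mono_on_def)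

definition Q :: "real \<Rightarrow> 'a measure" where
  "Q t = density M (\<lambda>x. ennreal (\<phi> x t))"

definition level :: "('a \<Rightarrow> ereal) \<Rightarrow> real \<Rightarrow> 'a set" where
  "level X \<alpha> = {x \<in> space M. \<bar>X x\<bar> > ereal \<alpha>}"

lemma sets_Q [simp, measurable_cong]: "sets (Q t) = sets M" and space_Q [simp]: "space (Q t) = space M"
  by (simp_all add: Q_def)

lemma emeasure_Q:
  "0 \<le> t \<Longrightarrow> A \<in> sets M \<Longrightarrow> emeasure (Q t) A = (\<integral>\<^sup>+x. ennreal (\<phi> x t) * indicator A x \<partial>M)"
  by (simp add: Q_def emeasure_density)

lemma phi_meas_eq: "0 \<le> t \<Longrightarrow> A \<in> sets M \<Longrightarrow> phi_meas M \<phi> A t = emeasure (Q t) A"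
  by (simp add: emeasure_Q phi_meas_def)

lemma level_sets [measurable]: "X \<in> borel_measurable M \<Longrightarrow> level X \<alpha> \<in> sets M"
  unfolding level_def by measurable

lemma level_antimono: "\<alpha> \<le> \<beta> \<Longrightarrow> level X \<beta> \<subseteq> level X \<alpha>"
  by (auto simp: level_def intro: le_less_trans[of "ereal \<alpha>" "ereal \<beta>"])

lemma Q_finite: "0 < t \<Longrightarrow> emeasure (Q t) A < \<infinity>"
proof -
  assume t: "0 < t"
  have "emeasure (Q t) A \<le> emeasure (Q t) (space M)"
    using emeasure_space[of "Q t" A] by simp
  also have "\<dots> = (\<integral>\<^sup>+x. ennreal (\<phi> x t) \<partial>M)"
    using t by (subst emeasure_Q) (auto intro!: nn_integral_cong)
  also have "\<dots> < \<infinity>"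
    using mo t by (auto simp: musielak_orlicz_def)
  finally show ?thesis .
qed

lemma Q_mono_AE:
  assumes "0 \<le> t" "A \<in> sets M" "B \<in> sets M" "AE x in M. x \<in> A \<longrightarrow> x \<in> B"
  shows "emeasure (Q t) A \<le> emeasure (Q t) B"
  using assms(4) unfolding emeasure_Q[OF assms(1,2)] emeasure_Q[OF assms(1,3)]
  by (intro nn_integral_mono_AE) (auto split: split_indicator)

lemma Q_scale:
  assumes le: "\<And>x. x \<in> space M \<Longrightarrow> \<phi> x s \<le> c * \<phi> x t"
    and "0 \<le> c" "0 \<le> s" "0 \<le> t" and A: "A \<in> sets M"
  shows "emeasure (Q s) A \<le> ennreal c * emeasure (Q t) A"
proof -
  have "emeasure (Q s) A \<le> (\<integral>\<^sup>+x. ennreal c * (ennreal (\<phi> x t) * indicator A x) \<partial>M)"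
    unfolding emeasure_Q[OF \<open>0 \<le> s\<close> A] using le assms(2-4)
    by (intro nn_integral_mono) (auto simp: ennreal_mult'[symmetric] phi_nonneg intro!: ennreal_leI split: split_indicator)
  also have "\<dots> = ennreal c * emeasure (Q t) A"
    using assms by (subst nn_integral_cmult) (auto simp: emeasure_Q)
  finally show ?thesis .
qed

lemma upper_typeE:
  obtains C where "C > 0" "\<And>s t A. 1 \<le> s \<Longrightarrow> 0 \<le> t \<Longrightarrow> A \<in> sets M \<Longrightarrow>
    emeasure (Q (s * t)) A \<le> ennreal (C * s powr pp) * emeasure (Q t) A"
proof -
  obtain C where "C > 0" "\<forall>x\<in>space M. \<forall>t\<ge>0. \<forall>s\<ge>1. \<phi> x (s * t) \<le> C * s powr pp * \<phi> x t"
    using upper_type unfolding uniformly_upper_type_def by blast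
  then show thesis by (intro that[of C] Q_scale) auto
qed

lemma lower_typeE:
  obtains C where "C > 0" "\<And>s t A. 0 < s \<Longrightarrow> s < 1 \<Longrightarrow> 0 \<le> t \<Longrightarrow> A \<in> sets M \<Longrightarrow>
    emeasure (Q (s * t)) A \<le> ennreal (C * s powr pm) * emeasure (Q t) A"
proof -
  obtain C where "C > 0" "\<forall>x\<in>space M. \<forall>t\<ge>0. \<forall>s\<in>{0<..<1}. \<phi> x (s * t) \<le> C * s powr pm * \<phi> x t"
    using lower_type unfolding uniformly_lower_type_def by blast
  then show thesis by (intro that[of C] Q_scale) auto
qed

lemma Q_mono_arg: "0 \<le> s \<Longrightarrow> s \<le> t \<Longrightarrow> A \<in> sets M \<Longrightarrow> emeasure (Q s) A \<le> emeasure (Q t) A"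
  by (auto simp: emeasure_Q intro!: nn_integral_mono mult_right_mono ennreal_leI phi_mono)

text \<open>The admissible scales in the infimum defining \<open>WL_norm\<close>. They are upward
  closed (\<open>bounds_mono\<close>), so two functions of finite norm have a common scale.\<close>

definition bounds :: "('a \<Rightarrow> ereal) \<Rightarrow> real \<Rightarrow> bool" where
  "bounds X l \<longleftrightarrow> 0 < l \<and> (\<forall>\<alpha>>0. emeasure (Q (\<alpha> / l)) (level X \<alpha>) \<le> 1)"

lemma WL_norm_eq:
  assumes "X \<in> borel_measurable M"
  shows "WL_norm M \<phi> X = Inf (ennreal ` {l. bounds X l})"
proof -
  have "(SUP \<alpha>\<in>{0<..}. phi_meas M \<phi> {x \<in> space M. \<bar>X x\<bar> > ereal \<alpha>} (\<alpha> / l)) \<le> 1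
      \<longleftrightarrow> (\<forall>\<alpha>>0. emeasure (Q (\<alpha> / l)) (level X \<alpha>) \<le> 1)" if "0 < l" for l :: real
    using that level_sets[OF assms]
    by (auto simp: SUP_le_iff phi_meas_eq level_def)
  then have "{ennreal l | l. 0 < l \<and>
       (SUP \<alpha>\<in>{0<..}. phi_meas M \<phi> {x \<in> space M. \<bar>X x\<bar> > ereal \<alpha>} (\<alpha> / l)) \<le> 1} = ennreal ` {l. bounds X l}"
    unfolding bounds_def by blast
  then show ?thesis unfolding WL_norm_def by simp
qed

lemma bounds_mono:
  assumes "X \<in> borel_measurable M" "bounds X l" "l \<le> l'"
  shows "bounds X l'"
proof -
  have "emeasure (Q (\<alpha> / l')) (level X \<alpha>) \<le> 1" if "\<alpha> > 0" for \<alpha>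
  proof -
    have "emeasure (Q (\<alpha> / l')) (level X \<alpha>) \<le> emeasure (Q (\<alpha> / l)) (level X \<alpha>)"
      using assms that by (intro Q_mono_arg) (auto simp: bounds_def frac_le)
    also have "\<dots> \<le> 1" using assms that by (auto simp: bounds_def)
    finally show ?thesis .
  qed
  then show ?thesis using assms by (auto simp: bounds_def)
qed

lemma WL_norm_le_of_bounds:
  "X \<in> borel_measurable M \<Longrightarrow> bounds X l \<Longrightarrow> WL_norm M \<phi> X \<le> ennreal l"
  by (subst WL_norm_eq) (auto intro: Inf_lower)

text \<open>The infimum defining a norm need not be attained, so scales are taken below an arbitrary
  \<open>m\<close> above both norms, and the larger of the two serves both functions. If one norm is
  infinite there is no such \<open>m\<close> and nothing is left to show.\<close>

lemma le_cmult_max_WL_normI: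
  assumes Y: "Y1 \<in> borel_measurable M" "Y2 \<in> borel_measurable M" and "C > 0"
    and le: "\<And>l. bounds Y1 l \<Longrightarrow> bounds Y2 l \<Longrightarrow> a \<le> ennreal (C * l)"
  shows "a \<le> ennreal C * max (WL_norm M \<phi> Y1) (WL_norm M \<phi> Y2)"
proof -
  have C: "ennreal C * ennreal (1 / C) = 1"
    using \<open>C > 0\<close> by (simp add: ennreal_mult'[symmetric])
  have "ennreal (1 / C) * a \<le> max (WL_norm M \<phi> Y1) (WL_norm M \<phi> Y2)"
  proof (rule dense_ge)
    fix m assume m: "max (WL_norm M \<phi> Y1) (WL_norm M \<phi> Y2) < m"
    obtain l1 where l1: "bounds Y1 l1" "ennreal l1 < m"
      using m Y by (auto simp: WL_norm_eq Inf_less_iff)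
    obtain l2 where l2: "bounds Y2 l2" "ennreal l2 < m"
      using m Y by (auto simp: WL_norm_eq Inf_less_iff)
    define l where "l = max l1 l2"
    have l: "l > 0" using l1 by (auto simp: l_def bounds_def)
    have "a \<le> ennreal (C * l)"
      using l1 l2 Y by (intro le) (auto simp: l_def intro: bounds_mono)
    then have "ennreal (1 / C) * a \<le> ennreal (1 / C) * ennreal (C * l)"
      by (intro mult_left_mono) auto
    also have "\<dots> = ennreal l"
      using \<open>C > 0\<close> l by (simp add: ennreal_mult'[symmetric])
    also have "\<dots> \<le> m" using l1 l2 by (auto simp: l_def max_def)
    finally show "ennreal (1 / C) * a \<le> m" .
  qed
  then have "ennreal C * (ennreal (1 / C) * a) \<le> ennreal C * max (WL_norm M \<phi> Y1) (WL_norm M \<phi> Y2)"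
    by (intro mult_left_mono) auto
  then show ?thesis by (simp add: mult.assoc[symmetric] C)
qed

text \<open>Two controlling functions are allowed because the maximal function is only controlled by the
  square function and the conditional square function together.\<close>

definition weak_type_bound ::
  "real \<Rightarrow> (('a \<Rightarrow> ereal) \<Rightarrow> ('a \<Rightarrow> ereal) \<Rightarrow> ('a \<Rightarrow> ereal) \<Rightarrow> bool) \<Rightarrow> bool" where
  "weak_type_bound C R \<longleftrightarrow> 0 < C \<and>
    (\<forall>X\<in>borel_measurable M. \<forall>Y1\<in>borel_measurable M. \<forall>Y2\<in>borel_measurable M. R X Y1 Y2 \<longrightarrow>
      WL_norm M \<phi> X \<le> ennreal C * max (WL_norm M \<phi> Y1) (WL_norm M \<phi> Y2))"

lemma weak_type_boundI:
  assumes "0 < C" "\<And>X Y1 Y2. X \<in> borel_measurable M \<Longrightarrow> Y1 \<in> borel_measurable M \<Longrightarrow> Y2 \<in> borel_measurable M \<Longrightarrow>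
    R X Y1 Y2 \<Longrightarrow> WL_norm M \<phi> X \<le> ennreal C * max (WL_norm M \<phi> Y1) (WL_norm M \<phi> Y2)"
  shows "weak_type_bound C R"
  using assms unfolding weak_type_bound_def by blast

lemma weak_type_boundD:
  assumes "weak_type_bound C R"
  shows "0 < C" "X \<in> borel_measurable M \<Longrightarrow> Y1 \<in> borel_measurable M \<Longrightarrow> Y2 \<in> borel_measurable M \<Longrightarrow>
    R X Y1 Y2 \<Longrightarrow> WL_norm M \<phi> X \<le> ennreal C * max (WL_norm M \<phi> Y1) (WL_norm M \<phi> Y2)"
  using assms unfolding weak_type_bound_def by blast+

definition level_bounded :: "real \<Rightarrow> ('a \<Rightarrow> ereal) \<Rightarrow> ('a \<Rightarrow> ereal) \<Rightarrow> ('a \<Rightarrow> ereal) \<Rightarrow> bool" where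
  "level_bounded B X Y1 Y2 \<longleftrightarrow>
    (\<forall>l \<alpha>. bounds Y1 l \<longrightarrow> bounds Y2 l \<longrightarrow> 0 < \<alpha> \<longrightarrow> emeasure (Q (\<alpha> / l)) (level X \<alpha>) \<le> ennreal B)"

text \<open>The weight \<open>t\<close> stays the same on both sides while the level doubles. In
  this form the inequality can be proved with conditional expectations; the coupling of
  \<open>t\<close> to the level enters only in \<open>good_lambda_ineq_weak_type\<close>.\<close>

definition good_lambda_ineq ::
  "real \<Rightarrow> real \<Rightarrow> real \<Rightarrow> ('a \<Rightarrow> ereal) \<Rightarrow> ('a \<Rightarrow> ereal) \<Rightarrow> ('a \<Rightarrow> ereal) \<Rightarrow> bool" where
  "good_lambda_ineq \<epsilon> B \<delta> X Y1 Y2 \<longleftrightarrow>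
    (\<forall>t>0. \<forall>\<alpha>>0. emeasure (Q t) (level X (2 * \<alpha>)) \<le> ennreal \<epsilon> * emeasure (Q t) (level X \<alpha>)
      + ennreal B * (emeasure (Q t) (level Y1 (\<delta> * \<alpha>)) + emeasure (Q t) (level Y2 (\<delta> * \<alpha>))))"

text \<open>By the lower type with \<open>s = 1 / C\<close>, enlarging the scale by \<open>C\<close>
  multiplies the masses by at most \<open>D * C powr (- pm)\<close>, which beats \<open>B\<close>
  once \<open>C\<close> is large.\<close>

lemma level_bounded_weak_type:
  assumes "B \<ge> 0"
  shows "\<exists>C. weak_type_bound C (level_bounded B)"
proof -
  obtain D where D: "D > 0" "\<And>s t A. 0 < s \<Longrightarrow> s < 1 \<Longrightarrow> 0 \<le> t \<Longrightarrow> A \<in> sets M \<Longrightarrow>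
    emeasure (Q (s * t)) A \<le> ennreal (D * s powr pm) * emeasure (Q t) A"
    using lower_typeE by metis
  \<comment> \<open>The first summand makes \<open>C powr pm\<close> at least
    \<open>1 + D * B\<close>; the added 1 gives \<open>C > 1\<close>, as the lower type needs
    \<open>1 / C < 1\<close>.\<close>
  define C where "C = (1 + D * B) powr (1 / pm) + 1"
  have C1: "C > 1" using assms D by (auto simp: C_def add_nonneg_eq_0_iff)
  have DB: "1 + D * B > 0" using assms D by (simp add: add_pos_nonneg)
  have "1 + D * B = ((1 + D * B) powr (1 / pm)) powr pm"
    using DB pm_pos by (simp add: powr_powr)
  also have "\<dots> \<le> C powr pm"
    using assms D pm_pos by (intro powr_mono2) (auto simp: C_def)
  finally have "D * B \<le> C powr pm" by simp
  then have CB: "D * (1 / C) powr pm * B \<le> 1"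
    using C1 by (simp add: powr_divide divide_simps mult_ac)
  have "weak_type_bound C (level_bounded B)"
  proof (rule weak_type_boundI)
    show "C > 0" using C1 by simp
    fix X Y1 Y2 :: "'a \<Rightarrow> ereal"
    assume meas: "X \<in> borel_measurable M" "Y1 \<in> borel_measurable M" "Y2 \<in> borel_measurable M"
      and "level_bounded B X Y1 Y2"
    then have B: "\<And>l \<alpha>. bounds Y1 l \<Longrightarrow> bounds Y2 l \<Longrightarrow> \<alpha> > 0 \<Longrightarrow> emeasure (Q (\<alpha> / l)) (level X \<alpha>) \<le> ennreal B"
      unfolding level_bounded_def by blast
    show "WL_norm M \<phi> X \<le> ennreal C * max (WL_norm M \<phi> Y1) (WL_norm M \<phi> Y2)"
    proof (rule le_cmult_max_WL_normI[OF meas(2,3)])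
      show "C > 0" using C1 by simp
      fix l assume l: "bounds Y1 l" "bounds Y2 l"
      have "emeasure (Q (\<alpha> / (C * l))) (level X \<alpha>) \<le> 1" if "\<alpha> > 0" for \<alpha>
      proof -
        have "emeasure (Q (\<alpha> / (C * l))) (level X \<alpha>) = emeasure (Q ((1 / C) * (\<alpha> / l))) (level X \<alpha>)"
          by simp
        also have "\<dots> \<le> ennreal (D * (1 / C) powr pm) * emeasure (Q (\<alpha> / l)) (level X \<alpha>)"
          using l that meas C1 by (intro D) (auto simp: bounds_def)
        also have "\<dots> \<le> ennreal (D * (1 / C) powr pm) * ennreal B"
          using B[OF l that] by (intro mult_left_mono) auto
        also have "\<dots> = ennreal (D * (1 / C) powr pm * B)"
          using D assms by (simp add: ennreal_mult'[symmetric])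
        also have "\<dots> \<le> 1" using CB by (simp add: ennreal_le_1)
        finally show ?thesis .
      qed
      then have "bounds X (C * l)" using l C1 by (auto simp: bounds_def)
      then show "WL_norm M \<phi> X \<le> ennreal (C * l)" using meas by (intro WL_norm_le_of_bounds)
    qed
  qed
  then show ?thesis ..
qed

text \<open>With \<open>N a\<close> the mass of the set above \<open>a\<close> in the weight at
  \<open>a / l\<close>, the inequality becomes \<open>N (2 * a) \<le> N a / 2 + b\<close>. The
  supremum of \<open>N\<close> over all levels may be infinite, so the first term cannot be
  subtracted and is iterated away. The order of quantifiers matters: \<open>\<epsilon>\<close> comes
  from the upper type alone, and later proofs tune \<open>B\<close> and \<open>\<delta>\<close> to
  it.\<close>

lemma good_lambda_ineq_weak_type:
  "\<exists>\<epsilon>>0. \<forall>B\<ge>0. \<forall>\<delta>>0. \<exists>C. weak_type_bound C (good_lambda_ineq \<epsilon> B \<delta>)"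
proof -
  obtain U where U: "U > 0" "\<And>s t A. 1 \<le> s \<Longrightarrow> 0 \<le> t \<Longrightarrow> A \<in> sets M \<Longrightarrow>
    emeasure (Q (s * t)) A \<le> ennreal (U * s powr pp) * emeasure (Q t) A"
    using upper_typeE by metis
  define u where "u = U * 2 powr pp"
  have u: "u > 0" using U by (simp add: u_def)
  \<comment> \<open>Chosen so that \<open>u * \<epsilon> = 1 / 2\<close>, with \<open>u\<close> the
    cost of doubling the weight argument.\<close>
  define \<epsilon> where "\<epsilon> = 1 / (2 * u)"
  have eps: "\<epsilon> > 0" using u by (simp add: \<epsilon>_def)
  have "\<exists>C. weak_type_bound C (good_lambda_ineq \<epsilon> B \<delta>)" if B: "B \<ge> 0" and \<delta>: "0 < \<delta>" for B \<delta>
  proof -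
    \<comment> \<open>Admissibility of \<open>l\<close> bounds the mass of
      \<open>level Y (\<delta> * a)\<close> in the weight at \<open>\<delta> * a / l\<close>; the
      factor \<open>max 1 (1 / \<delta>)\<close> leads up to the weight at \<open>a / l\<close>. The
      1 is there because the upper type requires \<open>s \<ge> 1\<close>.\<close>
    define v where "v = U * (max 1 (1 / \<delta>)) powr pp"
    have v: "v \<ge> 0" using U by (simp add: v_def)
    define b where "b = u * (B * (2 * v))"
    have b: "b \<ge> 0" using u v B by (simp add: b_def)
    obtain C where C: "weak_type_bound C (level_bounded (2 * b))"
      using level_bounded_weak_type[of "2 * b"] b by auto
    have "weak_type_bound C (good_lambda_ineq \<epsilon> B \<delta>)"
    proof (rule weak_type_boundI[OF weak_type_boundD(1)[OF C]])
      fix X Y1 Y2 :: "'a \<Rightarrow> ereal"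
      assume meas [measurable]: "X \<in> borel_measurable M" "Y1 \<in> borel_measurable M" "Y2 \<in> borel_measurable M"
        and ineq: "good_lambda_ineq \<epsilon> B \<delta> X Y1 Y2"
      note * = ineq[unfolded good_lambda_ineq_def]
      show "WL_norm M \<phi> X \<le> ennreal C * max (WL_norm M \<phi> Y1) (WL_norm M \<phi> Y2)"
      proof (rule weak_type_boundD(2)[OF C meas], unfold level_bounded_def, intro allI impI)
        fix l \<alpha> :: real assume l: "bounds Y1 l" "bounds Y2 l" and \<alpha>: "0 < \<alpha>"
        have lpos: "l > 0" using l by (simp add: bounds_def)
        define N where "N a = emeasure (Q (a / l)) (level X a)" for a
        have Yv: "emeasure (Q (a / l)) (level Y (\<delta> * a)) \<le> ennreal v" if "bounds Y l" "Y \<in> borel_measurable M" "a > 0" for Y a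
        proof -
          have [measurable]: "Y \<in> borel_measurable M" by fact
          have "a \<le> (max 1 (1 / \<delta>)) * (\<delta> * a)"
            using \<delta> that by (auto simp: max_def field_simps)
          then have "emeasure (Q (a / l)) (level Y (\<delta> * a)) \<le> emeasure (Q (max 1 (1 / \<delta>) * (\<delta> * a / l))) (level Y (\<delta> * a))"
            using that lpos by (intro Q_mono_arg) (auto simp: divide_right_mono)
          also have "\<dots> \<le> ennreal v * emeasure (Q (\<delta> * a / l)) (level Y (\<delta> * a))"
            unfolding v_def using \<delta> that lpos by (intro U) auto
          also have "\<dots> \<le> ennreal v * 1"
            using that \<delta> by (intro mult_left_mono) (auto simp: bounds_def)
          finally show ?thesis by simp
        qed
        have step: "N (2 * a) \<le> ennreal (1 / 2) * N a + ennreal b" if a: "a > 0" for a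
        proof -
          have "N (2 * a) = emeasure (Q (2 * (a / l))) (level X (2 * a))" by (simp add: N_def)
          also have "\<dots> \<le> ennreal u * emeasure (Q (a / l)) (level X (2 * a))"
            unfolding u_def using a lpos by (intro U) auto
          also have "\<dots> \<le> ennreal u * (ennreal \<epsilon> * N a + ennreal B * (ennreal v + ennreal v))"
            using a lpos l unfolding N_def
            by (intro mult_left_mono order.trans[OF *[rule_format, of "a / l" a]] add_mono Yv order.refl) auto
          also have "\<dots> = ennreal (1 / 2) * N a + ennreal b"
            using u B v eps by (simp add: b_def \<epsilon>_def distrib_left ennreal_mult'[symmetric] mult.assoc[symmetric]
                ennreal_plus[symmetric] del: ennreal_plus)
          finally show ?thesis .
        qed
        \<comment> \<open>The second summand is \<open>b\<close> times a partial sum of the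
          geometric series with ratio 1/2.\<close>
        have iter: "N a \<le> ennreal ((1 / 2) ^ k) * N (a / 2 ^ k) + ennreal (2 * b - 2 * b * (1 / 2) ^ k)" if a: "a > 0" for a k
        proof (induction k)
          case (Suc k)
          have le1: "(1 / 2) ^ k \<le> (1::real)" by (simp add: power_le_one)
          have "N a \<le> ennreal ((1 / 2) ^ k) * N (a / 2 ^ k) + ennreal (2 * b - 2 * b * (1 / 2) ^ k)" by fact
          also have "\<dots> \<le> ennreal ((1 / 2) ^ k) * (ennreal (1 / 2) * N (a / 2 ^ Suc k) + ennreal b) + ennreal (2 * b - 2 * b * (1 / 2) ^ k)"
          proof (rule add_right_mono[OF mult_left_mono])
            show "N (a / 2 ^ k) \<le> ennreal (1 / 2) * N (a / 2 ^ Suc k) + ennreal b"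
              using step[of "a / 2 ^ Suc k"] a by simp
          qed simp
          also have "\<dots> = (ennreal ((1 / 2) ^ k) * ennreal (1 / 2)) * N (a / 2 ^ Suc k)
              + (ennreal ((1 / 2) ^ k) * ennreal b + ennreal (2 * b - 2 * b * (1 / 2) ^ k))"
            by (simp only: distrib_left mult.assoc add.assoc)
          also have "ennreal ((1 / 2) ^ k) * ennreal (1 / 2) = ennreal ((1 / 2) ^ Suc k)"
            by (subst ennreal_mult[symmetric]) (auto simp: mult.commute)
          also have "ennreal ((1 / 2) ^ k) * ennreal b + ennreal (2 * b - 2 * b * (1 / 2) ^ k)
              = ennreal ((1 / 2) ^ k * b + (2 * b - 2 * b * (1 / 2) ^ k))"
            using b le1 by (subst ennreal_mult[symmetric], simp, simp, subst ennreal_plus) (auto simp: mult_left_le)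
          also have "(1 / 2) ^ k * b + (2 * b - 2 * b * (1 / 2) ^ k) = 2 * b - 2 * b * (1 / 2) ^ Suc k"
            by (simp add: field_simps)
          finally show ?case .
        qed simp
        \<comment> \<open>Monotonicity of \<open>\<phi>\<close> in its second argument bounds every
          \<open>N (\<alpha> / 2 ^ k)\<close> by this one number, which is finite by the standing
          integrability assumption.\<close>
        define c where "c = emeasure (Q (\<alpha> / l)) (space M)"
        have c: "c < \<infinity>" unfolding c_def using \<alpha> lpos by (intro Q_finite) auto
        have "N \<alpha> \<le> ennreal ((1 / 2) ^ k) * c + ennreal (2 * b)" for k
        proof -
          have "N (\<alpha> / 2 ^ k) \<le> emeasure (Q (\<alpha> / l)) (level X (\<alpha> / 2 ^ k))"
            unfolding N_def using \<alpha> lpos by (intro Q_mono_arg) (auto simp: field_simps)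
          also have "\<dots> \<le> c" unfolding c_def by (intro emeasure_mono) (auto simp: level_def)
          finally have "N (\<alpha> / 2 ^ k) \<le> c" .
          then show ?thesis
            using b by (intro order.trans[OF iter[OF \<alpha>, of k]] add_mono mult_left_mono ennreal_leI) auto
        qed
        moreover have "(\<lambda>k. ennreal ((1 / 2) ^ k) * c + ennreal (2 * b)) \<longlonglongrightarrow> ennreal 0 * c + ennreal (2 * b)"
          using c by (intro tendsto_add tendsto_mult_ennreal tendsto_ennrealI tendsto_const LIMSEQ_power_zero) auto
        ultimately have "N \<alpha> \<le> ennreal 0 * c + ennreal (2 * b)"
          by (intro LIMSEQ_le_const) auto
        then show "emeasure (Q (\<alpha> / l)) (level X \<alpha>) \<le> ennreal (2 * b)" by (simp add: N_def)
      qed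
    qed
    then show ?thesis ..
  qed
  then show ?thesis using eps by blast
qed

end

section \<open>Weights satisfying the A-infinity condition\<close>

text \<open>\<open>disjointed U n\<close> is the event that the sets \<open>U\<close> are entered
  for the first time at \<open>n\<close>. An estimate on each of these events suffices, since they
  partition the union that contains \<open>G\<close>.\<close>

lemma emeasure_le_first_entrance:
  assumes U: "\<And>n. U n \<in> sets N" and G: "G \<in> sets N" "G \<subseteq> (\<Union>n. U n)"
    and le: "\<And>n::nat. emeasure N (G \<inter> disjointed U n) \<le> c * emeasure N (disjointed U n)"
  shows "emeasure N G \<le> c * emeasure N (\<Union>n. U n)"
proof -
  have D: "disjointed U n \<in> sets N" for n
    using sets.range_disjointed_sets[of U N] U by auto
  have "G = (\<Union>n. G \<inter> disjointed U n)"
    using G UN_disjointed_eq[of U] by auto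
  then have "emeasure N G = emeasure N (\<Union>n. G \<inter> disjointed U n)" by simp
  also have "\<dots> = (\<Sum>n. emeasure N (G \<inter> disjointed U n))"
    using D G by (intro suminf_emeasure[symmetric])
      (auto intro!: disjoint_family_on_bisimulation[OF disjoint_family_disjointed[of U]])
  also have "\<dots> \<le> (\<Sum>n. c * emeasure N (disjointed U n))"
    by (intro suminf_le le) auto
  also have "\<dots> = c * (\<Sum>n. emeasure N (disjointed U n))"
    by (rule ennreal_suminf_cmult)
  also have "(\<Sum>n. emeasure N (disjointed U n)) = emeasure N (\<Union>n. disjointed U n)"
    using D by (intro suminf_emeasure) (auto simp: disjoint_family_disjointed)
  finally show ?thesis by (simp add: UN_disjointed_eq)
qed

context weighted_basis
begin

text \<open>The first entrance into an adapted sequence of sets is a stopping time.\<close>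

lemma disjointed_F: "(\<And>n. U n \<in> sets (F n)) \<Longrightarrow> disjointed U n \<in> sets (F n)"
  unfolding disjointed_def by (intro sets.Diff sets.finite_UN) (auto intro: sets_F_mono[OF less_imp_le])

lemma phi_cond_measurable [measurable]: "phi_cond M F \<phi> n t \<in> borel_measurable (F n)"
  by (simp add: phi_cond_def)

lemma phi_cond_measurable_M [measurable]: "phi_cond M F \<phi> n t \<in> borel_measurable M"
  by (rule measurable_F_M[OF phi_cond_measurable])

lemma phi_cond_integral:
  "0 \<le> t \<Longrightarrow> f \<in> borel_measurable (F n) \<Longrightarrow>
    (\<integral>\<^sup>+x. f x * phi_cond M F \<phi> n t x \<partial>M) = (\<integral>\<^sup>+x. f x * ennreal (\<phi> x t) \<partial>M)"
  unfolding phi_cond_def by (rule nn_cond_exp_mult_integral) auto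

lemma phi_cond_finite: "0 < t \<Longrightarrow> AE x in M. phi_cond M F \<phi> n t x = ennreal (enn2real (phi_cond M F \<phi> n t x))"
proof -
  assume t: "0 < t"
  have "(\<integral>\<^sup>+x. 1 * phi_cond M F \<phi> n t x \<partial>M) < \<infinity>"
    using t mo by (subst phi_cond_integral) (auto simp: musielak_orlicz_def)
  then have "AE x in M. phi_cond M F \<phi> n t x \<noteq> \<infinity>"
    by (intro nn_integral_PInf_AE) auto
  then show ?thesis by eventually_elim (auto simp: less_top)
qed

text \<open>The conditional Chebyshev inequality, applied to a negative power of the weight.\<close>

lemma A_weight_lower_bound:
  assumes "A_infinity M F \<phi>" and eps: "\<epsilon> > 0"
  obtains \<theta> where "\<theta> > 0" "\<And>t n C. 0 < t \<Longrightarrow> C \<in> sets (F n) \<Longrightarrow>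
    prob (C \<inter> {x \<in> space M. \<phi> x t < \<theta> * enn2real (phi_cond M F \<phi> n t x)}) \<le> \<epsilon> * prob C"
proof -
  obtain q where q: "q \<ge> 1" "A_weight M F \<phi> q" using assms by (auto simp: A_infinity_def)
  show thesis
  proof (cases "q = 1")
    case True
    then obtain K where K: "K > 0" "\<And>t n. 0 < t \<Longrightarrow> AE x in M. phi_cond M F \<phi> n t x * ennreal (1 / \<phi> x t) \<le> ennreal K"
      using q by (auto simp: A_weight_def)
    show thesis
    proof (rule that)
      \<comment> \<open>For \<open>q = 1\<close> the weight dominates its conditional expectation up
        to the factor \<open>K\<close>, so the exceptional set is null.\<close>
      show "1 / K > 0" using K by simp
      fix t :: real and n C assume t: "0 < t" and C: "C \<in> sets (F n)"
      have [measurable]: "C \<in> sets M" by (rule sets_F_M[OF C])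
      have "AE x in M. \<not> (\<phi> x t < 1 / K * enn2real (phi_cond M F \<phi> n t x))"
        using K(2)[OF t, of n] phi_cond_finite[OF t, of n] AE_space
      proof eventually_elim
        case (elim x)
        define W where "W = enn2real (phi_cond M F \<phi> n t x)"
        have W: "phi_cond M F \<phi> n t x = ennreal W" "W \<ge> 0" using elim by (auto simp: W_def)
        have p: "\<phi> x t > 0" using elim t by (simp add: phi_pos)
        have "W * (1 / \<phi> x t) \<le> K"
          using elim(1) W p K(1) by (simp add: ennreal_mult'[symmetric])
        then have "W / K \<le> \<phi> x t" using K p by (simp add: field_simps)
        then show ?case by (simp add: W_def)
      qed
      then have "prob (C \<inter> {x \<in> space M. \<phi> x t < 1 / K * enn2real (phi_cond M F \<phi> n t x)}) = 0"
        using t by (subst prob_eq_0) auto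
      then show "prob (C \<inter> {x \<in> space M. \<phi> x t < 1 / K * enn2real (phi_cond M F \<phi> n t x)}) \<le> \<epsilon> * prob C"
        using eps by simp
    qed
  next
    case False
    define r where "r = 1 / (q - 1)"
    have r: "r > 0" "(q - 1) * r = 1" "- 1 / (q - 1) = - r" using False q by (auto simp: r_def)
    define V where "V t n = nn_cond_exp M (F n) (\<lambda>y. ennreal (\<phi> y t powr - r))" for t n
    obtain K where K: "K > 0" "\<And>t n. 0 < t \<Longrightarrow> AE x in M. phi_cond M F \<phi> n t x * ennreal_powr (V t n x) (q - 1) \<le> ennreal K"
      using q False unfolding A_weight_def V_def r(3) by auto
    \<comment> \<open>Solves \<open>(\<theta> * K) powr r = \<epsilon>\<close>, the left side being
      what Chebyshev's inequality for the power \<open>- r\<close> of the weight produces.\<close>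
    define \<theta> where "\<theta> = \<epsilon> powr (q - 1) / K"
    have th: "\<theta> > 0" using K eps by (simp add: \<theta>_def)
    show thesis
    proof (rule that[OF th])
      fix t :: real and n C assume t: "0 < t" and C: "C \<in> sets (F n)"
      have [measurable]: "C \<in> sets (F n)" "C \<in> sets M" using C sets_F_M[OF C] by auto
      define W where "W x = enn2real (phi_cond M F \<phi> n t x)" for x
      have [measurable]: "W \<in> borel_measurable (F n)" "W \<in> borel_measurable M"
        unfolding W_def by measurable
      let ?B = "{x \<in> space M. \<phi> x t < \<theta> * W x}"
      have [measurable]: "(\<lambda>y. \<phi> y t) \<in> borel_measurable M" using t by simp
      have "emeasure M (C \<inter> ?B) = (\<integral>\<^sup>+x. indicator (C \<inter> ?B) x \<partial>M)"
        using t by (simp)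
      also have "\<dots> \<le> (\<integral>\<^sup>+x. (indicator C x * ennreal ((\<theta> * W x) powr r)) * ennreal (\<phi> x t powr - r) \<partial>M)"
      proof (intro nn_integral_mono)
        fix x assume x: "x \<in> space M"
        have p: "\<phi> x t > 0" using x t by (simp add: phi_pos)
        have "1 \<le> (\<theta> * W x) powr r * \<phi> x t powr - r" if "\<phi> x t < \<theta> * W x"
        proof -
          have "1 = \<phi> x t powr r * \<phi> x t powr - r" using p by (simp add: powr_add[symmetric])
          also have "\<dots> \<le> (\<theta> * W x) powr r * \<phi> x t powr - r"
            using p r that by (intro mult_right_mono powr_mono2) auto
          finally show ?thesis .
        qed
        then show "indicator (C \<inter> ?B) x \<le> (indicator C x * ennreal ((\<theta> * W x) powr r)) * ennreal (\<phi> x t powr - r)"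
          by (auto split: split_indicator simp: ennreal_mult'[symmetric])
      qed
      also have "\<dots> = (\<integral>\<^sup>+x. (indicator C x * ennreal ((\<theta> * W x) powr r)) * V t n x \<partial>M)"
        unfolding V_def by (rule nn_cond_exp_mult_integral[symmetric]) measurable
      also have "\<dots> \<le> (\<integral>\<^sup>+x. ennreal \<epsilon> * indicator C x \<partial>M)"
      proof (intro nn_integral_mono_AE)
        show "AE x in M. indicator C x * ennreal ((\<theta> * W x) powr r) * V t n x \<le> ennreal \<epsilon> * indicator C x"
          using K(2)[OF t, of n] phi_cond_finite[OF t, of n]
        proof eventually_elim
          case (elim x)
          have W: "phi_cond M F \<phi> n t x = ennreal (W x)" "W x \<ge> 0" using elim by (auto simp: W_def)
          have "ennreal ((\<theta> * W x) powr r) * V t n x \<le> ennreal \<epsilon>"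
          \<comment> \<open>Where \<open>W\<close> vanishes, the weight condition gives no bound on
            \<open>V\<close>; there the factor \<open>(\<theta> * W x) powr r\<close> is
            zero.\<close>
          proof (cases "W x = 0")
            case False
            then have Wp: "W x > 0" using W by simp
            have "V t n x \<noteq> \<infinity>"
              using elim(1) W Wp by (auto simp: ennreal_powr_def ennreal_mult_top top_unique)
            then obtain v where v: "V t n x = ennreal v" "v \<ge> 0" by (cases "V t n x") auto
            have *: "W x * v powr (q - 1) \<le> K"
              using elim(1) W v K by (simp add: ennreal_powr_def ennreal_mult'[symmetric])
            have "(\<theta> * W x) powr r * v = (\<theta> * W x) powr r * (v powr (q - 1)) powr r"
              using v r by (simp add: powr_powr)
            also have "\<dots> = (\<theta> * (W x * v powr (q - 1))) powr r"
              using th W by (simp add: powr_mult[symmetric] mult_ac)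
            also have "\<dots> \<le> (\<theta> * K) powr r"
              using th W * r by (intro powr_mono2 mult_left_mono) auto
            also have "\<dots> = \<epsilon>" using K eps r by (simp add: \<theta>_def powr_powr)
            finally show ?thesis using v by (simp add: ennreal_mult'[symmetric] ennreal_leI)
          qed (use r in simp)
          then show ?case by (auto split: split_indicator)
        qed
      qed
      also have "\<dots> = ennreal \<epsilon> * emeasure M C" by (simp add: nn_integral_cmult_indicator)
      finally show "prob (C \<inter> {x \<in> space M. \<phi> x t < \<theta> * enn2real (phi_cond M F \<phi> n t x)}) \<le> \<epsilon> * prob C"
        using eps by (simp add: emeasure_eq_measure ennreal_mult'[symmetric] W_def)
    qed
  qed
qed

text \<open>Testing against all \<open>C\<close> in \<open>F n\<close> below \<open>D\<close>
  expresses that the conditional probability of \<open>A\<close> is at least \<open>p\<close> on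
  \<open>D\<close>. The test on the set where it is smaller than \<open>p\<close> shows that this
  set is null; after that \<open>u\<close> is carried through the conditional expectation.\<close>

lemma nn_integral_ge_of_cond_prob:
  assumes A: "A \<in> sets M" and D: "D \<in> sets (F n)" and u: "u \<in> borel_measurable (F n)"
    and p: "0 \<le> p" "\<And>C. C \<in> sets (F n) \<Longrightarrow> C \<subseteq> D \<Longrightarrow> p * prob C \<le> prob (A \<inter> C)"
  shows "ennreal p * (\<integral>\<^sup>+x. u x * indicator D x \<partial>M) \<le> (\<integral>\<^sup>+x. u x * indicator (A \<inter> D) x \<partial>M)"
proof -
  define g where "g = nn_cond_exp M (F n) (indicator A)"
  have gF [measurable]: "g \<in> borel_measurable (F n)" by (simp add: g_def)
  have [measurable]: "A \<in> sets M" "D \<in> sets (F n)" "D \<in> sets M" "u \<in> borel_measurable (F n)" "u \<in> borel_measurable M"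
    "g \<in> borel_measurable M"
    using A D u sets_F_M[OF D] measurable_F_M[OF u] measurable_F_M[OF gF] by simp_all
  define C where "C = {x \<in> space M. x \<in> D \<and> g x < ennreal p}"
  have C: "C \<in> sets (F n)"
  proof -
    have "C = {x \<in> space (F n). x \<in> D \<and> g x < ennreal p}" by (simp add: C_def)
    also have "\<dots> \<in> sets (F n)" by measurable
    finally show ?thesis .
  qed
  then have [measurable]: "C \<in> sets (F n)" "C \<in> sets M" using sets_F_M by auto
  have Cg: "(\<integral>\<^sup>+x. indicator C x * g x \<partial>M) = ennreal (prob (A \<inter> C))"
  proof -
    have "(\<integral>\<^sup>+x. indicator C x * g x \<partial>M) = (\<integral>\<^sup>+x. indicator C x * indicator A x \<partial>M)"
      unfolding g_def by (rule nn_cond_exp_mult_integral) auto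
    also have "\<dots> = (\<integral>\<^sup>+x. indicator (A \<inter> C) x \<partial>M)"
      by (intro nn_integral_cong) (auto split: split_indicator)
    also have "\<dots> = ennreal (prob (A \<inter> C))" by (simp add: emeasure_eq_measure)
    finally show ?thesis .
  qed
  have "AE x in M. ennreal p * indicator C x \<le> indicator C x * g x"
  proof (rule ccontr)
    assume *: "\<not> (AE x in M. ennreal p * indicator C x \<le> indicator C x * g x)"
    have "(\<integral>\<^sup>+x. indicator C x * g x \<partial>M) < (\<integral>\<^sup>+x. ennreal p * indicator C x \<partial>M)"
      using * Cg by (intro nn_integral_less) (auto simp: C_def split: split_indicator)
    also have "\<dots> = ennreal (p * prob C)"
      using p by (simp add: nn_integral_cmult_indicator emeasure_eq_measure ennreal_mult'[symmetric])
    also have "\<dots> \<le> ennreal (prob (A \<inter> C))"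
      using p(2)[OF C] by (intro ennreal_leI) (auto simp: C_def)
    finally show False using Cg by simp
  qed
  then have ge: "AE x in M. x \<in> D \<longrightarrow> ennreal p \<le> g x"
    using AE_space by eventually_elim (auto simp: C_def split: split_indicator_asm)
  have "ennreal p * (\<integral>\<^sup>+x. u x * indicator D x \<partial>M) = (\<integral>\<^sup>+x. ennreal p * (u x * indicator D x) \<partial>M)"
    by (rule nn_integral_cmult[symmetric]) auto
  also have "\<dots> \<le> (\<integral>\<^sup>+x. (u x * indicator D x) * g x \<partial>M)"
    using ge by (intro nn_integral_mono_AE, eventually_elim)
      (auto split: split_indicator simp: mult.commute[of _ "u _"] intro: mult_left_mono)
  also have "\<dots> = (\<integral>\<^sup>+x. (u x * indicator D x) * indicator A x \<partial>M)"
    unfolding g_def by (rule nn_cond_exp_mult_integral) auto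
  also have "\<dots> = (\<integral>\<^sup>+x. u x * indicator (A \<inter> D) x \<partial>M)"
    by (intro nn_integral_cong) (auto split: split_indicator)
  finally show ?thesis .
qed

text \<open>Removing from \<open>A\<close> the set where the weight is below \<open>\<theta>\<close>
  times its conditional expectation costs at most half of the conditional probability. On what
  remains the weight is at least \<open>\<theta>\<close> times an \<open>F n\<close>-measurable
  function that has the same integral over \<open>D\<close> as the weight, so the lower bound passes
  from probabilities to weighted masses.\<close>

lemma A_infinity_sets:
  assumes "A_infinity M F \<phi>" and p: "p > 0"
  obtains c where "c > 0" "\<And>t n A D. 0 < t \<Longrightarrow> A \<in> sets M \<Longrightarrow> D \<in> sets (F n) \<Longrightarrow>
    \<forall>C\<in>sets (F n). C \<subseteq> D \<longrightarrow> p * prob C \<le> prob (A \<inter> C) \<Longrightarrow>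
    ennreal c * emeasure (Q t) D \<le> emeasure (Q t) (A \<inter> D)"
proof -
  obtain \<theta> where th: "\<theta> > 0" "\<And>t n C. 0 < t \<Longrightarrow> C \<in> sets (F n) \<Longrightarrow>
    prob (C \<inter> {x \<in> space M. \<phi> x t < \<theta> * enn2real (phi_cond M F \<phi> n t x)}) \<le> p / 2 * prob C"
    by (rule A_weight_lower_bound[OF assms(1) half_gt_zero[OF p]]) (rule that)
  show thesis
  proof (rule that)
    show "\<theta> * (p / 2) > 0" using th p by simp
    fix t :: real and n A D assume t: "0 < t" and A: "A \<in> sets M" and D: "D \<in> sets (F n)"
      and AD: "\<forall>C\<in>sets (F n). C \<subseteq> D \<longrightarrow> p * prob C \<le> prob (A \<inter> C)"
    define W where "W x = enn2real (phi_cond M F \<phi> n t x)" for x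
    have [measurable]: "W \<in> borel_measurable (F n)" "W \<in> borel_measurable M"
      unfolding W_def by measurable
    have [measurable]: "A \<in> sets M" "D \<in> sets (F n)" "D \<in> sets M" using A D sets_F_M[OF D] by auto
    define B where "B = {x \<in> space M. \<phi> x t < \<theta> * W x}"
    have [measurable]: "(\<lambda>x. \<phi> x t) \<in> borel_measurable M" using t by simp
    have [measurable]: "B \<in> sets M" unfolding B_def by measurable
    have cond: "p / 2 * prob C \<le> prob ((A - B) \<inter> C)" if C: "C \<in> sets (F n)" "C \<subseteq> D" for C
    proof -
      have [measurable]: "C \<in> sets M" using C sets_F_M by auto
      have "p * prob C \<le> prob (A \<inter> C)" using AD C by blast
      also have "\<dots> \<le> prob (((A - B) \<inter> C) \<union> (C \<inter> B))"
        by (intro finite_measure_mono) auto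
      also have "\<dots> \<le> prob ((A - B) \<inter> C) + prob (C \<inter> B)"
        by (intro measure_Un_le) auto
      also have "prob (C \<inter> B) \<le> p / 2 * prob C"
        using th(2)[OF t C(1)] by (simp add: B_def W_def)
      finally show ?thesis by (simp add: field_simps)
    qed
    have "ennreal (\<theta> * (p / 2)) * emeasure (Q t) D = ennreal \<theta> * (ennreal (p / 2) * (\<integral>\<^sup>+x. indicator D x * ennreal (\<phi> x t) \<partial>M))"
    proof -
      have "ennreal (\<theta> * (p / 2)) = ennreal \<theta> * ennreal (p / 2)" using p th by (intro ennreal_mult) auto
      then show ?thesis using t by (simp only: mult.assoc) (simp add: emeasure_Q mult.commute[of "indicator D _"])
    qed
    also have "(\<integral>\<^sup>+x. indicator D x * ennreal (\<phi> x t) \<partial>M) = (\<integral>\<^sup>+x. indicator D x * phi_cond M F \<phi> n t x \<partial>M)"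
      using t by (intro phi_cond_integral[symmetric]) auto
    also have "\<dots> = (\<integral>\<^sup>+x. ennreal (W x) * indicator D x \<partial>M)"
      using phi_cond_finite[OF t, of n] unfolding W_def
      by (intro nn_integral_cong_AE, eventually_elim) (auto split: split_indicator)
    also have "ennreal (p / 2) * \<dots> \<le> (\<integral>\<^sup>+x. ennreal (W x) * indicator ((A - B) \<inter> D) x \<partial>M)"
      using p by (intro nn_integral_ge_of_cond_prob[of _ D n] cond) auto
    also have "ennreal \<theta> * \<dots> = (\<integral>\<^sup>+x. ennreal \<theta> * (ennreal (W x) * indicator ((A - B) \<inter> D) x) \<partial>M)"
      by (rule nn_integral_cmult[symmetric]) auto
    also have "\<dots> \<le> (\<integral>\<^sup>+x. ennreal (\<phi> x t) * indicator (A \<inter> D) x \<partial>M)"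
      using th(1) by (intro nn_integral_mono)
        (auto simp: B_def ennreal_mult'[symmetric] intro!: ennreal_leI split: split_indicator)
    also have "\<dots> = emeasure (Q t) (A \<inter> D)" using t by (simp add: emeasure_Q)
    finally show "ennreal (\<theta> * (p / 2)) * emeasure (Q t) D \<le> emeasure (Q t) (A \<inter> D)"
      by (simp add: mult_left_mono)
  qed
qed

text \<open>\<open>disjointed (U \<alpha>) n\<close> is the event that \<open>X\<close> first passes
  \<open>\<alpha>\<close> at time \<open>n\<close>; the test over all \<open>C\<close> in
  \<open>F n\<close> encodes a bound on a conditional probability given \<open>F n\<close>. Only the
  unweighted measure occurs, so this is a statement about martingales alone.\<close>

definition good_lambda_pair :: "real \<Rightarrow> real \<Rightarrow> ('a \<Rightarrow> ereal) \<Rightarrow> ('a \<Rightarrow> ereal) \<Rightarrow> ('a \<Rightarrow> ereal) \<Rightarrow> bool" where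
  "good_lambda_pair \<beta> \<delta> X Y1 Y2 \<longleftrightarrow>
     (\<exists>U. (\<forall>\<alpha>>0. level X \<alpha> = (\<Union>n. U \<alpha> n)) \<and> (\<forall>\<alpha>>0. \<forall>n. U \<alpha> n \<in> sets (F n)) \<and>
       (\<forall>\<alpha>>0. \<forall>n. \<forall>C\<in>sets (F n). C \<subseteq> disjointed (U \<alpha>) n \<longrightarrow>
         prob (C \<inter> (level X (\<beta> * \<alpha>) - level Y1 (\<delta> * \<alpha>) - level Y2 (\<delta> * \<alpha>))) \<le> 1 / 2 * prob C))"

lemma good_lambda_pairI:
  assumes "\<And>\<alpha>. 0 < \<alpha> \<Longrightarrow> level X \<alpha> = (\<Union>n. U \<alpha> n)" "\<And>\<alpha> n. 0 < \<alpha> \<Longrightarrow> U \<alpha> n \<in> sets (F n)"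
    and "\<And>\<alpha> n C. 0 < \<alpha> \<Longrightarrow> C \<in> sets (F n) \<Longrightarrow> C \<subseteq> disjointed (U \<alpha>) n \<Longrightarrow>
      prob (C \<inter> (level X (\<beta> * \<alpha>) - level Y1 (\<delta> * \<alpha>) - level Y2 (\<delta> * \<alpha>))) \<le> 1 / 2 * prob C"
  shows "good_lambda_pair \<beta> \<delta> X Y1 Y2"
  unfolding good_lambda_pair_def using assms by (intro exI[of _ U]) simp

text \<open>The A-infinity condition only yields a fixed factor \<open>\<eta> < 1\<close>. Choosing \<open>\<beta> = 2\<^bsup>1/k\<^esup>\<close> and
  iterating \<open>k\<close> times gives the arbitrarily small factor \<open>\<eta>\<^sup>k\<close> at the cost of doubling the level.\<close>

lemma good_lambda:
  assumes "A_infinity M F \<phi>" and \<kappa>: "\<kappa> > 0"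
  shows "\<exists>\<beta>>1. \<exists>C. weak_type_bound C (good_lambda_pair \<beta> ((\<beta> - 1) / \<kappa>))"
proof -
  obtain \<epsilon> :: real where eps: "\<epsilon> > 0" and good: "\<forall>B\<ge>0. \<forall>\<delta>>0. \<exists>C. weak_type_bound C (good_lambda_ineq \<epsilon> B \<delta>)"
    using good_lambda_ineq_weak_type by blast
  \<comment> \<open>To be applied to the complement of the exceptional set, whose conditional
    probability is at least 1/2 on each first-entrance event.\<close>
  obtain c0 where c0: "c0 > 0" "\<And>t n A D. 0 < t \<Longrightarrow> A \<in> sets M \<Longrightarrow> D \<in> sets (F n) \<Longrightarrow>
    \<forall>C\<in>sets (F n). C \<subseteq> D \<longrightarrow> (1 / 2) * prob C \<le> prob (A \<inter> C) \<Longrightarrow>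
    ennreal c0 * emeasure (Q t) D \<le> emeasure (Q t) (A \<inter> D)"
    by (rule A_infinity_sets[OF assms(1) half_gt_zero[OF zero_less_one]]) (rule that)
  \<comment> \<open>The minimum with 1/2 keeps \<open>\<eta>\<close> positive; lowering
    \<open>c0\<close> preserves the inequality it comes with.\<close>
  define \<eta> where "\<eta> = 1 - min c0 (1 / 2)"
  have eta: "0 < \<eta>" "\<eta> < 1" using c0 by (auto simp: \<eta>_def)
  obtain k0 where k0: "\<eta> ^ k0 < \<epsilon>" using real_arch_pow_inv[OF eps eta(2)] by auto
  define k where "k = Suc k0"
  have "\<eta> ^ Suc k0 \<le> \<eta> ^ k0" using eta by (intro power_decreasing) auto
  then have k: "\<eta> ^ k \<le> \<epsilon>" "k > 0" using k0 by (auto simp: k_def)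
  define \<beta> :: real where "\<beta> = 2 powr (1 / k)"
  have beta: "\<beta> > 1" "\<beta> ^ k = 2"
    using k by (auto simp: \<beta>_def powr_realpow[symmetric] powr_powr gr_one_powr)
  define \<delta> where "\<delta> = (\<beta> - 1) / \<kappa>"
  have \<delta>: "\<delta> > 0" using beta \<kappa> by (simp add: \<delta>_def)
  \<comment> \<open>Each of the \<open>k\<close> iterations contributes one term in
    \<open>Y1\<close> and \<open>Y2\<close>, hence the constant \<open>k\<close>.\<close>
  obtain C where C: "weak_type_bound C (good_lambda_ineq \<epsilon> k \<delta>)"
    using good \<delta> by (metis of_nat_0_le_iff)
  have "weak_type_bound C (good_lambda_pair \<beta> \<delta>)"
  proof (rule weak_type_boundI[OF weak_type_boundD(1)[OF C]])
    fix X Y1 Y2 :: "'a \<Rightarrow> ereal"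
    assume meas [measurable]: "X \<in> borel_measurable M" "Y1 \<in> borel_measurable M" "Y2 \<in> borel_measurable M"
      and pair: "good_lambda_pair \<beta> \<delta> X Y1 Y2"
    obtain U where XU: "\<forall>\<alpha>>0. level X \<alpha> = (\<Union>n. U \<alpha> n)" and UF: "\<forall>\<alpha>>0. \<forall>n. U \<alpha> n \<in> sets (F n)"
      and cond: "\<forall>\<alpha>>0. \<forall>n. \<forall>C\<in>sets (F n). C \<subseteq> disjointed (U \<alpha>) n \<longrightarrow>
        prob (C \<inter> (level X (\<beta> * \<alpha>) - level Y1 (\<delta> * \<alpha>) - level Y2 (\<delta> * \<alpha>))) \<le> 1 / 2 * prob C"
      using pair unfolding good_lambda_pair_def by blast
    define Y where "Y \<alpha> = level Y1 (\<delta> * \<alpha>) \<union> level Y2 (\<delta> * \<alpha>)" for \<alpha>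
    have Ymeas[measurable]: "Y \<alpha> \<in> sets M" for \<alpha> by (auto simp: Y_def)
    have one: "emeasure (Q t) (level X (\<beta> * \<alpha>)) \<le> ennreal \<eta> * emeasure (Q t) (level X \<alpha>) + emeasure (Q t) (Y \<alpha>)"
      if t: "t > 0" and \<alpha>: "\<alpha> > 0" for t \<alpha> :: real
    proof -
      define G where "G = level X (\<beta> * \<alpha>) - Y \<alpha>"
      have G[measurable]: "G \<in> sets M" by (auto simp: G_def)
      have "emeasure (Q t) G \<le> ennreal \<eta> * emeasure (Q t) (\<Union>n. U \<alpha> n)"
      proof (rule emeasure_le_first_entrance)
        show "U \<alpha> n \<in> sets (Q t)" for n using UF \<alpha> sets_F_M by auto
        show "G \<in> sets (Q t)" by simp
        have "level X (\<beta> * \<alpha>) \<subseteq> level X \<alpha>" using beta \<alpha> by (intro level_antimono) auto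
        then show "G \<subseteq> (\<Union>n. U \<alpha> n)" using XU \<alpha> by (auto simp: G_def)
        fix n
        define D where "D = disjointed (U \<alpha>) n"
        have D: "D \<in> sets (F n)" unfolding D_def using UF \<alpha> by (intro disjointed_F) auto
        then have [measurable]: "D \<in> sets M" by (rule sets_F_M)
        have "ennreal c0 * emeasure (Q t) D \<le> emeasure (Q t) ((space M - G) \<inter> D)"
        proof (rule c0(2)[OF t _ D], simp, intro ballI impI)
          fix C assume C: "C \<in> sets (F n)" "C \<subseteq> D"
          have CM: "C \<in> sets M" using C sets_F_M by auto
          have "prob (C \<inter> G) \<le> 1 / 2 * prob C"
            using cond \<alpha> C by (auto simp: G_def Y_def D_def Diff_Un Diff_eq Int_assoc)
          moreover have "prob C = prob (C \<inter> G) + prob ((space M - G) \<inter> C)"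
            using CM sets.sets_into_space[OF CM] by (subst finite_measure_Union[symmetric]) (auto intro!: arg_cong[where f=prob])
          ultimately show "1 / 2 * prob C \<le> prob ((space M - G) \<inter> C)" by simp
        qed
        moreover have "emeasure (Q t) D = emeasure (Q t) (G \<inter> D) + emeasure (Q t) ((space M - G) \<inter> D)"
          using sets.sets_into_space[OF \<open>D \<in> sets M\<close>]
          by (subst plus_emeasure) (auto intro!: arg_cong[where f="emeasure (Q t)"])
        moreover have "emeasure (Q t) (G \<inter> D) < \<infinity>" "emeasure (Q t) ((space M - G) \<inter> D) < \<infinity>" "emeasure (Q t) D < \<infinity>"
          using Q_finite[OF t] by simp_all
        ultimately have "emeasure (Q t) (G \<inter> D) \<le> ennreal \<eta> * emeasure (Q t) D"
        proof -
          assume a: "ennreal c0 * emeasure (Q t) D \<le> emeasure (Q t) ((space M - G) \<inter> D)"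
            and b: "emeasure (Q t) D = emeasure (Q t) (G \<inter> D) + emeasure (Q t) ((space M - G) \<inter> D)"
            and c: "emeasure (Q t) (G \<inter> D) < \<infinity>" "emeasure (Q t) ((space M - G) \<inter> D) < \<infinity>" "emeasure (Q t) D < \<infinity>"
          obtain x y z where xyz: "emeasure (Q t) D = ennreal x" "x \<ge> 0" "emeasure (Q t) (G \<inter> D) = ennreal y" "y \<ge> 0"
            "emeasure (Q t) ((space M - G) \<inter> D) = ennreal z" "z \<ge> 0"
            using c by (metis ennreal_cases infinity_ennreal_def less_irrefl)
          have "c0 * x \<le> z" "x = y + z"
            using a b xyz c0(1) by (auto simp: ennreal_mult'[symmetric] ennreal_plus[symmetric] simp del: ennreal_plus)
          moreover have "min c0 (1 / 2) * x \<le> c0 * x" using xyz by (intro mult_right_mono) auto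
          ultimately have "y \<le> \<eta> * x" by (auto simp: \<eta>_def algebra_simps)
          then show ?thesis using xyz eta by (auto simp: ennreal_mult'[symmetric])
        qed
        then show "emeasure (Q t) (G \<inter> disjointed (U \<alpha>) n) \<le> ennreal \<eta> * emeasure (Q t) (disjointed (U \<alpha>) n)"
          by (simp add: D_def)
      qed
      then have "emeasure (Q t) G \<le> ennreal \<eta> * emeasure (Q t) (level X \<alpha>)" using XU \<alpha> by simp
      moreover have "emeasure (Q t) (level X (\<beta> * \<alpha>)) \<le> emeasure (Q t) (G \<union> Y \<alpha>)"
        by (intro emeasure_mono) (auto simp: G_def)
      moreover have "emeasure (Q t) (G \<union> Y \<alpha>) \<le> emeasure (Q t) G + emeasure (Q t) (Y \<alpha>)"
        by (intro emeasure_subadditive) auto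
      ultimately show ?thesis by (meson add_right_mono order.trans)
    qed
    have iter: "emeasure (Q t) (level X (\<beta> ^ j * \<alpha>)) \<le> ennreal (\<eta> ^ j) * emeasure (Q t) (level X \<alpha>) + ennreal j * emeasure (Q t) (Y \<alpha>)"
      if t: "t > 0" and \<alpha>: "\<alpha> > 0" for t \<alpha> :: real and j :: nat
    proof (induction j)
      case (Suc j)
      \<comment> \<open>The levels \<open>\<beta> ^ j * \<alpha>\<close> increase with
        \<open>j\<close>, so all the sets \<open>Y\<close> met on the way lie in the one for the
        lowest level.\<close>
      have "Y (\<beta> ^ j * \<alpha>) \<subseteq> Y \<alpha>"
        unfolding Y_def using beta \<alpha> \<delta> by (intro Un_mono level_antimono) (auto simp: mult_le_cancel_left1)
      then have Ysub: "emeasure (Q t) (Y (\<beta> ^ j * \<alpha>)) \<le> emeasure (Q t) (Y \<alpha>)" by (intro emeasure_mono) auto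
      have "emeasure (Q t) (level X (\<beta> ^ Suc j * \<alpha>)) \<le> ennreal \<eta> * emeasure (Q t) (level X (\<beta> ^ j * \<alpha>)) + emeasure (Q t) (Y (\<beta> ^ j * \<alpha>))"
        using one[OF t, of "\<beta> ^ j * \<alpha>"] beta \<alpha> by (simp add: mult.assoc)
      also have "\<dots> \<le> ennreal \<eta> * (ennreal (\<eta> ^ j) * emeasure (Q t) (level X \<alpha>) + ennreal j * emeasure (Q t) (Y \<alpha>)) + emeasure (Q t) (Y \<alpha>)"
        by (rule add_mono[OF mult_left_mono[OF Suc] Ysub]) simp
      also have "\<dots> = ennreal (\<eta> ^ Suc j) * emeasure (Q t) (level X \<alpha>) + (ennreal \<eta> * (ennreal j * emeasure (Q t) (Y \<alpha>)) + emeasure (Q t) (Y \<alpha>))"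
        using eta by (simp add: distrib_left ennreal_mult mult.assoc add.assoc)
      also have "\<dots> \<le> ennreal (\<eta> ^ Suc j) * emeasure (Q t) (level X \<alpha>) + (1 * (ennreal j * emeasure (Q t) (Y \<alpha>)) + emeasure (Q t) (Y \<alpha>))"
        using eta by (intro add_left_mono add_right_mono mult_right_mono) auto
      also have "1 * (ennreal j * emeasure (Q t) (Y \<alpha>)) + emeasure (Q t) (Y \<alpha>) = ennreal (Suc j) * emeasure (Q t) (Y \<alpha>)"
        by (simp add: distrib_right add.commute)
      finally show ?case .
    qed simp
    show "WL_norm M \<phi> X \<le> ennreal C * max (WL_norm M \<phi> Y1) (WL_norm M \<phi> Y2)"
    proof (rule weak_type_boundD(2)[OF C meas], unfold good_lambda_ineq_def, intro allI impI)
      fix t \<alpha> :: real assume t: "t > 0" and \<alpha>: "\<alpha> > 0"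
      have "emeasure (Q t) (level X (2 * \<alpha>)) \<le> ennreal (\<eta> ^ k) * emeasure (Q t) (level X \<alpha>) + ennreal k * emeasure (Q t) (Y \<alpha>)"
        using iter[OF t \<alpha>, of k] beta by simp
      also have "\<dots> \<le> ennreal \<epsilon> * emeasure (Q t) (level X \<alpha>) + ennreal k * (emeasure (Q t) (level Y1 (\<delta> * \<alpha>)) + emeasure (Q t) (level Y2 (\<delta> * \<alpha>)))"
        unfolding Y_def using k by (intro add_mono mult_mono ennreal_leI emeasure_subadditive) auto
      finally show "emeasure (Q t) (level X (2 * \<alpha>)) \<le> ennreal \<epsilon> * emeasure (Q t) (level X \<alpha>)
        + ennreal k * (emeasure (Q t) (level Y1 (\<delta> * \<alpha>)) + emeasure (Q t) (level Y2 (\<delta> * \<alpha>)))" .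
    qed
  qed
  then show ?thesis using beta(1) unfolding \<delta>_def by blast
qed

end

section \<open>Martingale transforms\<close>

lemma mdiff_Suc: "mdiff f (Suc i) x = f (Suc i) x - f i x"
  by (simp add: mdiff_def)

lemma sum_mdiff: "n \<le> m \<Longrightarrow> (\<Sum>i\<in>{n..<m}. mdiff f (Suc i) x) = f m x - f n x"
  unfolding mdiff_Suc by (rule sum_Suc_diff')

text \<open>The retained terms form an initial segment, and since the condition includes the current
  term, their sum never passes \<open>a\<close>. For \<open>csqd\<close> the condition at
  \<open>i\<close> is known at time \<open>i\<close>, so that truncation is predictable.\<close>

lemma stopped_sum_le:
  fixes b :: "nat \<Rightarrow> ennreal"
  shows "(\<Sum>i<N. if (\<Sum>j<Suc i. b j) \<le> a then b i else 0) \<le> min a (\<Sum>i<N. b i)"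
proof (induction N)
  case (Suc N)
  show ?case
  proof (cases "(\<Sum>j<Suc N. b j) \<le> a")
    case True
    then show ?thesis using Suc by (simp add: add_right_mono)
  next
    case False
    have "(\<Sum>i<N. b i) \<le> (\<Sum>i<Suc N. b i)" by simp
    then show ?thesis using Suc False by (auto intro: order.trans)
  qed
qed simp

lemma less_suminf_ennreal_iff:
  fixes b :: "nat \<Rightarrow> ennreal"
  shows "c < (\<Sum>i. b i) \<longleftrightarrow> (\<exists>n. c < (\<Sum>i<n. b i))"
  by (simp add: suminf_eq_SUP less_SUP_iff)

lemma less_sqrt_ennreal_iff:
  assumes "\<alpha> > 0"
  shows "ereal \<alpha> < enn2ereal (ennreal_powr v (1 / 2)) \<longleftrightarrow> ennreal (\<alpha>\<^sup>2) < v"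
proof (cases v)
  case (real r)
  have "\<alpha> < sqrt r \<longleftrightarrow> \<alpha>\<^sup>2 < r"
    using assms real by (metis less_eq_real_def not_less power2_eq_square real_le_lsqrt real_le_rsqrt real_less_lsqrt real_less_rsqrt)
  then show ?thesis
    using real assms by (simp add: ennreal_powr_def enn2ereal_ennreal powr_half_sqrt ennreal_less_iff)
next
  case top
  then show ?thesis using assms by (simp add: ennreal_powr_def)
qed

context weighted_basis
begin

text \<open>\<open>sqd f i\<close> belongs to time \<open>Suc i\<close> and \<open>csqd f i\<close>
  is its expectation given \<open>F i\<close>: the index is the time at which a predictable
  coefficient has to be known. Values lie in \<open>ennreal\<close> because the squares need not be
  integrable.\<close>

definition sqd :: "(nat \<Rightarrow> 'a \<Rightarrow> real) \<Rightarrow> nat \<Rightarrow> 'a \<Rightarrow> ennreal" where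
  "sqd f i x = ennreal (\<bar>mdiff f (Suc i) x\<bar>\<^sup>2)"

definition csqd :: "(nat \<Rightarrow> 'a \<Rightarrow> real) \<Rightarrow> nat \<Rightarrow> 'a \<Rightarrow> ennreal" where
  "csqd f i = nn_cond_exp M (F i) (sqd f i)"

lemma martingales0D:
  assumes "f \<in> martingales0 M F"
  shows "f n \<in> borel_measurable (F n)" "integrable M (f n)" "AE x in M. f 0 x = 0"
    "m \<le> n \<Longrightarrow> AE x in M. real_cond_exp M (F m) (f n) x = f m x"
  using assms unfolding martingales0_def is_martingale_def by blast+

lemma mart_measurable_F: "f \<in> martingales0 M F \<Longrightarrow> m \<le> n \<Longrightarrow> f m \<in> borel_measurable (F n)"
  by (rule measurable_F_mono[OF _ martingales0D(1)])

lemma mart_measurable [measurable]: "f \<in> martingales0 M F \<Longrightarrow> f m \<in> borel_measurable M"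
  using mart_measurable_F measurable_F_M by blast

lemma mdiff_measurable_F: "f \<in> martingales0 M F \<Longrightarrow> i < n \<Longrightarrow> mdiff f (Suc i) \<in> borel_measurable (F n)"
  unfolding mdiff_Suc[abs_def] by (intro borel_measurable_diff mart_measurable_F) auto

lemma mdiff_measurable [measurable]: "f \<in> martingales0 M F \<Longrightarrow> mdiff f (Suc i) \<in> borel_measurable M"
  using mdiff_measurable_F measurable_F_M by blast

lemma sqd_measurable_F: "f \<in> martingales0 M F \<Longrightarrow> i < n \<Longrightarrow> sqd f i \<in> borel_measurable (F n)"
  using mdiff_measurable_F[of f i n] unfolding sqd_def[abs_def] by measurable

lemma sqd_measurable [measurable]: "f \<in> martingales0 M F \<Longrightarrow> sqd f i \<in> borel_measurable M"
  using sqd_measurable_F measurable_F_M by blast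

lemma csqd_measurable_F: "i \<le> n \<Longrightarrow> csqd f i \<in> borel_measurable (F n)"
  by (rule measurable_F_mono[of i]) (auto simp: csqd_def)

lemma csqd_measurable [measurable]: "csqd f i \<in> borel_measurable M"
  using csqd_measurable_F measurable_F_M by blast

lemma csqd_integral:
  "f \<in> martingales0 M F \<Longrightarrow> u \<in> borel_measurable (F i) \<Longrightarrow>
    (\<integral>\<^sup>+x. u x * csqd f i x \<partial>M) = (\<integral>\<^sup>+x. u x * sqd f i x \<partial>M)"
  unfolding csqd_def by (rule nn_cond_exp_mult_integral) auto

lemma integral_mult_mdiff:
  assumes f: "f \<in> martingales0 M F" and u: "u \<in> borel_measurable (F i)"
    and int: "integrable M (\<lambda>x. u x * mdiff f (Suc i) x)"
  shows "(\<integral>x. u x * mdiff f (Suc i) x \<partial>M) = 0"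
proof -
  interpret sub: sigma_finite_subalgebra M "F i" by (rule sigma_finite_F)
  have 1: "AE x in M. real_cond_exp M (F i) (\<lambda>x. f (Suc i) x - f i x) x
      = real_cond_exp M (F i) (f (Suc i)) x - real_cond_exp M (F i) (f i) x"
    using f by (intro sub.real_cond_exp_diff martingales0D(2))
  have 2: "AE x in M. real_cond_exp M (F i) (f (Suc i)) x = f i x" "AE x in M. real_cond_exp M (F i) (f i) x = f i x"
    using martingales0D(4)[OF f] by auto
  have z: "AE x in M. real_cond_exp M (F i) (mdiff f (Suc i)) x = 0"
    using 1 2 unfolding mdiff_Suc[abs_def] by eventually_elim simp
  have "(\<integral>x. u x * mdiff f (Suc i) x \<partial>M) = (\<integral>x. u x * real_cond_exp M (F i) (mdiff f (Suc i)) x \<partial>M)"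
    using sub.real_cond_exp_intg(2)[OF int u mdiff_measurable[OF f]] by simp
  also have "\<dots> = (\<integral>x. 0 \<partial>M)"
    using z u measurable_F_M[OF u] by (intro integral_cong_AE)
      (auto intro: measurable_F_M[OF borel_measurable_cond_exp])
  finally show ?thesis by simp
qed

text \<open>Pythagoras for martingale transforms: cross terms vanish by
  \<open>integral_mult_mdiff\<close>. Square integrability is asked of the products with
  \<open>k i\<close> and not of \<open>f\<close>, so that a truncating \<open>k\<close> can supply
  it.\<close>

lemma transform_square:
  assumes f: "f \<in> martingales0 M F" and k: "\<And>i. k i \<in> borel_measurable (F i)"
    and int: "\<And>i. i < N \<Longrightarrow> integrable M (\<lambda>x. (k i x * mdiff f (Suc i) x)\<^sup>2)"
  shows "integrable M (\<lambda>x. (\<Sum>i<N. k i x * mdiff f (Suc i) x)\<^sup>2) \<and>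
    (\<integral>x. (\<Sum>i<N. k i x * mdiff f (Suc i) x)\<^sup>2 \<partial>M) = (\<Sum>i<N. \<integral>x. (k i x * mdiff f (Suc i) x)\<^sup>2 \<partial>M)"
  using int
proof (induction N)
  case (Suc N)
  define T where "T x = (\<Sum>i<N. k i x * mdiff f (Suc i) x)" for x
  define e where "e x = k N x * mdiff f (Suc N) x" for x
  have IH: "integrable M (\<lambda>x. (T x)\<^sup>2)" "(\<integral>x. (T x)\<^sup>2 \<partial>M) = (\<Sum>i<N. \<integral>x. (k i x * mdiff f (Suc i) x)\<^sup>2 \<partial>M)"
    using Suc unfolding T_def by auto
  have TF: "T \<in> borel_measurable (F N)"
    unfolding T_def[abs_def] using f k
    by (intro borel_measurable_sum borel_measurable_times mdiff_measurable_F) (auto intro: measurable_F_mono[OF less_imp_le])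
  have [measurable]: "T \<in> borel_measurable M" "k N \<in> borel_measurable M" "mdiff f (Suc N) \<in> borel_measurable M"
    using TF k f measurable_F_M mdiff_measurable by auto
  have eint: "integrable M (\<lambda>x. (e x)\<^sup>2)" unfolding e_def using Suc by auto
  have Te: "integrable M (\<lambda>x. T x * e x)"
  proof (rule Bochner_Integration.integrable_bound[of M "\<lambda>x. (T x)\<^sup>2 + (e x)\<^sup>2"])
    show "AE x in M. norm (T x * e x) \<le> norm ((T x)\<^sup>2 + (e x)\<^sup>2)"
    proof (rule AE_I2)
      fix x
      have "0 \<le> (\<bar>T x\<bar> - \<bar>e x\<bar>)\<^sup>2" by simp
      then have "2 * (\<bar>T x\<bar> * \<bar>e x\<bar>) \<le> (T x)\<^sup>2 + (e x)\<^sup>2" by (simp add: power2_diff)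
      moreover have "0 \<le> \<bar>T x\<bar> * \<bar>e x\<bar>" by simp
      ultimately have "\<bar>T x\<bar> * \<bar>e x\<bar> \<le> (T x)\<^sup>2 + (e x)\<^sup>2" by linarith
      then show "norm (T x * e x) \<le> norm ((T x)\<^sup>2 + (e x)\<^sup>2)" by (simp add: abs_mult)
    qed
  qed (use IH eint in \<open>auto simp: e_def\<close>)
  \<comment> \<open>\<open>T\<close> and \<open>k N\<close> are known at time \<open>N\<close>, so
    the cross term is a predictable factor times a martingale difference.\<close>
  have "(\<integral>x. T x * e x \<partial>M) = (\<integral>x. (T x * k N x) * mdiff f (Suc N) x \<partial>M)"
    by (simp add: e_def mult.assoc)
  also have "\<dots> = 0"
    using Te by (intro integral_mult_mdiff f borel_measurable_times TF k) (simp add: e_def mult.assoc)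
  finally have 0: "(\<integral>x. T x * e x \<partial>M) = 0" .
  have eq: "(\<Sum>i<Suc N. k i x * mdiff f (Suc i) x)\<^sup>2 = (T x)\<^sup>2 + (e x)\<^sup>2 + 2 * (T x * e x)" for x
    by (simp add: T_def e_def power2_sum)
  show ?case
    unfolding eq using IH eint Te 0 by (simp add: e_def)
qed simp

lemma nn_transform_square:
  assumes f: "f \<in> martingales0 M F" and k: "\<And>i. k i \<in> borel_measurable (F i)"
    and fin: "\<And>i. i < N \<Longrightarrow> (\<integral>\<^sup>+x. ennreal ((k i x * mdiff f (Suc i) x)\<^sup>2) \<partial>M) < \<infinity>"
  shows "(\<integral>\<^sup>+x. ennreal ((\<Sum>i<N. k i x * mdiff f (Suc i) x)\<^sup>2) \<partial>M)
    = (\<Sum>i<N. \<integral>\<^sup>+x. ennreal ((k i x * mdiff f (Suc i) x)\<^sup>2) \<partial>M)"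
proof -
  have [measurable]: "k i \<in> borel_measurable M" "mdiff f (Suc i) \<in> borel_measurable M" for i
    using k f measurable_F_M mdiff_measurable by auto
  have int: "integrable M (\<lambda>x. (k i x * mdiff f (Suc i) x)\<^sup>2)" if "i < N" for i
    using fin[OF that] by (intro integrableI_nonneg) auto
  note * = transform_square[OF f k int]
  have "(\<integral>\<^sup>+x. ennreal ((\<Sum>i<N. k i x * mdiff f (Suc i) x)\<^sup>2) \<partial>M)
      = ennreal (\<integral>x. (\<Sum>i<N. k i x * mdiff f (Suc i) x)\<^sup>2 \<partial>M)"
    using * by (intro nn_integral_eq_integral) auto
  also have "\<dots> = ennreal (\<Sum>i<N. \<integral>x. (k i x * mdiff f (Suc i) x)\<^sup>2 \<partial>M)"
    using * by simp
  also have "\<dots> = (\<Sum>i<N. ennreal (\<integral>x. (k i x * mdiff f (Suc i) x)\<^sup>2 \<partial>M))"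
    by (rule sum_ennreal[symmetric]) simp
  also have "\<dots> = (\<Sum>i<N. \<integral>\<^sup>+x. ennreal ((k i x * mdiff f (Suc i) x)\<^sup>2) \<partial>M)"
    using int by (intro sum.cong refl nn_integral_eq_integral[symmetric]) auto
  finally show ?thesis .
qed

text \<open>Kolmogorov's inequality for the increments after time \<open>n\<close>, localised to
  \<open>C\<close> and to the paths lying in all \<open>p i\<close>. The predictable sets
  \<open>p i\<close> cut the second moments down to \<open>a * prob C\<close>; on their intersection
  they cut nothing off, so there the transform is the true increment and Chebyshev's inequality
  applies.\<close>

lemma maximal_increment:
  assumes f: "f \<in> martingales0 M F" and p: "\<And>i. p i \<in> sets (F i)" and C: "C \<in> sets (F n)"
    and ab: "a \<ge> 0" "b > 0"
    and le: "\<And>N. (\<Sum>i\<in>{n..<N}. \<integral>\<^sup>+x. indicator (C \<inter> p i) x * sqd f i x \<partial>M) \<le> ennreal (a * prob C)"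
  shows "b\<^sup>2 * prob (C \<inter> (\<Inter>i. p i) \<inter> {x \<in> space M. \<exists>m\<ge>n. b < \<bar>f m x - f n x\<bar>}) \<le> a * prob C"
proof -
  have [measurable]: "f m \<in> borel_measurable M" for m using f by (rule mart_measurable)
  have [measurable]: "C \<in> sets M" "p i \<in> sets M" for i using C p sets_F_M by auto
  define R where "R i = {x \<in> space M. \<forall>j\<in>{n..i}. \<bar>f j x - f n x\<bar> \<le> b}" for i
  have R: "R i \<in> sets (F i)" if "n \<le> i" for i
  proof -
    have m: "f j \<in> borel_measurable (F i)" if "j \<le> i" for j using f that by (rule mart_measurable_F)
    have "R i = (\<Inter>j\<in>{n..i}. {x \<in> space (F i). \<bar>f j x - f n x\<bar> \<le> b})"
      using that by (auto simp: R_def)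
    also have "\<dots> \<in> sets (F i)"
    proof (rule sets.finite_INT)
      fix j assume "j \<in> {n..i}"
      then have [measurable]: "f j \<in> borel_measurable (F i)" "f n \<in> borel_measurable (F i)" using m that by auto
      show "{x \<in> space (F i). \<bar>f j x - f n x\<bar> \<le> b} \<in> sets (F i)" by measurable
    qed (use that in auto)
    finally show ?thesis .
  qed
  \<comment> \<open>the transform by \<open>k\<close> freezes the increment when it first exceeds \<open>b\<close>, so no maximal inequality is needed\<close>
  define k where "k i = (if n \<le> i then indicator (C \<inter> p i \<inter> R i) else (\<lambda>_. 0::real))" for i
  have k: "k i \<in> borel_measurable (F i)" for i
    using sets_F_mono[OF _ C, of i] p R by (auto simp: k_def intro!: borel_measurable_indicator)
  have kd: "(\<integral>\<^sup>+x. ennreal ((k i x * mdiff f (Suc i) x)\<^sup>2) \<partial>M) \<le>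
      (if n \<le> i then \<integral>\<^sup>+x. indicator (C \<inter> p i) x * sqd f i x \<partial>M else 0)" for i
    by (auto simp: k_def sqd_def intro!: nn_integral_mono split: split_indicator)
  define T where "T N x = (\<Sum>i<N. k i x * mdiff f (Suc i) x)" for N x
  have T_le: "(\<integral>\<^sup>+x. ennreal ((T N x)\<^sup>2) \<partial>M) \<le> ennreal (a * prob C)" for N
  proof -
    have "(\<integral>\<^sup>+x. ennreal ((T N x)\<^sup>2) \<partial>M) = (\<Sum>i<N. \<integral>\<^sup>+x. ennreal ((k i x * mdiff f (Suc i) x)\<^sup>2) \<partial>M)"
      unfolding T_def
    proof (rule nn_transform_square[OF f k])
      fix i
      show "(\<integral>\<^sup>+x. ennreal ((k i x * mdiff f (Suc i) x)\<^sup>2) \<partial>M) < \<infinity>"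
      proof (cases "n \<le> i")
        case True
        have "(\<integral>\<^sup>+x. ennreal ((k i x * mdiff f (Suc i) x)\<^sup>2) \<partial>M) \<le> (\<integral>\<^sup>+x. indicator (C \<inter> p i) x * sqd f i x \<partial>M)"
          using kd[of i] True by simp
        also have "\<dots> \<le> (\<Sum>i\<in>{n..<Suc i}. \<integral>\<^sup>+x. indicator (C \<inter> p i) x * sqd f i x \<partial>M)"
          using True by (intro member_le_sum) auto
        also have "\<dots> \<le> ennreal (a * prob C)" by (rule le)
        also have "\<dots> < \<infinity>" by simp
        finally show ?thesis .
      qed (simp add: k_def)
    qed
    also have "\<dots> \<le> (\<Sum>i<N. if n \<le> i then \<integral>\<^sup>+x. indicator (C \<inter> p i) x * sqd f i x \<partial>M else 0)"
      by (intro sum_mono kd)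
    also have "\<dots> = (\<Sum>i\<in>{i\<in>{..<N}. n \<le> i}. \<integral>\<^sup>+x. indicator (C \<inter> p i) x * sqd f i x \<partial>M)"
      by (rule sum.inter_filter[symmetric]) simp
    also have "{i\<in>{..<N}. n \<le> i} = {n..<N}" by auto
    also have "(\<Sum>i\<in>{n..<N}. \<integral>\<^sup>+x. indicator (C \<inter> p i) x * sqd f i x \<partial>M) \<le> ennreal (a * prob C)" by (rule le)
    finally show ?thesis .
  qed
  define G where "G N = C \<inter> (\<Inter>i. p i) \<inter> {x \<in> space M. \<exists>m\<in>{n..N}. b < \<bar>f m x - f n x\<bar>}" for N
  have [measurable]: "G N \<in> sets M" for N unfolding G_def by measurable
  have TG: "b\<^sup>2 \<le> (T N x)\<^sup>2" if x: "x \<in> G N" for N x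
  proof -
    \<comment> \<open>The first exceedance time. On \<open>G N\<close> the coefficients equal 1
      exactly on \<open>{n..<m}\<close>, so the transform telescopes to the increment at
      \<open>m\<close>.\<close>
    define m where "m = (LEAST m. n \<le> m \<and> b < \<bar>f m x - f n x\<bar>)"
    obtain m0 where m0: "n \<le> m0" "m0 \<le> N" "b < \<bar>f m0 x - f n x\<bar>" using x by (auto simp: G_def)
    have m: "n \<le> m" "b < \<bar>f m x - f n x\<bar>"
      using LeastI[of "\<lambda>m. n \<le> m \<and> b < \<bar>f m x - f n x\<bar>" m0] m0 by (auto simp: m_def)
    have mN: "m \<le> N"
      using Least_le[of "\<lambda>m. n \<le> m \<and> b < \<bar>f m x - f n x\<bar>" m0] m0 by (auto simp: m_def)
    have before: "\<bar>f j x - f n x\<bar> \<le> b" if "n \<le> j" "j < m" for j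
      using not_less_Least[of j "\<lambda>m. n \<le> m \<and> b < \<bar>f m x - f n x\<bar>"] that by (auto simp: m_def not_less)
    have kx: "k i x = (if n \<le> i \<and> i < m then 1 else 0)" for i
      using x m before by (auto simp: k_def G_def R_def indicator_def not_le)
    have "T N x = (\<Sum>i<N. if n \<le> i \<and> i < m then mdiff f (Suc i) x else 0)"
      by (auto simp: T_def kx intro!: sum.cong)
    also have "\<dots> = (\<Sum>i\<in>{i\<in>{..<N}. n \<le> i \<and> i < m}. mdiff f (Suc i) x)"
      by (rule sum.inter_filter[symmetric]) simp
    also have "{i\<in>{..<N}. n \<le> i \<and> i < m} = {n..<m}" using mN by auto
    also have "(\<Sum>i\<in>{n..<m}. mdiff f (Suc i) x) = f m x - f n x" using m by (rule_tac sum_mdiff)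
    finally have "b \<le> \<bar>T N x\<bar>" using m by simp
    then show ?thesis using ab by (metis abs_le_square_iff abs_of_pos)
  qed
  have G_le: "b\<^sup>2 * prob (G N) \<le> a * prob C" for N
  proof -
    have "ennreal (b\<^sup>2 * prob (G N)) = (\<integral>\<^sup>+x. ennreal (b\<^sup>2) * indicator (G N) x \<partial>M)"
      by (simp add: nn_integral_cmult_indicator emeasure_eq_measure ennreal_mult'[symmetric])
    also have "\<dots> \<le> (\<integral>\<^sup>+x. ennreal ((T N x)\<^sup>2) \<partial>M)"
      using TG by (intro nn_integral_mono) (auto intro!: ennreal_leI split: split_indicator)
    also have "\<dots> \<le> ennreal (a * prob C)" by (rule T_le)
    finally show ?thesis using ab by (subst (asm) ennreal_le_iff) auto
  qed
  have "incseq G" by (force simp: incseq_def G_def)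
  then have "(\<lambda>N. prob (G N)) \<longlonglongrightarrow> prob (\<Union>N. G N)"
    by (intro finite_Lim_measure_incseq) auto
  then have "(\<lambda>N. b\<^sup>2 * prob (G N)) \<longlonglongrightarrow> b\<^sup>2 * prob (\<Union>N. G N)" by (rule tendsto_mult_left)
  then have "b\<^sup>2 * prob (\<Union>N. G N) \<le> a * prob C"
    by (rule LIMSEQ_le_const2) (use G_le in auto)
  also have "(\<Union>N. G N) = C \<inter> (\<Inter>i. p i) \<inter> {x \<in> space M. \<exists>m\<ge>n. b < \<bar>f m x - f n x\<bar>}"
    by (auto simp: G_def) (meson atLeastAtMost_iff order.refl)
  finally show ?thesis .
qed

section \<open>Control sequences\<close>

lemma control_seqsD:
  assumes "l \<in> control_seqs M F"
  shows "l n \<in> borel_measurable (F n)" "l n \<in> borel_measurable M" "x \<in> space M \<Longrightarrow> 0 \<le> l n x"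
    "x \<in> space M \<Longrightarrow> m \<le> n \<Longrightarrow> l m x \<le> l n x"
  using assms measurable_F_M by (auto simp: control_seqs_def incseq_def)

text \<open>The domination in \<open>control_WP\<close> with \<open>n - 1\<close> renamed to
  \<open>i\<close>. Finiteness of the norm of the limit is left out here and added back in
  \<open>control_WP_iff\<close>, so that estimates can be stated for every control.\<close>

definition controls :: "(nat \<Rightarrow> 'a \<Rightarrow> real) \<Rightarrow> (nat \<Rightarrow> 'a \<Rightarrow> real) \<Rightarrow> bool" where
  "controls l f \<longleftrightarrow> l \<in> control_seqs M F \<and> (\<forall>i. AE x in M. \<bar>f (Suc i) x\<bar> \<le> l i x)"

definition square_controls :: "(nat \<Rightarrow> 'a \<Rightarrow> real) \<Rightarrow> (nat \<Rightarrow> 'a \<Rightarrow> real) \<Rightarrow> bool" where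
  "square_controls l f \<longleftrightarrow> l \<in> control_seqs M F \<and> (\<forall>i. AE x in M. square_fun_upto f (Suc i) x \<le> l i x)"

text \<open>What is gained is the bound on the current value: \<open>f 0\<close> vanishes almost
  everywhere, and \<open>l j\<close>, which bounds \<open>f (Suc j)\<close>, is at most
  \<open>l (Suc j)\<close>.\<close>

lemma control_dominates:
  assumes f: "f \<in> martingales0 M F" and l: "l \<in> control_seqs M F"
    and dom: "\<forall>i. AE x in M. \<bar>f (Suc i) x\<bar> \<le> l i x"
  shows "AE x in M. \<forall>i. \<bar>f i x\<bar> \<le> l i x \<and> \<bar>f (Suc i) x\<bar> \<le> l i x"
proof -
  have "AE x in M. \<forall>i. \<bar>f (Suc i) x\<bar> \<le> l i x" using dom by (simp add: AE_all_countable)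
  then show ?thesis
    using martingales0D(3)[OF f] AE_space
  proof eventually_elim
    case (elim x)
    have "\<bar>f i x\<bar> \<le> l i x" for i
    proof (cases i)
      case (Suc j)
      have "\<bar>f (Suc j) x\<bar> \<le> l j x" using elim by blast
      also have "l j x \<le> l (Suc j) x" using control_seqsD(4)[OF l elim(3), of j "Suc j"] by simp
      finally show ?thesis by (simp add: Suc)
    qed (use elim control_seqsD(3)[OF l elim(3), of 0] in simp)
    then show ?case using elim by simp
  qed
qed

text \<open>Once \<open>l\<close> passes \<open>a\<close> it stays there, so the transform by these
  indicators is the increment of \<open>f\<close> from \<open>n\<close>, stopped while
  \<open>l\<close> still bounds it: \<open>l i \<le> a\<close> already bounds
  \<open>f (Suc i)\<close>. The transform is thus at most \<open>2 * a\<close> on \<open>C\<close>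
  and zero elsewhere, and \<open>nn_transform_square\<close> turns this into a bound on the sum of
  squares.\<close>

lemma control_increment:
  assumes f: "f \<in> martingales0 M F" and l: "l \<in> control_seqs M F"
    and dom: "\<forall>i. AE x in M. \<bar>f (Suc i) x\<bar> \<le> l i x"
    and C: "C \<in> sets (F n)" and a: "a \<ge> 0"
  shows "(\<Sum>i\<in>{n..<N}. \<integral>\<^sup>+x. indicator (C \<inter> {x \<in> space M. l i x \<le> a}) x * sqd f i x \<partial>M) \<le> ennreal (4 * a\<^sup>2 * prob C)"
proof -
  note lF = control_seqsD(1)[OF l] and linc = control_seqsD(4)[OF l]
  have [measurable]: "C \<in> sets M" using C sets_F_M by auto
  define p where "p i = {x \<in> space M. l i x \<le> a}" for i
  have p: "p i \<in> sets (F i)" for i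
  proof -
    have "p i = {x \<in> space (F i). l i x \<le> a}" by (simp add: p_def)
    also have "\<dots> \<in> sets (F i)" using lF by measurable
    finally show ?thesis .
  qed
  define k where "k i = (if n \<le> i then indicator (C \<inter> p i) else (\<lambda>_. 0::real))" for i
  have k: "k i \<in> borel_measurable (F i)" for i
    using sets_F_mono[OF _ C, of i] p by (auto simp: k_def intro!: borel_measurable_indicator)
  note dom' = control_dominates[OF f l dom]
  have sq: "(\<integral>\<^sup>+x. ennreal ((k i x * mdiff f (Suc i) x)\<^sup>2) \<partial>M) =
      (if n \<le> i then \<integral>\<^sup>+x. indicator (C \<inter> p i) x * sqd f i x \<partial>M else 0)" for i
    by (auto simp: k_def sqd_def intro!: nn_integral_cong split: split_indicator)
  have "{i\<in>{..<N}. n \<le> i} = {n..<N}" by auto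
  then have "(\<Sum>i\<in>{n..<N}. \<integral>\<^sup>+x. indicator (C \<inter> p i) x * sqd f i x \<partial>M)
     = (\<Sum>i\<in>{i\<in>{..<N}. n \<le> i}. \<integral>\<^sup>+x. indicator (C \<inter> p i) x * sqd f i x \<partial>M)" by simp
  also have "\<dots> = (\<Sum>i<N. if n \<le> i then \<integral>\<^sup>+x. indicator (C \<inter> p i) x * sqd f i x \<partial>M else 0)"
    by (rule sum.inter_filter) simp
  also have "\<dots> = (\<Sum>i<N. \<integral>\<^sup>+x. ennreal ((k i x * mdiff f (Suc i) x)\<^sup>2) \<partial>M)"
    by (simp add: sq)
  also have "\<dots> = (\<integral>\<^sup>+x. ennreal ((\<Sum>i<N. k i x * mdiff f (Suc i) x)\<^sup>2) \<partial>M)"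
  proof (rule nn_transform_square[OF f k, symmetric])
    fix i
    \<comment> \<open>Second moments of \<open>f\<close> may be infinite, but on the support of
      \<open>k i\<close> the control bounds both \<open>f i\<close> and \<open>f (Suc i)\<close> by
      \<open>a\<close>.\<close>
    have "(\<integral>\<^sup>+x. ennreal ((k i x * mdiff f (Suc i) x)\<^sup>2) \<partial>M) \<le> (\<integral>\<^sup>+x. ennreal ((2 * a)\<^sup>2) \<partial>M)"
    proof (intro nn_integral_mono_AE)
      show "AE x in M. ennreal ((k i x * mdiff f (Suc i) x)\<^sup>2) \<le> ennreal ((2 * a)\<^sup>2)"
        using dom'
      proof eventually_elim
        case (elim x)
        have "\<bar>k i x * mdiff f (Suc i) x\<bar> \<le> \<bar>2 * a\<bar>"
        proof (cases "n \<le> i \<and> x \<in> C \<inter> p i")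
          case True
          then have "\<bar>f (Suc i) x\<bar> \<le> a" "\<bar>f i x\<bar> \<le> a"
            using elim[rule_format, of i] by (auto simp: p_def)
          then show ?thesis using True by (simp add: k_def mdiff_Suc)
        qed (use a in \<open>auto simp: k_def\<close>)
        then show ?case by (intro ennreal_leI) (simp only: abs_le_square_iff)
      qed
    qed
    also have "\<dots> < \<infinity>" by (simp add: emeasure_eq_measure ennreal_mult'[symmetric])
    finally show "(\<integral>\<^sup>+x. ennreal ((k i x * mdiff f (Suc i) x)\<^sup>2) \<partial>M) < \<infinity>" .
  qed
  also have "\<dots> \<le> (\<integral>\<^sup>+x. ennreal ((2 * a)\<^sup>2) * indicator C x \<partial>M)"
  proof (intro nn_integral_mono_AE)
    show "AE x in M. ennreal ((\<Sum>i<N. k i x * mdiff f (Suc i) x)\<^sup>2) \<le> ennreal ((2 * a)\<^sup>2) * indicator C x"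
      using dom' AE_space
    proof eventually_elim
      case (elim x)
      show ?case
      proof (cases "x \<in> C")
        case False
        then have "k i x = 0" for i by (auto simp: k_def)
        then show ?thesis by simp
      next
        case True
        have fn: "\<bar>f n x\<bar> \<le> a" if "n \<le> i" "x \<in> p i" for i
          using elim linc[of x n i] that by (auto simp: p_def intro: order.trans)
        \<comment> \<open>The second half of the invariant carries the induction: as long as
          \<open>l\<close> has not passed \<open>a\<close> the sum is the increment from
          \<open>n\<close>, and afterwards it no longer changes.\<close>
        have "\<bar>\<Sum>i<N. k i x * mdiff f (Suc i) x\<bar> \<le> 2 * a \<and>
          (n \<le> N \<longrightarrow> x \<in> p N \<longrightarrow> (\<Sum>i<N. k i x * mdiff f (Suc i) x) = f N x - f n x)"
        proof (induction N)
          case 0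
          then show ?case using a by simp
        next
          case (Suc N)
          consider "Suc N \<le> n" | "n \<le> N" "x \<in> p N" | "n \<le> N" "x \<notin> p N" by linarith
          then show ?case
          proof cases
            case 1
            then have "(\<Sum>i<Suc N. k i x * mdiff f (Suc i) x) = 0"
              by (intro sum.neutral) (auto simp: k_def)
            then show ?thesis using a 1 by auto
          next
            case 2
            then have *: "(\<Sum>i<Suc N. k i x * mdiff f (Suc i) x) = f (Suc N) x - f n x"
              using Suc True by (auto simp: k_def mdiff_Suc)
            have "\<bar>f (Suc N) x\<bar> \<le> l N x" using elim by blast
            also have "l N x \<le> a" using 2 by (simp add: p_def)
            finally show ?thesis using fn[OF 2] unfolding * by auto
          next
            case 3
            then have "x \<notin> p (Suc N)" using linc[of x N "Suc N"] elim by (auto simp: p_def)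
            then show ?thesis using 3 Suc by (auto simp: k_def)
          qed
        qed
        then have "\<bar>\<Sum>i<N. k i x * mdiff f (Suc i) x\<bar> \<le> \<bar>2 * a\<bar>" using a by linarith
        then show ?thesis using True by (simp only: abs_le_square_iff) (auto intro!: ennreal_leI)
      qed
    qed
  qed
  also have "\<dots> = ennreal (4 * a\<^sup>2 * prob C)"
    by (simp add: nn_integral_cmult_indicator emeasure_eq_measure ennreal_mult'[symmetric] power_mult_distrib)
  finally show ?thesis by (simp add: p_def)
qed

section \<open>Weighted integrals of squared differences\<close>

lemma phi_csqd_integral:
  assumes f: "f \<in> martingales0 M F" and u: "u \<in> borel_measurable (F i)" and t: "0 < t"
  shows "(\<integral>\<^sup>+x. u x * csqd f i x * ennreal (\<phi> x t) \<partial>M) = (\<integral>\<^sup>+x. u x * sqd f i x * phi_cond M F \<phi> i t x \<partial>M)"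
proof -
  have [measurable]: "csqd f i \<in> borel_measurable (F i)" "u \<in> borel_measurable (F i)"
    using u by (auto intro: csqd_measurable_F)
  have "(\<integral>\<^sup>+x. u x * csqd f i x * ennreal (\<phi> x t) \<partial>M) = (\<integral>\<^sup>+x. u x * csqd f i x * phi_cond M F \<phi> i t x \<partial>M)"
    using t by (intro phi_cond_integral[symmetric]) auto
  also have "\<dots> = (\<integral>\<^sup>+x. (u x * phi_cond M F \<phi> i t x) * csqd f i x \<partial>M)"
    by (simp add: mult_ac)
  also have "\<dots> = (\<integral>\<^sup>+x. (u x * phi_cond M F \<phi> i t x) * sqd f i x \<partial>M)"
    using f by (intro csqd_integral) auto
  finally show ?thesis by (simp add: mult_ac)
qed

text \<open>\<open>sqd f i\<close> is known only at time \<open>Suc i\<close>, so the weight is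
  conditioned on \<open>F (Suc i)\<close>, whereas in \<open>phi_csqd_integral\<close> everything
  but the weight is known at time \<open>i\<close>. The two right-hand sides differ only in the time
  index of \<open>phi_cond\<close>, and \<open>S_minus\<close> and \<open>S_plus\<close> compare
  just these two quantities.\<close>

lemma phi_sqd_integral:
  assumes f: "f \<in> martingales0 M F" and u: "u \<in> borel_measurable (F i)" and t: "0 < t"
  shows "(\<integral>\<^sup>+x. u x * sqd f i x * ennreal (\<phi> x t) \<partial>M) = (\<integral>\<^sup>+x. u x * sqd f i x * phi_cond M F \<phi> (Suc i) t x \<partial>M)"
  using t measurable_F_mono[OF _ u, of "Suc i"] sqd_measurable_F[OF f, of i "Suc i"]
  by (intro phi_cond_integral[symmetric]) auto

lemma nn_integral_phi_cond_mono:
  assumes f: "f \<in> martingales0 M F" and u: "u \<in> borel_measurable (F i)"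
    and le: "AE x in M. phi_cond M F \<phi> j t x \<le> ennreal K * phi_cond M F \<phi> k t x"
  shows "(\<integral>\<^sup>+x. u x * sqd f i x * phi_cond M F \<phi> j t x \<partial>M) \<le>
    ennreal K * (\<integral>\<^sup>+x. u x * sqd f i x * phi_cond M F \<phi> k t x \<partial>M)"
proof -
  have [measurable]: "u \<in> borel_measurable M" "sqd f i \<in> borel_measurable M"
    using u f measurable_F_M by auto
  have "(\<integral>\<^sup>+x. u x * sqd f i x * phi_cond M F \<phi> j t x \<partial>M) \<le>
      (\<integral>\<^sup>+x. ennreal K * (u x * sqd f i x * phi_cond M F \<phi> k t x) \<partial>M)"
  proof (intro nn_integral_mono_AE)
    show "AE x in M. u x * sqd f i x * phi_cond M F \<phi> j t x \<le> ennreal K * (u x * sqd f i x * phi_cond M F \<phi> k t x)"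
      using le
    proof eventually_elim
      case (elim x)
      then have "u x * sqd f i x * phi_cond M F \<phi> j t x \<le> u x * sqd f i x * (ennreal K * phi_cond M F \<phi> k t x)"
        by (intro mult_left_mono) simp_all
      then show ?case by (simp add: mult_ac)
    qed
  qed
  also have "\<dots> = ennreal K * (\<integral>\<^sup>+x. u x * sqd f i x * phi_cond M F \<phi> k t x \<partial>M)"
    by (rule nn_integral_cmult) measurable
  finally show ?thesis .
qed

lemma S_minus_integral:
  assumes "S_minus M F \<phi>"
  obtains K where "K > 0" "\<And>f u i t. f \<in> martingales0 M F \<Longrightarrow> u \<in> borel_measurable (F i) \<Longrightarrow> 0 < t \<Longrightarrow>
    (\<integral>\<^sup>+x. u x * csqd f i x * ennreal (\<phi> x t) \<partial>M) \<le> ennreal K * (\<integral>\<^sup>+x. u x * sqd f i x * ennreal (\<phi> x t) \<partial>M)"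
proof -
  obtain K where K: "K > 0" "\<And>n t. n \<ge> 1 \<Longrightarrow> t > 0 \<Longrightarrow> AE x in M.
        ennreal (1 / K) * phi_cond M F \<phi> (n - 1) t x \<le> phi_cond M F \<phi> n t x"
    using assms by (auto simp: S_minus_def)
  have K1: "ennreal K * ennreal (1 / K) = 1" using K(1) by (simp add: ennreal_mult'[symmetric])
  have "AE x in M. phi_cond M F \<phi> i t x \<le> ennreal K * phi_cond M F \<phi> (Suc i) t x" if "t > 0" for i t
    using K(2)[of "Suc i" t, simplified, OF that]
  proof eventually_elim
    case (elim x)
    then have "ennreal K * (ennreal (1 / K) * phi_cond M F \<phi> i t x) \<le> ennreal K * phi_cond M F \<phi> (Suc i) t x"
      by (intro mult_left_mono) auto
    then show ?case by (simp add: mult.assoc[symmetric] K1)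
  qed
  then show thesis
    by (intro that[OF K(1)]) (simp add: phi_csqd_integral phi_sqd_integral nn_integral_phi_cond_mono)
qed

lemma S_plus_integral:
  assumes "S_plus M F \<phi>"
  obtains K where "K > 0" "\<And>f u i t. f \<in> martingales0 M F \<Longrightarrow> u \<in> borel_measurable (F i) \<Longrightarrow> 0 < t \<Longrightarrow>
    (\<integral>\<^sup>+x. u x * sqd f i x * ennreal (\<phi> x t) \<partial>M) \<le> ennreal K * (\<integral>\<^sup>+x. u x * csqd f i x * ennreal (\<phi> x t) \<partial>M)"
proof -
  obtain K where K: "K > 0" "\<And>n t. n \<ge> 1 \<Longrightarrow> t > 0 \<Longrightarrow> AE x in M.
        phi_cond M F \<phi> n t x \<le> ennreal K * phi_cond M F \<phi> (n - 1) t x"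
    using assms by (auto simp: S_plus_def)
  have "AE x in M. phi_cond M F \<phi> (Suc i) t x \<le> ennreal K * phi_cond M F \<phi> i t x" if "t > 0" for i t
    using K(2)[of "Suc i" t, simplified, OF that] .
  then show thesis
    by (intro that[OF K(1)]) (simp add: phi_csqd_integral phi_sqd_integral nn_integral_phi_cond_mono)
qed

end

section \<open>Good-lambda inequalities for maximal and square functions\<close>

lemma measurable_ennreal_powr [measurable]:
  assumes [measurable]: "g \<in> borel_measurable N"
  shows "(\<lambda>x. ennreal_powr (g x) a) \<in> borel_measurable N"
proof -
  have "g -` {\<infinity>} \<inter> space N \<in> sets N" by measurable
  then have [measurable]: "{x \<in> space N. g x = \<infinity>} \<in> sets N"
    by (simp add: vimage_def Int_def conj_commute)
  show ?thesis unfolding ennreal_powr_def by measurable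
qed

lemma square_fun_upto_squared: "(square_fun_upto f n x)\<^sup>2 = (\<Sum>i<n. \<bar>mdiff f (Suc i) x\<bar>\<^sup>2)"
  unfolding square_fun_upto_def
  by (simp add: sum_nonneg sum.atLeast1_atMost_eq)

lemma square_fun_upto_nonneg: "0 \<le> square_fun_upto f n x"
  by (simp add: square_fun_upto_def sum_nonneg)

lemma square_fun_upto_mono: "m \<le> n \<Longrightarrow> square_fun_upto f m x \<le> square_fun_upto f n x"
  unfolding square_fun_upto_def by (intro real_sqrt_le_mono sum_mono2) auto

lemma mdiff_le_square_fun_upto: "\<bar>mdiff f (Suc i) x\<bar> \<le> square_fun_upto f (Suc i) x"
  by (rule power2_le_imp_le) (simp_all add: square_fun_upto_squared square_fun_upto_nonneg sum_nonneg)

lemma square_fun_upto_Suc_le: "square_fun_upto f (Suc n) x \<le> square_fun_upto f n x + \<bar>mdiff f (Suc n) x\<bar>"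
proof (rule power2_le_imp_le)
  show "(square_fun_upto f (Suc n) x)\<^sup>2 \<le> (square_fun_upto f n x + \<bar>mdiff f (Suc n) x\<bar>)\<^sup>2"
    by (simp add: square_fun_upto_squared power2_sum square_fun_upto_nonneg)
qed (simp add: square_fun_upto_nonneg)

context weighted_basis
begin

section \<open>Measurability and level sets of the maximal and square functions\<close>

lemma square_fun_upto_measurable_F:
  assumes f: "f \<in> martingales0 M F"
  shows "square_fun_upto f n \<in> borel_measurable (F n)"
proof -
  have "(\<lambda>x. \<Sum>i<n. \<bar>mdiff f (Suc i) x\<bar>\<^sup>2) \<in> borel_measurable (F n)"
    using mdiff_measurable_F[OF f, of _ n]
    by (intro borel_measurable_sum borel_measurable_power borel_measurable_abs) auto
  then show ?thesis unfolding square_fun_upto_def[abs_def] One_nat_def sum.atLeast1_atMost_eq by measurable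
qed

lemma sum_sqd: "(\<Sum>i<n. sqd f i x) = ennreal ((square_fun_upto f n x)\<^sup>2)"
  by (simp add: sqd_def sum_ennreal square_fun_upto_squared)

lemma maximal_fun_measurable [measurable]: "f \<in> martingales0 M F \<Longrightarrow> maximal_fun f \<in> borel_measurable M"
  unfolding maximal_fun_def[abs_def] by measurable

lemma square_fun_eq: "square_fun f x = enn2ereal (ennreal_powr (\<Sum>i. sqd f i x) (1 / 2))"
  by (simp add: square_fun_def sqd_def)

lemma cond_square_fun_eq: "cond_square_fun M F f x = enn2ereal (ennreal_powr (\<Sum>i. csqd f i x) (1 / 2))"
  by (simp add: cond_square_fun_def csqd_def sqd_def[abs_def])

lemma square_fun_measurable [measurable]: "f \<in> martingales0 M F \<Longrightarrow> square_fun f \<in> borel_measurable M"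
  unfolding square_fun_eq[abs_def] by measurable

lemma cond_square_fun_measurable [measurable]: "cond_square_fun M F f \<in> borel_measurable M"
  unfolding cond_square_fun_eq[abs_def] by measurable

lemma level_maximal: "level (maximal_fun f) \<alpha> = (\<Union>n. {x \<in> space M. \<alpha> < \<bar>f n x\<bar>})"
proof -
  have "\<bar>maximal_fun f x\<bar> = maximal_fun f x" for x
    unfolding maximal_fun_def by (intro abs_ereal_ge0 SUP_upper2[of 0]) auto
  then show ?thesis by (auto simp: level_def maximal_fun_def less_SUP_iff)
qed

lemma level_square:
  "\<alpha> > 0 \<Longrightarrow> level (square_fun f) \<alpha> = (\<Union>n. {x \<in> space M. ennreal (\<alpha>\<^sup>2) < (\<Sum>i<n. sqd f i x)})"
  by (auto simp: level_def square_fun_eq less_sqrt_ennreal_iff less_suminf_ennreal_iff)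

lemma less_sum_sqd_iff:
  "\<alpha> > 0 \<Longrightarrow> ennreal (\<alpha>\<^sup>2) < (\<Sum>i<n. sqd f i x) \<longleftrightarrow> \<alpha> < square_fun_upto f n x"
  using abs_le_square_iff[of "square_fun_upto f n x" \<alpha>]
  by (simp add: sum_sqd ennreal_less_iff square_fun_upto_nonneg not_le[symmetric])

lemma level_square':
  assumes "\<alpha> > 0"
  shows "level (square_fun f) \<alpha> = (\<Union>n. {x \<in> space M. \<alpha> < square_fun_upto f n x})"
  by (simp add: level_square[OF assms] less_sum_sqd_iff[OF assms])

text \<open>The sum through \<open>n\<close> is still \<open>F n\<close>-measurable, so each
  entrance set is as early as adaptedness permits; this is what spares \<open>csqd_increment\<close>
  an overshoot. Starting the union with one summand loses nothing, because the empty sum is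
  zero.\<close>

lemma level_cond_square:
  assumes "\<alpha> > 0"
  shows "level (cond_square_fun M F f) \<alpha> = (\<Union>n. {x \<in> space M. ennreal (\<alpha>\<^sup>2) < (\<Sum>i<Suc n. csqd f i x)})"
proof -
  have "(\<exists>n. ennreal (\<alpha>\<^sup>2) < (\<Sum>i<n. csqd f i x)) \<longleftrightarrow> (\<exists>n. ennreal (\<alpha>\<^sup>2) < (\<Sum>i<Suc n. csqd f i x))" for x
    by (metis lessThan_0 not_less_zero old.nat.exhaust sum.empty)
  then show ?thesis using assms
    by (auto simp: level_def cond_square_fun_eq less_sqrt_ennreal_iff less_suminf_ennreal_iff simp del: sum.lessThan_Suc)
qed

lemma control_limit_eq:
  "l \<in> control_seqs M F \<Longrightarrow> x \<in> space M \<Longrightarrow> control_limit l x = (SUP n. ereal (l n x))"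
  unfolding control_limit_def
  by (intro limI LIMSEQ_SUP) (auto simp: incseq_def control_seqsD(4))

lemma control_limit_measurable [measurable]:
  assumes l: "l \<in> control_seqs M F"
  shows "control_limit l \<in> borel_measurable M"
proof -
  have [measurable]: "l n \<in> borel_measurable M" for n using l by (rule control_seqsD)
  have "(\<lambda>x. SUP n. ereal (l n x)) \<in> borel_measurable M" by measurable
  then show ?thesis by (subst measurable_cong[OF control_limit_eq[OF l]])
qed

lemma level_control:
  assumes "l \<in> control_seqs M F"
  shows "level (control_limit l) \<alpha> = (\<Union>n. {x \<in> space M. \<alpha> < l n x})"
proof -
  have "\<bar>control_limit l x\<bar> = (SUP n. ereal (l n x))" if "x \<in> space M" for x
    unfolding control_limit_eq[OF assms that] using control_seqsD(3)[OF assms that]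
    by (intro abs_ereal_ge0 SUP_upper2[of 0]) auto
  then show ?thesis by (auto simp: level_def less_SUP_iff)
qed

lemma not_level_control:
  "l \<in> control_seqs M F \<Longrightarrow> x \<in> space M \<Longrightarrow> x \<notin> level (control_limit l) \<alpha> \<Longrightarrow> l i x \<le> \<alpha>"
  by (auto simp: level_control not_less)

lemma control_set: "l \<in> control_seqs M F \<Longrightarrow> {x \<in> space M. l i x \<le> a} \<in> sets (F i)"
proof -
  assume "l \<in> control_seqs M F"
  then have [measurable]: "l i \<in> borel_measurable (F i)" by (rule control_seqsD)
  have "{x \<in> space M. l i x \<le> a} = {x \<in> space (F i). l i x \<le> a}" by simp
  also have "\<dots> \<in> sets (F i)" by measurable
  finally show ?thesis .
qed

lemma csqd_sum_set:
  shows "{x \<in> space M. (\<Sum>j<Suc i. csqd f j x) \<le> a} \<in> sets (F i)"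
    and "{x \<in> space M. a < (\<Sum>j<Suc i. csqd f j x)} \<in> sets (F i)"
proof -
  have [measurable]: "(\<lambda>x. \<Sum>j<Suc i. csqd f j x) \<in> borel_measurable (F i)"
    by (intro borel_measurable_sum csqd_measurable_F) auto
  have "{x \<in> space M. (\<Sum>j<Suc i. csqd f j x) \<le> a} = {x \<in> space (F i). (\<Sum>j<Suc i. csqd f j x) \<le> a}"
    "{x \<in> space M. a < (\<Sum>j<Suc i. csqd f j x)} = {x \<in> space (F i). a < (\<Sum>j<Suc i. csqd f j x)}" by simp_all
  moreover have "{x \<in> space (F i). (\<Sum>j<Suc i. csqd f j x) \<le> a} \<in> sets (F i)" 
    "{x \<in> space (F i). a < (\<Sum>j<Suc i. csqd f j x)} \<in> sets (F i)" by measurable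
  ultimately show "{x \<in> space M. (\<Sum>j<Suc i. csqd f j x) \<le> a} \<in> sets (F i)"
    "{x \<in> space M. a < (\<Sum>j<Suc i. csqd f j x)} \<in> sets (F i)" by simp_all
qed

section \<open>Summation and Chebyshev estimates\<close>

lemma sum_integral_le:
  fixes p :: "nat \<Rightarrow> 'a set"
  assumes C: "C \<in> sets M" and p: "\<And>i. p i \<in> sets M" and g: "\<And>i. g i \<in> borel_measurable M" and a: "a \<ge> 0"
    and le: "AE x in M. (\<Sum>i<N. indicator (p i) x * g i x) \<le> ennreal a"
  shows "(\<Sum>i\<in>{n..<N}. \<integral>\<^sup>+x. indicator (C \<inter> p i) x * g i x \<partial>M) \<le> ennreal (a * prob C)"
proof -
  have [measurable]: "C \<in> sets M" "p i \<in> sets M" "g i \<in> borel_measurable M" for i by fact+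
  have "(\<Sum>i\<in>{n..<N}. \<integral>\<^sup>+x. indicator (C \<inter> p i) x * g i x \<partial>M) \<le> (\<Sum>i<N. \<integral>\<^sup>+x. indicator (C \<inter> p i) x * g i x \<partial>M)"
    by (intro sum_mono2) auto
  also have "\<dots> = (\<integral>\<^sup>+x. (\<Sum>i<N. indicator (C \<inter> p i) x * g i x) \<partial>M)"
    by (rule nn_integral_sum[symmetric]) measurable
  also have "\<dots> \<le> (\<integral>\<^sup>+x. ennreal a * indicator C x \<partial>M)"
    using le by (intro nn_integral_mono_AE, eventually_elim) (auto simp: indicator_inter_arith split: split_indicator)
  also have "\<dots> = ennreal (a * prob C)"
    using a by (simp add: nn_integral_cmult_indicator emeasure_eq_measure ennreal_mult'[symmetric])
  finally show ?thesis .
qed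

lemma suminf_integral_le:
  fixes g :: "nat \<Rightarrow> 'a \<Rightarrow> ennreal"
  assumes g: "\<And>i. g i \<in> borel_measurable N"
    and le: "\<And>m. (\<Sum>i\<in>{n..<m}. \<integral>\<^sup>+x. g i x \<partial>N) \<le> B"
  shows "(\<integral>\<^sup>+x. (\<Sum>i. if n \<le> i then g i x else 0) \<partial>N) \<le> B"
proof -
  have "(\<integral>\<^sup>+x. (\<Sum>i. if n \<le> i then g i x else 0) \<partial>N) = (\<Sum>i. \<integral>\<^sup>+x. (if n \<le> i then g i x else 0) \<partial>N)"
    using g by (intro nn_integral_suminf) auto
  also have "\<dots> \<le> B"
  proof (rule suminf_le_const[OF summableI])
    fix m
    have "(\<Sum>i<m. \<integral>\<^sup>+x. (if n \<le> i then g i x else 0) \<partial>N) = (\<Sum>i<m. if n \<le> i then \<integral>\<^sup>+x. g i x \<partial>N else 0)"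
      by (intro sum.cong) auto
    also have "\<dots> = (\<Sum>i\<in>{i\<in>{..<m}. n \<le> i}. \<integral>\<^sup>+x. g i x \<partial>N)"
      by (rule sum.inter_filter[symmetric]) simp
    also have "{i\<in>{..<m}. n \<le> i} = {n..<m}" by auto
    finally show "(\<Sum>i<m. \<integral>\<^sup>+x. (if n \<le> i then g i x else 0) \<partial>N) \<le> B" using le by simp
  qed
  finally show ?thesis .
qed

lemma sum_le_suminf_from:
  fixes h :: "nat \<Rightarrow> ennreal"
  shows "(\<Sum>i\<in>{n..<m}. h i) \<le> (\<Sum>i. if n \<le> i then h i else 0)"
proof -
  have "(\<Sum>i\<in>{n..<m}. h i) = (\<Sum>i\<in>{n..<m}. if n \<le> i then h i else 0)" by simp
  also have "\<dots> \<le> (\<Sum>i. if n \<le> i then h i else 0)"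
    by (rule sum_le_suminf) auto
  finally show ?thesis .
qed

lemma prob_le_of_integral:
  assumes "A \<in> sets M" "AE x in M. x \<in> A \<longrightarrow> ennreal b \<le> h x" "(\<integral>\<^sup>+x. h x \<partial>M) \<le> ennreal c" "0 \<le> b" "0 \<le> c"
  shows "b * prob A \<le> c"
proof -
  have "ennreal (b * prob A) = (\<integral>\<^sup>+x. ennreal b * indicator A x \<partial>M)"
    using assms by (simp add: nn_integral_cmult_indicator emeasure_eq_measure ennreal_mult'[symmetric])
  also have "\<dots> \<le> (\<integral>\<^sup>+x. h x \<partial>M)"
    using assms(2) by (intro nn_integral_mono_AE, eventually_elim) (auto split: split_indicator)
  also have "\<dots> \<le> ennreal c" by fact
  finally show ?thesis using assms by simp
qed

text \<open>Here \<open>\<beta> = 1 + 4 * \<delta>\<close>. At the entrance time the previous value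
  is at most \<open>\<alpha>\<close> and the jump at most \<open>\<delta> * \<alpha>\<close>, so
  reaching \<open>\<beta> * \<alpha>\<close> takes a further increment above
  \<open>3 * (\<delta> * \<alpha>)\<close>. The second moment available is
  \<open>(\<delta> * \<alpha>)\<^sup>2\<close>, and \<open>maximal_increment\<close> gives 1/9,
  below 1/2. Entrance at time 0 is excluded by \<open>f 0 = 0\<close>.\<close>

lemma maximal_good_lambda:
  assumes f: "f \<in> martingales0 M F" and p: "\<And>i. p i \<in> sets (F i)" and C: "C \<in> sets (F n)"
    and Csub: "C \<subseteq> disjointed (\<lambda>n. {x \<in> space M. \<alpha> < \<bar>f n x\<bar>}) n"
    and \<alpha>: "\<alpha> > 0" and \<beta>: "\<beta> > 1" and \<delta>: "\<delta> = (\<beta> - 1) / 4"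
    and le: "\<And>N. (\<Sum>i\<in>{n..<N}. \<integral>\<^sup>+x. indicator (C \<inter> p i) x * sqd f i x \<partial>M) \<le> ennreal ((\<delta> * \<alpha>)\<^sup>2 * prob C)"
    and A: "A \<in> sets M"
      "AE x in M. x \<in> A \<longrightarrow> (\<forall>i. x \<in> p i) \<and> (\<forall>i. \<bar>mdiff f (Suc i) x\<bar> \<le> \<delta> * \<alpha>) \<and> x \<in> level (maximal_fun f) (\<beta> * \<alpha>)"
  shows "prob (C \<inter> A) \<le> 1 / 2 * prob C"
proof -
  have [measurable]: "f m \<in> borel_measurable M" for m using f by (rule mart_measurable)
  have [measurable]: "C \<in> sets M" "p i \<in> sets M" for i using C p sets_F_M by auto
  define G where "G = C \<inter> (\<Inter>i. p i) \<inter> {x \<in> space M. \<exists>m\<ge>n. 3 * (\<delta> * \<alpha>) < \<bar>f m x - f n x\<bar>}"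
  have \<delta>0: "\<delta> * \<alpha> > 0" using \<alpha> \<beta> \<delta> by simp
  have "(3 * (\<delta> * \<alpha>))\<^sup>2 * prob G \<le> (\<delta> * \<alpha>)\<^sup>2 * prob C"
    unfolding G_def using \<delta>0 by (intro maximal_increment f p C le) auto
  then have "(\<delta> * \<alpha>)\<^sup>2 * (9 * prob G) \<le> (\<delta> * \<alpha>)\<^sup>2 * prob C" by (simp add: power_mult_distrib)
  then have G9: "9 * prob G \<le> prob C" using \<delta>0 by (metis mult_le_cancel_left_pos zero_less_power)
  have "prob (C \<inter> A) \<le> prob G"
  proof (rule finite_measure_mono_AE)
    show "AE x in M. x \<in> C \<inter> A \<longrightarrow> x \<in> G"
      using A(2) martingales0D(3)[OF f] AE_space
    proof eventually_elim
      case (elim x)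
      show ?case
      proof
        assume x: "x \<in> C \<inter> A"
        have Cx: "\<alpha> < \<bar>f n x\<bar>" "\<And>i. i < n \<Longrightarrow> \<bar>f i x\<bar> \<le> \<alpha>"
          using x Csub elim(3) by (auto simp: disjointed_def not_less)
        have "n \<noteq> 0"
        proof
          assume "n = 0"
          then show False using Cx(1) elim(2) \<alpha> by simp
        qed
        then obtain k where k: "n = Suc k" by (cases n) auto
        have "\<bar>mdiff f (Suc k) x\<bar> \<le> \<delta> * \<alpha>" using elim(1) x by blast
        then have fn: "\<bar>f n x\<bar> \<le> \<alpha> + \<delta> * \<alpha>" using Cx(2)[of k] by (simp add: k mdiff_Suc)
        obtain m where m: "\<beta> * \<alpha> < \<bar>f m x\<bar>" using elim(1) x by (auto simp: level_maximal)
        have "m \<ge> n"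
        proof (rule ccontr)
          assume "\<not> m \<ge> n"
          then have "\<bar>f m x\<bar> \<le> \<alpha>" using Cx by auto
          moreover have "\<alpha> < \<beta> * \<alpha>" using \<beta> \<alpha> by simp
          ultimately show False using m by simp
        qed
        moreover have "3 * (\<delta> * \<alpha>) + (\<alpha> + \<delta> * \<alpha>) = \<beta> * \<alpha>" by (simp add: \<delta> field_simps)
        then have "3 * (\<delta> * \<alpha>) < \<bar>f m x - f n x\<bar>" using m fn by linarith
        ultimately show "x \<in> G" using x elim by (auto simp: G_def)
      qed
    qed
    show "G \<in> sets M" unfolding G_def by measurable
  qed
  then show ?thesis using G9 measure_nonneg[of M G] by linarith
qed

lemma abs_level_sets:
  assumes f: "f \<in> martingales0 M F"
  shows "{x \<in> space M. \<alpha> < \<bar>f n x\<bar>} \<in> sets (F n)"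
proof -
  have [measurable]: "f n \<in> borel_measurable (F n)" by (rule martingales0D[OF f])
  have "{x \<in> space M. \<alpha> < \<bar>f n x\<bar>} = {x \<in> space (F n). \<alpha> < \<bar>f n x\<bar>}" by simp
  also have "\<dots> \<in> sets (F n)" by measurable
  finally show ?thesis .
qed

lemma sqd_sum_set:
  assumes f: "f \<in> martingales0 M F"
  shows "{x \<in> space M. a < (\<Sum>j<i. sqd f j x)} \<in> sets (F i)"
proof -
  have [measurable]: "(\<lambda>x. \<Sum>j<i. sqd f j x) \<in> borel_measurable (F i)"
    by (intro borel_measurable_sum sqd_measurable_F[OF f]) auto
  have "{x \<in> space M. a < (\<Sum>j<i. sqd f j x)} = {x \<in> space (F i). a < (\<Sum>j<i. sqd f j x)}" by simp
  also have "\<dots> \<in> sets (F i)" by measurable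
  finally show ?thesis .
qed

text \<open>The set where the sum of squares through time \<open>Suc i\<close> is within bounds is
  in general not predictable, but it contains the predictable set \<open>{l i \<le> a}\<close> up to
  a null set, so \<open>stopped_sum_le\<close> applies.\<close>

lemma controlled_sqd_sum:
  assumes f: "f \<in> martingales0 M F" and l: "l \<in> control_seqs M F"
    and dom: "\<And>i. AE x in M. square_fun_upto f (Suc i) x \<le> l i x"
  shows "AE x in M. (\<Sum>i<N. indicator {x \<in> space M. l i x \<le> a} x * sqd f i x) \<le> ennreal (a\<^sup>2)"
proof -
  have "AE x in M. \<forall>i. square_fun_upto f (Suc i) x \<le> l i x" using dom by (simp add: AE_all_countable)
  then show ?thesis
  proof eventually_elim
    case (elim x)
    have "(\<Sum>i<N. indicator {x \<in> space M. l i x \<le> a} x * sqd f i x)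
        \<le> (\<Sum>i<N. if (\<Sum>j<Suc i. sqd f j x) \<le> ennreal (a\<^sup>2) then sqd f i x else 0)"
    proof (intro sum_mono)
      fix i
      have "(\<Sum>j<Suc i. sqd f j x) \<le> ennreal (a\<^sup>2)" if "l i x \<le> a"
      proof -
        have "square_fun_upto f (Suc i) x \<le> a" using elim that by (meson order.trans)
        then show ?thesis unfolding sum_sqd using square_fun_upto_nonneg by (intro ennreal_leI power_mono)
      qed
      then show "indicator {x \<in> space M. l i x \<le> a} x * sqd f i x
        \<le> (if (\<Sum>j<Suc i. sqd f j x) \<le> ennreal (a\<^sup>2) then sqd f i x else 0)"
        by (auto simp: indicator_def simp del: sum.lessThan_Suc)
    qed
    also have "\<dots> \<le> ennreal (a\<^sup>2)" using stopped_sum_le[where b="\<lambda>i. sqd f i x"] by (meson min.boundedE)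
    finally show ?case .
  qed
qed

text \<open>The control serves both needs of \<open>maximal_good_lambda\<close>:
  \<open>l i \<le> \<delta> * \<alpha>\<close> is a predictable condition that bounds the sum of
  squares through time \<open>Suc i\<close> and with it the jump at that time.\<close>

lemma maximal_le_square_control:
  assumes "A_infinity M F \<phi>"
  shows "\<exists>C>0. \<forall>f\<in>martingales0 M F. \<forall>l. square_controls l f \<longrightarrow>
    WL_norm M \<phi> (maximal_fun f) \<le> ennreal C * WL_norm M \<phi> (control_limit l)"
proof -
  obtain \<beta> C :: real where \<beta>: "\<beta> > 1" and C: "weak_type_bound C (good_lambda_pair \<beta> ((\<beta> - 1) / 4))"
    using good_lambda[OF assms, of 4] by auto
  define \<delta> where "\<delta> = (\<beta> - 1) / 4"
  note main = weak_type_boundD(2)[OF C[folded \<delta>_def]]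
  have \<delta>: "\<delta> > 0" using \<beta> by (simp add: \<delta>_def)
  show ?thesis
  proof (intro exI[of _ C] conjI ballI allI impI)
    show "C > 0" by (rule weak_type_boundD(1)[OF C])
    fix f l assume f: "f \<in> martingales0 M F" and "square_controls l f"
    then have l: "l \<in> control_seqs M F" and dom: "\<forall>i. AE x in M. square_fun_upto f (Suc i) x \<le> l i x"
      by (simp_all add: square_controls_def)
    define Y where "Y = control_limit l"
    have Y[measurable]: "Y \<in> borel_measurable M" using l by (simp add: Y_def)
    have X[measurable]: "maximal_fun f \<in> borel_measurable M" using f by simp
    have pair: "good_lambda_pair \<beta> \<delta> (maximal_fun f) Y Y"
    proof (rule good_lambda_pairI[where U="\<lambda>\<alpha> n. {x \<in> space M. \<alpha> < \<bar>f n x\<bar>}"])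
      fix \<alpha> :: real and n C assume \<alpha>: "0 < \<alpha>" and C: "C \<in> sets (F n)"
        and Csub: "C \<subseteq> disjointed (\<lambda>n. {x \<in> space M. \<alpha> < \<bar>f n x\<bar>}) n"
      show "prob (C \<inter> (level (maximal_fun f) (\<beta> * \<alpha>) - level Y (\<delta> * \<alpha>) - level Y (\<delta> * \<alpha>))) \<le> 1 / 2 * prob C"
      proof (rule maximal_good_lambda[OF f _ C Csub \<alpha> \<beta> \<delta>_def, where p="\<lambda>i. {x \<in> space M. l i x \<le> \<delta> * \<alpha>}"])
        show "{x \<in> space M. l i x \<le> \<delta> * \<alpha>} \<in> sets (F i)" for i by (rule control_set[OF l])
        show "(\<Sum>i\<in>{n..<N}. \<integral>\<^sup>+x. indicator (C \<inter> {x \<in> space M. l i x \<le> \<delta> * \<alpha>}) x * sqd f i x \<partial>M)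
            \<le> ennreal ((\<delta> * \<alpha>)\<^sup>2 * prob C)" for N
          using dom by (intro sum_integral_le controlled_sqd_sum f l sets_F_M[OF C] sets_F_M[OF control_set[OF l]] sqd_measurable) auto
        have "AE x in M. \<forall>i. square_fun_upto f (Suc i) x \<le> l i x" using dom by (simp add: AE_all_countable)
        then show "AE x in M. x \<in> level (maximal_fun f) (\<beta> * \<alpha>) - level Y (\<delta> * \<alpha>) - level Y (\<delta> * \<alpha>) \<longrightarrow>
            (\<forall>i. x \<in> {x \<in> space M. l i x \<le> \<delta> * \<alpha>}) \<and> (\<forall>i. \<bar>mdiff f (Suc i) x\<bar> \<le> \<delta> * \<alpha>) \<and> x \<in> level (maximal_fun f) (\<beta> * \<alpha>)"
          using AE_space
        proof eventually_elim
          case (elim x)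
          have "l i x \<le> \<delta> * \<alpha>" if "x \<notin> level Y (\<delta> * \<alpha>)" for i
            using not_level_control[OF l elim(2)] that by (simp add: Y_def)
          moreover have "\<bar>mdiff f (Suc i) x\<bar> \<le> l i x" for i
            using elim(1) mdiff_le_square_fun_upto[of f i x] by (meson order.trans)
          ultimately have "\<forall>i. l i x \<le> \<delta> * \<alpha> \<and> \<bar>mdiff f (Suc i) x\<bar> \<le> \<delta> * \<alpha>" if "x \<notin> level Y (\<delta> * \<alpha>)"
            using that by (blast intro: order.trans)
          then show ?case using elim(2) by blast
        qed
      qed simp
    qed (use level_maximal abs_level_sets[OF f] in auto)
    show "WL_norm M \<phi> (maximal_fun f) \<le> ennreal C * WL_norm M \<phi> (control_limit l)"
      using main[OF _ Y Y pair] f by (simp add: Y_def)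
  qed
qed

text \<open>Stopping has to be predictable and therefore uses the partial sums of
  \<open>csqd\<close>; integrals of \<open>csqd\<close> and \<open>sqd\<close> agree against such
  coefficients. These sums do not bound a single jump, so the square function enters as a second
  controlling function.\<close>

lemma maximal_le_square_and_cond_square:
  assumes "A_infinity M F \<phi>"
  shows "\<exists>C>0. \<forall>f\<in>martingales0 M F. WHM_norm M \<phi> f \<le> ennreal C * max (WHS_norm M \<phi> f) (WHs_norm M F \<phi> f)"
proof -
  obtain \<beta> C :: real where \<beta>: "\<beta> > 1" and C: "weak_type_bound C (good_lambda_pair \<beta> ((\<beta> - 1) / 4))"
    using good_lambda[OF assms, of 4] by auto
  define \<delta> where "\<delta> = (\<beta> - 1) / 4"
  note main = weak_type_boundD(2)[OF C[folded \<delta>_def]]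
  have \<delta>: "\<delta> > 0" using \<beta> by (simp add: \<delta>_def)
  show ?thesis
  proof (intro exI[of _ C] conjI ballI allI impI)
    show "C > 0" by (rule weak_type_boundD(1)[OF C])
    fix f assume f: "f \<in> martingales0 M F"
    have X[measurable]: "maximal_fun f \<in> borel_measurable M" "square_fun f \<in> borel_measurable M" using f by simp_all
    have pair: "good_lambda_pair \<beta> \<delta> (maximal_fun f) (cond_square_fun M F f) (square_fun f)"
    proof (rule good_lambda_pairI[where U="\<lambda>\<alpha> n. {x \<in> space M. \<alpha> < \<bar>f n x\<bar>}"])
      fix \<alpha> :: real and n C assume \<alpha>: "0 < \<alpha>" and C: "C \<in> sets (F n)"
        and Csub: "C \<subseteq> disjointed (\<lambda>n. {x \<in> space M. \<alpha> < \<bar>f n x\<bar>}) n"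
      have \<delta>\<alpha>: "\<delta> * \<alpha> > 0" using \<delta> \<alpha> by simp
      define p where "p i = {x \<in> space M. (\<Sum>j<Suc i. csqd f j x) \<le> ennreal ((\<delta> * \<alpha>)\<^sup>2)}" for i
      have p: "p i \<in> sets (F i)" for i unfolding p_def by (rule csqd_sum_set)
      show "prob (C \<inter> (level (maximal_fun f) (\<beta> * \<alpha>) - level (cond_square_fun M F f) (\<delta> * \<alpha>) - level (square_fun f) (\<delta> * \<alpha>)))
          \<le> 1 / 2 * prob C"
      proof (rule maximal_good_lambda[OF f p C Csub \<alpha> \<beta> \<delta>_def])
        fix N
        have "(\<Sum>i\<in>{n..<N}. \<integral>\<^sup>+x. indicator (C \<inter> p i) x * sqd f i x \<partial>M)
            = (\<Sum>i\<in>{n..<N}. \<integral>\<^sup>+x. indicator (C \<inter> p i) x * csqd f i x \<partial>M)"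
        proof (intro sum.cong refl csqd_integral[symmetric] f)
          fix i assume "i \<in> {n..<N}"
          then have "C \<inter> p i \<in> sets (F i)" using sets_F_mono[OF _ C] p by auto
          then show "indicator (C \<inter> p i) \<in> borel_measurable (F i)" by simp
        qed
        also have "\<dots> \<le> ennreal ((\<delta> * \<alpha>)\<^sup>2 * prob C)"
        proof (intro sum_integral_le sets_F_M[OF C] sets_F_M[OF p] csqd_measurable AE_I2)
          fix x
          have "(\<Sum>i<N. indicator (p i) x * csqd f i x)
              \<le> (\<Sum>i<N. if (\<Sum>j<Suc i. csqd f j x) \<le> ennreal ((\<delta> * \<alpha>)\<^sup>2) then csqd f i x else 0)"
            by (intro sum_mono) (auto simp: p_def indicator_def simp del: sum.lessThan_Suc)
          also have "\<dots> \<le> ennreal ((\<delta> * \<alpha>)\<^sup>2)" using stopped_sum_le[where b="\<lambda>i. csqd f i x"] by (meson min.boundedE)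
          finally show "(\<Sum>i<N. indicator (p i) x * csqd f i x) \<le> ennreal ((\<delta> * \<alpha>)\<^sup>2)" .
        qed simp
        finally show "(\<Sum>i\<in>{n..<N}. \<integral>\<^sup>+x. indicator (C \<inter> p i) x * sqd f i x \<partial>M) \<le> ennreal ((\<delta> * \<alpha>)\<^sup>2 * prob C)" .
      next
        show "AE x in M. x \<in> level (maximal_fun f) (\<beta> * \<alpha>) - level (cond_square_fun M F f) (\<delta> * \<alpha>) - level (square_fun f) (\<delta> * \<alpha>) \<longrightarrow>
            (\<forall>i. x \<in> p i) \<and> (\<forall>i. \<bar>mdiff f (Suc i) x\<bar> \<le> \<delta> * \<alpha>) \<and> x \<in> level (maximal_fun f) (\<beta> * \<alpha>)"
        proof (intro AE_I2 impI conjI allI)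
          fix x i assume x: "x \<in> space M" "x \<in> level (maximal_fun f) (\<beta> * \<alpha>) - level (cond_square_fun M F f) (\<delta> * \<alpha>) - level (square_fun f) (\<delta> * \<alpha>)"
          show "x \<in> p i" using x by (auto simp: level_cond_square[OF \<delta>\<alpha>] p_def not_less simp del: sum.lessThan_Suc)
          have "square_fun_upto f (Suc i) x \<le> \<delta> * \<alpha>"
            using x by (auto simp: level_square'[OF \<delta>\<alpha>] not_less)
          then show "\<bar>mdiff f (Suc i) x\<bar> \<le> \<delta> * \<alpha>" using mdiff_le_square_fun_upto[of f i x] by linarith
        qed auto
      qed measurable
    qed (use level_maximal abs_level_sets[OF f] in auto)
    show "WHM_norm M \<phi> f \<le> ennreal C * max (WHS_norm M \<phi> f) (WHs_norm M F \<phi> f)"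
      using main[OF X(1) cond_square_fun_measurable X(2) pair]
      by (simp add: WHM_norm_def WHS_norm_def WHs_norm_def max.commute)
  qed
qed

text \<open>In units of \<open>\<delta> * \<alpha>\<close>, the gap between \<open>\<alpha>\<close>
  and \<open>\<beta> * \<alpha>\<close> is 8. The jump at entrance takes at most 2, since
  differences are bounded by \<open>2 * l i\<close>, so the square function must still grow by more
  than 6. The square 36 is compared with the second moment 4 from \<open>control_increment\<close>,
  which leaves 1/9.\<close>

lemma square_le_control:
  assumes "A_infinity M F \<phi>"
  shows "\<exists>C>0. \<forall>f\<in>martingales0 M F. \<forall>l. controls l f \<longrightarrow>
    WL_norm M \<phi> (square_fun f) \<le> ennreal C * WL_norm M \<phi> (control_limit l)"
proof -
  obtain \<beta> C :: real where \<beta>: "\<beta> > 1" and C: "weak_type_bound C (good_lambda_pair \<beta> ((\<beta> - 1) / 8))"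
    using good_lambda[OF assms, of 8] by auto
  define \<delta> where "\<delta> = (\<beta> - 1) / 8"
  note main = weak_type_boundD(2)[OF C[folded \<delta>_def]]
  have \<delta>: "\<delta> > 0" using \<beta> by (simp add: \<delta>_def)
  show ?thesis
  proof (intro exI[of _ C] conjI ballI allI impI)
    show "C > 0" by (rule weak_type_boundD(1)[OF C])
    fix f l assume f: "f \<in> martingales0 M F" and "controls l f"
    then have l: "l \<in> control_seqs M F" and dom: "\<forall>i. AE x in M. \<bar>f (Suc i) x\<bar> \<le> l i x"
      by (simp_all add: controls_def)
    define Y where "Y = control_limit l"
    have Y[measurable]: "Y \<in> borel_measurable M" using l by (simp add: Y_def)
    have X[measurable]: "square_fun f \<in> borel_measurable M" "\<And>i. sqd f i \<in> borel_measurable M" using f by simp_all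
    have dom': "AE x in M. \<forall>i. \<bar>mdiff f (Suc i) x\<bar> \<le> 2 * l i x"
      using control_dominates[OF f l dom]
    proof eventually_elim
      case (elim x)
      then show ?case unfolding mdiff_Suc by (smt (verit))
    qed
    have pair: "good_lambda_pair \<beta> \<delta> (square_fun f) Y Y"
    proof (rule good_lambda_pairI[where U="\<lambda>\<alpha> n. {x \<in> space M. ennreal (\<alpha>\<^sup>2) < (\<Sum>i<n. sqd f i x)}"])
      fix \<alpha> :: real and n C assume \<alpha>: "0 < \<alpha>" and C: "C \<in> sets (F n)"
        and Csub: "C \<subseteq> disjointed (\<lambda>n. {x \<in> space M. ennreal (\<alpha>\<^sup>2) < (\<Sum>i<n. sqd f i x)}) n"
      define A where "A = level (square_fun f) (\<beta> * \<alpha>) - level Y (\<delta> * \<alpha>) - level Y (\<delta> * \<alpha>)"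
      have [measurable]: "A \<in> sets M" unfolding A_def by measurable
      define p where "p i = {x \<in> space M. l i x \<le> \<delta> * \<alpha>}" for i
      have [measurable]: "p i \<in> sets M" "C \<in> sets M" for i
        using sets_F_M[OF control_set[OF l]] sets_F_M[OF C] by (simp_all add: p_def)
      have d0: "\<delta> * \<alpha> > 0" "\<beta> * \<alpha> > 0" using \<delta> \<alpha> \<beta> by auto
      have "(6 * (\<delta> * \<alpha>))\<^sup>2 * prob (C \<inter> A) \<le> 4 * (\<delta> * \<alpha>)\<^sup>2 * prob C"
      proof (rule prob_le_of_integral)
        show "(\<integral>\<^sup>+x. (\<Sum>i. if n \<le> i then indicator (C \<inter> p i) x * sqd f i x else 0) \<partial>M) \<le> ennreal (4 * (\<delta> * \<alpha>)\<^sup>2 * prob C)"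
        proof (rule suminf_integral_le)
          show "(\<Sum>i\<in>{n..<m}. \<integral>\<^sup>+x. indicator (C \<inter> p i) x * sqd f i x \<partial>M) \<le> ennreal (4 * (\<delta> * \<alpha>)\<^sup>2 * prob C)" for m
            unfolding p_def using d0 by (intro control_increment[OF f l dom C]) auto
        qed measurable
        show "AE x in M. x \<in> C \<inter> A \<longrightarrow> ennreal ((6 * (\<delta> * \<alpha>))\<^sup>2)
            \<le> (\<Sum>i. if n \<le> i then indicator (C \<inter> p i) x * sqd f i x else 0)"
          using dom' AE_space
        proof eventually_elim
          case (elim x)
          show ?case
          proof
            assume x: "x \<in> C \<inter> A"
            define s where "s m = square_fun_upto f m x" for m
            have s_mono: "s i \<le> s j" if "i \<le> j" for i j using that by (simp add: s_def square_fun_upto_mono)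
            have lx: "l i x \<le> \<delta> * \<alpha>" for i
              using not_level_control[OF l elim(2)] x by (simp add: A_def Y_def)
            have sn: "\<alpha> < s n" "\<And>i. i < n \<Longrightarrow> s i \<le> \<alpha>"
              using x Csub elim(2) by (auto simp: disjointed_def not_less s_def less_sum_sqd_iff[OF \<alpha>])
            have "n \<noteq> 0"
            proof
              assume "n = 0"
              then show False using sn(1) \<alpha> by (simp add: s_def square_fun_upto_def)
            qed
            then obtain k where k: "n = Suc k" by (cases n) auto
            have "\<bar>mdiff f (Suc k) x\<bar> \<le> 2 * l k x" using elim by blast
            then have sn': "s n \<le> \<alpha> + 2 * (\<delta> * \<alpha>)"
              using sn(2)[of k] square_fun_upto_Suc_le[of f k x] lx[of k] by (simp add: s_def k)
            obtain N where N: "\<beta> * \<alpha> < s N" using x by (auto simp: A_def level_square'[OF d0(2)] s_def)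
            have split: "6 * (\<delta> * \<alpha>) + (\<alpha> + 2 * (\<delta> * \<alpha>)) = \<beta> * \<alpha>" by (simp add: \<delta>_def field_simps)
            have "n \<le> N" using s_mono[of N n] N sn' split d0 by linarith
            \<comment> \<open>For nonnegative numbers, the difference of the squares dominates the
              square of the difference.\<close>
            have "(6 * (\<delta> * \<alpha>))\<^sup>2 + (s n)\<^sup>2 \<le> (6 * (\<delta> * \<alpha>) + s n)\<^sup>2"
              using d0 sn(1) \<alpha> by (simp add: power2_sum)
            also have "6 * (\<delta> * \<alpha>) + s n \<le> s N" using N sn' split by linarith
            then have "(6 * (\<delta> * \<alpha>) + s n)\<^sup>2 \<le> (s N)\<^sup>2" using d0 sn(1) \<alpha> by (intro power_mono) auto
            finally have "(6 * (\<delta> * \<alpha>))\<^sup>2 \<le> (s N)\<^sup>2 - (s n)\<^sup>2" by simp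
            also have "(s N)\<^sup>2 - (s n)\<^sup>2 = (\<Sum>i\<in>{n..<N}. \<bar>mdiff f (Suc i) x\<bar>\<^sup>2)"
              unfolding s_def square_fun_upto_squared using \<open>n \<le> N\<close>
              by (simp add: lessThan_atLeast0 sum_diff_nat_ivl)
            finally have "ennreal ((6 * (\<delta> * \<alpha>))\<^sup>2) \<le> (\<Sum>i\<in>{n..<N}. sqd f i x)"
              by (simp add: sqd_def sum_ennreal ennreal_leI)
            also have "\<dots> = (\<Sum>i\<in>{n..<N}. indicator (C \<inter> p i) x * sqd f i x)"
              using x lx elim by (intro sum.cong) (auto simp: p_def indicator_def)
            also have "\<dots> \<le> (\<Sum>i. if n \<le> i then indicator (C \<inter> p i) x * sqd f i x else 0)"
              by (rule sum_le_suminf_from)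
            finally show "ennreal ((6 * (\<delta> * \<alpha>))\<^sup>2) \<le> (\<Sum>i. if n \<le> i then indicator (C \<inter> p i) x * sqd f i x else 0)" .
          qed
        qed
      qed auto
      then have "(\<delta> * \<alpha>)\<^sup>2 * (36 * prob (C \<inter> A)) \<le> (\<delta> * \<alpha>)\<^sup>2 * (4 * prob C)" by (simp add: power_mult_distrib)
      then have "36 * prob (C \<inter> A) \<le> 4 * prob C" using d0 by (metis mult_le_cancel_left_pos zero_less_power)
      then show "prob (C \<inter> (level (square_fun f) (\<beta> * \<alpha>) - level Y (\<delta> * \<alpha>) - level Y (\<delta> * \<alpha>))) \<le> 1 / 2 * prob C"
        using measure_nonneg[of M "C \<inter> A"] unfolding A_def[symmetric] by linarith
    qed (use level_square sqd_sum_set[OF f] in auto)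
    show "WL_norm M \<phi> (square_fun f) \<le> ennreal C * WL_norm M \<phi> (control_limit l)"
      using main[OF _ Y Y pair] f by (simp add: Y_def)
  qed
qed

text \<open>The conditional square function has no overshoot: not having entered before
  \<open>n\<close> bounds the sum over \<open>i < n\<close> by \<open>\<alpha>\<^sup>2\<close>, and
  the term at \<open>n\<close>, though it causes the entrance, counts as part of the
  increment.\<close>

lemma csqd_increment:
  assumes "\<alpha> \<ge> 0" "\<gamma> \<ge> 0" "C \<subseteq> disjointed (\<lambda>n. {x \<in> space M. ennreal (\<alpha>\<^sup>2) < (\<Sum>i<Suc n. csqd f i x)}) n"
    and x: "x \<in> C" "x \<in> space M" and N: "ennreal (\<alpha>\<^sup>2 + \<gamma>) < (\<Sum>i<N. csqd f i x)"
  shows "ennreal \<gamma> \<le> (\<Sum>i. if n \<le> i then csqd f i x else 0)"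
proof -
  have le: "(\<Sum>i<n. csqd f i x) \<le> ennreal (\<alpha>\<^sup>2)"
  proof (cases n)
    case (Suc k)
    then show ?thesis using assms(3) x by (auto simp: disjointed_def not_less simp del: sum.lessThan_Suc)
  qed simp
  have "ennreal \<gamma> \<le> (\<Sum>i\<in>{n..<N}. csqd f i x)"
  proof (rule ccontr)
    assume *: "\<not> ennreal \<gamma> \<le> (\<Sum>i\<in>{n..<N}. csqd f i x)"
    have "(\<Sum>i<N. csqd f i x) \<le> (\<Sum>i\<in>{..<n} \<union> {n..<N}. csqd f i x)"
      by (intro sum_mono2) auto
    also have "\<dots> = (\<Sum>i<n. csqd f i x) + (\<Sum>i\<in>{n..<N}. csqd f i x)"
      by (intro sum.union_disjoint) auto
    also have "\<dots> \<le> ennreal (\<alpha>\<^sup>2) + ennreal \<gamma>" using le * by (intro add_mono) auto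
    also have "\<dots> = ennreal (\<alpha>\<^sup>2 + \<gamma>)" using assms by simp
    finally show False using N by simp
  qed
  also have "\<dots> \<le> (\<Sum>i. if n \<le> i then csqd f i x else 0)" by (rule sum_le_suminf_from)
  finally show ?thesis .
qed

text \<open>Without overshoot, growth from \<open>\<alpha>\<close> to
  \<open>\<alpha> + 4 * (\<delta> * \<alpha>)\<close> raises the square by at least 16 units of
  \<open>(\<delta> * \<alpha>)\<^sup>2\<close>. As \<open>csqd\<close> and \<open>sqd\<close> have
  equal integrals against the predictable indicators, \<open>control_increment\<close> bounds the
  second moment by 4 units, leaving 1/4.\<close>

lemma cond_square_le_control:
  assumes "A_infinity M F \<phi>"
  shows "\<exists>C>0. \<forall>f\<in>martingales0 M F. \<forall>l. controls l f \<longrightarrow>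
    WL_norm M \<phi> (cond_square_fun M F f) \<le> ennreal C * WL_norm M \<phi> (control_limit l)"
proof -
  obtain \<beta> C :: real where \<beta>: "\<beta> > 1" and C: "weak_type_bound C (good_lambda_pair \<beta> ((\<beta> - 1) / 4))"
    using good_lambda[OF assms, of 4] by auto
  define \<delta> where "\<delta> = (\<beta> - 1) / 4"
  note main = weak_type_boundD(2)[OF C[folded \<delta>_def]]
  have \<delta>: "\<delta> > 0" using \<beta> by (simp add: \<delta>_def)
  show ?thesis
  proof (intro exI[of _ C] conjI ballI allI impI)
    show "C > 0" by (rule weak_type_boundD(1)[OF C])
    fix f l assume f: "f \<in> martingales0 M F" and "controls l f"
    then have l: "l \<in> control_seqs M F" and dom: "\<forall>i. AE x in M. \<bar>f (Suc i) x\<bar> \<le> l i x"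
      by (simp_all add: controls_def)
    define Y where "Y = control_limit l"
    have Y[measurable]: "Y \<in> borel_measurable M" using l by (simp add: Y_def)
    have pair: "good_lambda_pair \<beta> \<delta> (cond_square_fun M F f) Y Y"
    proof (rule good_lambda_pairI[where U="\<lambda>\<alpha> n. {x \<in> space M. ennreal (\<alpha>\<^sup>2) < (\<Sum>i<Suc n. csqd f i x)}"])
      fix \<alpha> :: real and n C assume \<alpha>: "0 < \<alpha>" and C: "C \<in> sets (F n)"
        and Csub: "C \<subseteq> disjointed (\<lambda>n. {x \<in> space M. ennreal (\<alpha>\<^sup>2) < (\<Sum>i<Suc n. csqd f i x)}) n"
      define A where "A = level (cond_square_fun M F f) (\<beta> * \<alpha>) - level Y (\<delta> * \<alpha>) - level Y (\<delta> * \<alpha>)"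
      have [measurable]: "A \<in> sets M" unfolding A_def by measurable
      define p where "p i = {x \<in> space M. l i x \<le> \<delta> * \<alpha>}" for i
      have p: "p i \<in> sets (F i)" for i unfolding p_def by (rule control_set[OF l])
      have [measurable]: "p i \<in> sets M" "C \<in> sets M" for i
        using p C sets_F_M by auto
      have d0: "\<delta> * \<alpha> > 0" "\<beta> * \<alpha> > 0" using \<delta> \<alpha> \<beta> by auto
      have "(4 * (\<delta> * \<alpha>))\<^sup>2 * prob (C \<inter> A) \<le> 4 * (\<delta> * \<alpha>)\<^sup>2 * prob C"
      proof (rule prob_le_of_integral)
        have "(\<Sum>i\<in>{n..<m}. \<integral>\<^sup>+x. indicator (C \<inter> p i) x * csqd f i x \<partial>M) \<le> ennreal (4 * (\<delta> * \<alpha>)\<^sup>2 * prob C)" for m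
        proof -
          have "(\<Sum>i\<in>{n..<m}. \<integral>\<^sup>+x. indicator (C \<inter> p i) x * csqd f i x \<partial>M)
            = (\<Sum>i\<in>{n..<m}. \<integral>\<^sup>+x. indicator (C \<inter> p i) x * sqd f i x \<partial>M)"
          proof (intro sum.cong refl csqd_integral f)
            fix i assume "i \<in> {n..<m}"
            then have "C \<inter> p i \<in> sets (F i)" using sets_F_mono[OF _ C] p by auto
            then show "indicator (C \<inter> p i) \<in> borel_measurable (F i)" by simp
          qed
          also have "\<dots> \<le> ennreal (4 * (\<delta> * \<alpha>)\<^sup>2 * prob C)"
            unfolding p_def using d0 by (intro control_increment[OF f l dom C]) auto
          finally show ?thesis .
        qed
        then show "(\<integral>\<^sup>+x. (\<Sum>i. if n \<le> i then indicator (C \<inter> p i) x * csqd f i x else 0) \<partial>M) \<le> ennreal (4 * (\<delta> * \<alpha>)\<^sup>2 * prob C)"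
          by (intro suminf_integral_le) auto
        show "AE x in M. x \<in> C \<inter> A \<longrightarrow> ennreal ((4 * (\<delta> * \<alpha>))\<^sup>2)
            \<le> (\<Sum>i. if n \<le> i then indicator (C \<inter> p i) x * csqd f i x else 0)"
        proof (rule AE_I2, rule impI)
          fix x assume xM: "x \<in> space M" and x: "x \<in> C \<inter> A"
          have lx: "l i x \<le> \<delta> * \<alpha>" for i
            using not_level_control[OF l xM] x by (simp add: A_def Y_def)
          have "\<alpha>\<^sup>2 + (4 * (\<delta> * \<alpha>))\<^sup>2 \<le> (\<alpha> + 4 * (\<delta> * \<alpha>))\<^sup>2" using d0 \<alpha> by (simp add: power2_sum)
          also have "\<alpha> + 4 * (\<delta> * \<alpha>) = \<beta> * \<alpha>" by (simp add: \<delta>_def field_simps)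
          finally have "ennreal (\<alpha>\<^sup>2 + (4 * (\<delta> * \<alpha>))\<^sup>2) \<le> ennreal ((\<beta> * \<alpha>)\<^sup>2)" by (rule ennreal_leI)
          moreover obtain N where "ennreal ((\<beta> * \<alpha>)\<^sup>2) < (\<Sum>i<Suc N. csqd f i x)"
            using x by (auto simp: A_def level_cond_square[OF d0(2)] simp del: sum.lessThan_Suc)
          ultimately have "ennreal (\<alpha>\<^sup>2 + (4 * (\<delta> * \<alpha>))\<^sup>2) < (\<Sum>i<Suc N. csqd f i x)" by (rule le_less_trans)
          then have "ennreal ((4 * (\<delta> * \<alpha>))\<^sup>2) \<le> (\<Sum>i. if n \<le> i then csqd f i x else 0)"
            using x xM \<alpha> by (intro csqd_increment[OF _ _ Csub, where N="Suc N"]) (auto simp del: sum.lessThan_Suc)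
          also have "\<dots> = (\<Sum>i. if n \<le> i then indicator (C \<inter> p i) x * csqd f i x else 0)"
            using x lx xM by (intro suminf_cong) (auto simp: p_def indicator_def)
          finally show "ennreal ((4 * (\<delta> * \<alpha>))\<^sup>2) \<le> (\<Sum>i. if n \<le> i then indicator (C \<inter> p i) x * csqd f i x else 0)" .
        qed
      qed auto
      then have "(\<delta> * \<alpha>)\<^sup>2 * (16 * prob (C \<inter> A)) \<le> (\<delta> * \<alpha>)\<^sup>2 * (4 * prob C)" by (simp add: power_mult_distrib)
      then have "16 * prob (C \<inter> A) \<le> 4 * prob C" using d0 by (metis mult_le_cancel_left_pos zero_less_power)
      then show "prob (C \<inter> (level (cond_square_fun M F f) (\<beta> * \<alpha>) - level Y (\<delta> * \<alpha>) - level Y (\<delta> * \<alpha>))) \<le> 1 / 2 * prob C"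
        using measure_nonneg[of M "C \<inter> A"] unfolding A_def[symmetric] by linarith
    qed (use level_cond_square csqd_sum_set in auto)
    show "WL_norm M \<phi> (cond_square_fun M F f) \<le> ennreal C * WL_norm M \<phi> (control_limit l)"
      using main[OF _ Y Y pair] f by (simp add: Y_def)
  qed
qed

section \<open>Weighted second moments under S^- and S^+\<close>

lemma nn_integral_suminf_phi:
  fixes u g :: "nat \<Rightarrow> 'a \<Rightarrow> ennreal"
  assumes "\<And>i. u i \<in> borel_measurable M" "\<And>i. g i \<in> borel_measurable M" "0 \<le> t"
  shows "(\<integral>\<^sup>+x. (\<Sum>i. u i x * g i x) * ennreal (\<phi> x t) \<partial>M) = (\<Sum>i. \<integral>\<^sup>+x. u i x * g i x * ennreal (\<phi> x t) \<partial>M)"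
proof -
  have "(\<integral>\<^sup>+x. (\<Sum>i. u i x * g i x) * ennreal (\<phi> x t) \<partial>M) = (\<integral>\<^sup>+x. (\<Sum>i. u i x * g i x * ennreal (\<phi> x t)) \<partial>M)"
    by (simp add: ennreal_suminf_multc)
  also have "\<dots> = (\<Sum>i. \<integral>\<^sup>+x. u i x * g i x * ennreal (\<phi> x t) \<partial>M)"
    using assms by (intro nn_integral_suminf) auto
  finally show ?thesis .
qed

text \<open>Chebyshev's inequality is used in the weighted measure itself, on each entrance event.
  Between the levels \<open>\<alpha>\<close> and \<open>2 * \<alpha>\<close> the square grows by at
  least \<open>3 * \<alpha>\<^sup>2\<close>, while the weighted integral of the growth is at most
  \<open>K * (\<delta> * \<alpha>)\<^sup>2\<close> times the mass of the event: S^- replaces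
  \<open>csqd\<close> by \<open>sqd\<close>, and the control bounds the latter. A small
  \<open>\<delta>\<close> makes the ratio small, so a single doubling suffices.\<close>

lemma cond_square_le_square_control:
  assumes "S_minus M F \<phi>"
  shows "\<exists>C>0. \<forall>f\<in>martingales0 M F. \<forall>l. square_controls l f \<longrightarrow>
    WL_norm M \<phi> (cond_square_fun M F f) \<le> ennreal C * WL_norm M \<phi> (control_limit l)"
proof -
  obtain K where K: "K > 0" and swap: "\<And>f u i t. f \<in> martingales0 M F \<Longrightarrow> u \<in> borel_measurable (F i) \<Longrightarrow> 0 < t \<Longrightarrow>
    (\<integral>\<^sup>+x. u x * csqd f i x * ennreal (\<phi> x t) \<partial>M) \<le> ennreal K * (\<integral>\<^sup>+x. u x * sqd f i x * ennreal (\<phi> x t) \<partial>M)"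
    by (rule S_minus_integral[OF assms]) (rule that)
  obtain \<epsilon> :: real where eps: "\<epsilon> > 0" and good: "\<forall>B\<ge>0. \<forall>\<delta>>0. \<exists>C. weak_type_bound C (good_lambda_ineq \<epsilon> B \<delta>)"
    using good_lambda_ineq_weak_type by blast
  \<comment> \<open>Makes the Chebyshev ratio \<open>K * \<delta>\<^sup>2 / 3\<close> equal to
    \<open>\<epsilon>\<close>.\<close>
  define \<delta> where "\<delta> = sqrt (3 * \<epsilon> / K)"
  have \<delta>: "\<delta> > 0" "K * \<delta>\<^sup>2 = 3 * \<epsilon>" using eps K by (auto simp: \<delta>_def)
  obtain C where C: "weak_type_bound C (good_lambda_ineq \<epsilon> 1 \<delta>)"
    using good \<delta>(1) by (metis zero_le_one)
  show ?thesis
  proof (intro exI[of _ C] conjI ballI allI impI)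
    show "C > 0" by (rule weak_type_boundD(1)[OF C])
    fix f l assume f: "f \<in> martingales0 M F" and "square_controls l f"
    then have l: "l \<in> control_seqs M F" and dom: "\<forall>i. AE x in M. square_fun_upto f (Suc i) x \<le> l i x"
      by (simp_all add: square_controls_def)
    define Y where "Y = control_limit l"
    have Y[measurable]: "Y \<in> borel_measurable M" using l by (simp add: Y_def)
    have [measurable]: "sqd f i \<in> borel_measurable M" for i using f by simp
    have "WL_norm M \<phi> (cond_square_fun M F f) \<le> ennreal C * max (WL_norm M \<phi> Y) (WL_norm M \<phi> Y)"
    proof (rule weak_type_boundD(2)[OF C _ Y Y], simp, unfold good_lambda_ineq_def, intro allI impI)
      fix t \<alpha> :: real assume t: "0 < t" and \<alpha>: "0 < \<alpha>"
      have [measurable]: "(\<lambda>x. \<phi> x t) \<in> borel_measurable M" using t by simp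
      define U where "U n = {x \<in> space M. ennreal (\<alpha>\<^sup>2) < (\<Sum>i<Suc n. csqd f i x)}" for n
      have U: "U n \<in> sets (F n)" for n unfolding U_def by (rule csqd_sum_set)
      define A where "A = level (cond_square_fun M F f) (2 * \<alpha>) - level Y (\<delta> * \<alpha>)"
      have [measurable]: "A \<in> sets M" unfolding A_def by measurable
      define p where "p i = {x \<in> space M. l i x \<le> \<delta> * \<alpha>}" for i
      have p: "p i \<in> sets (F i)" for i unfolding p_def by (rule control_set[OF l])
      have "emeasure (Q t) A \<le> ennreal \<epsilon> * emeasure (Q t) (\<Union>n. U n)"
      proof (rule emeasure_le_first_entrance)
        show "U n \<in> sets (Q t)" for n using U sets_F_M by simp
        show "A \<in> sets (Q t)" by simp
        have "level (cond_square_fun M F f) (2 * \<alpha>) \<subseteq> level (cond_square_fun M F f) \<alpha>"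
          using \<alpha> by (intro level_antimono) auto
        then show "A \<subseteq> (\<Union>n. U n)" using level_cond_square[OF \<alpha>] by (auto simp: A_def U_def)
        fix n
        define D where "D = disjointed U n"
        have D: "D \<in> sets (F n)" unfolding D_def using U by (rule disjointed_F)
        have [measurable]: "p i \<in> sets M" "D \<in> sets M" for i using p D sets_F_M by auto
        \<comment> \<open>Vanishing before \<open>n\<close>, these coefficients are predictable
          although \<open>D\<close> is known only from time \<open>n\<close> on.\<close>
        define u :: "nat \<Rightarrow> 'a \<Rightarrow> ennreal" where "u i = (if n \<le> i then indicator (D \<inter> p i) else (\<lambda>_. 0))" for i
        have u: "u i \<in> borel_measurable (F i)" for i
          using sets_F_mono[OF _ D, of i] p by (auto simp: u_def)
        have [measurable]: "u i \<in> borel_measurable M" for i using u by (rule measurable_F_M)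
        have "ennreal (3 * \<alpha>\<^sup>2) * emeasure (Q t) (A \<inter> D) = (\<integral>\<^sup>+x. ennreal (3 * \<alpha>\<^sup>2) * (ennreal (\<phi> x t) * indicator (A \<inter> D) x) \<partial>M)"
          using t by (subst nn_integral_cmult) (auto simp: emeasure_Q)
        also have "\<dots> \<le> (\<integral>\<^sup>+x. (\<Sum>i. u i x * csqd f i x) * ennreal (\<phi> x t) \<partial>M)"
        proof (intro nn_integral_mono)
          fix x assume xM: "x \<in> space M"
          show "ennreal (3 * \<alpha>\<^sup>2) * (ennreal (\<phi> x t) * indicator (A \<inter> D) x) \<le> (\<Sum>i. u i x * csqd f i x) * ennreal (\<phi> x t)"
          proof (cases "x \<in> A \<inter> D")
            case True
            have lx: "l i x \<le> \<delta> * \<alpha>" for i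
              using not_level_control[OF l xM] True by (simp add: A_def Y_def)
            obtain N where N: "ennreal ((2 * \<alpha>)\<^sup>2) < (\<Sum>i<Suc N. csqd f i x)"
              using True level_cond_square[of "2 * \<alpha>" f] \<alpha> by (auto simp: A_def simp del: sum.lessThan_Suc)
            have "ennreal (3 * \<alpha>\<^sup>2) \<le> (\<Sum>i. if n \<le> i then csqd f i x else 0)"
              using True xM \<alpha> N D_def U_def[abs_def]
              by (intro csqd_increment[where C=D and \<alpha>=\<alpha> and N="Suc N"]) (auto simp: power_mult_distrib simp del: sum.lessThan_Suc)
            also have "\<dots> = (\<Sum>i. u i x * csqd f i x)"
              using True lx xM by (intro suminf_cong) (auto simp: p_def u_def indicator_def)
            finally show ?thesis using True by (simp add: mult_right_mono)
          qed simp
        qed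
        also have "\<dots> = (\<Sum>i. \<integral>\<^sup>+x. u i x * csqd f i x * ennreal (\<phi> x t) \<partial>M)"
          using t by (intro nn_integral_suminf_phi) auto
        also have "\<dots> \<le> (\<Sum>i. ennreal K * (\<integral>\<^sup>+x. u i x * sqd f i x * ennreal (\<phi> x t) \<partial>M))"
          using swap[OF f u t] by (intro suminf_le) auto
        also have "\<dots> = ennreal K * (\<Sum>i. \<integral>\<^sup>+x. u i x * sqd f i x * ennreal (\<phi> x t) \<partial>M)"
          by (rule ennreal_suminf_cmult)
        also have "(\<Sum>i. \<integral>\<^sup>+x. u i x * sqd f i x * ennreal (\<phi> x t) \<partial>M) = (\<integral>\<^sup>+x. (\<Sum>i. u i x * sqd f i x) * ennreal (\<phi> x t) \<partial>M)"
          using t by (intro nn_integral_suminf_phi[symmetric]) auto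
        also have "\<dots> \<le> (\<integral>\<^sup>+x. ennreal ((\<delta> * \<alpha>)\<^sup>2) * (ennreal (\<phi> x t) * indicator D x) \<partial>M)"
        proof (intro nn_integral_mono_AE)
          have "AE x in M. \<forall>N. (\<Sum>i<N. indicator (p i) x * sqd f i x) \<le> ennreal ((\<delta> * \<alpha>)\<^sup>2)"
            unfolding p_def AE_all_countable using dom by (intro allI controlled_sqd_sum[OF f l]) auto
          then show "AE x in M. (\<Sum>i. u i x * sqd f i x) * ennreal (\<phi> x t) \<le> ennreal ((\<delta> * \<alpha>)\<^sup>2) * (ennreal (\<phi> x t) * indicator D x)"
          proof eventually_elim
            case (elim x)
            have "(\<Sum>i. u i x * sqd f i x) \<le> ennreal ((\<delta> * \<alpha>)\<^sup>2) * indicator D x"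
            proof (rule suminf_le_const[OF summableI])
              fix N
              have "(\<Sum>i<N. u i x * sqd f i x) \<le> (\<Sum>i<N. indicator (p i) x * sqd f i x) * indicator D x"
                unfolding sum_distrib_right by (intro sum_mono) (auto simp: u_def split: split_indicator)
              also have "\<dots> \<le> ennreal ((\<delta> * \<alpha>)\<^sup>2) * indicator D x" using elim by (intro mult_right_mono) auto
              finally show "(\<Sum>i<N. u i x * sqd f i x) \<le> ennreal ((\<delta> * \<alpha>)\<^sup>2) * indicator D x" .
            qed
            then have "(\<Sum>i. u i x * sqd f i x) * ennreal (\<phi> x t) \<le> ennreal ((\<delta> * \<alpha>)\<^sup>2) * indicator D x * ennreal (\<phi> x t)"
              by (rule mult_right_mono) simp
            then show ?case by (simp add: mult_ac)
          qed
        qed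
        also have "(\<integral>\<^sup>+x. ennreal ((\<delta> * \<alpha>)\<^sup>2) * (ennreal (\<phi> x t) * indicator D x) \<partial>M) = ennreal ((\<delta> * \<alpha>)\<^sup>2) * emeasure (Q t) D"
          using t by (subst nn_integral_cmult) (auto simp: emeasure_Q)
        finally have le: "ennreal (3 * \<alpha>\<^sup>2) * emeasure (Q t) (A \<inter> D) \<le> ennreal K * (ennreal ((\<delta> * \<alpha>)\<^sup>2) * emeasure (Q t) D)"
          by (simp add: mult_left_mono)
        obtain y z where yz: "emeasure (Q t) (A \<inter> D) = ennreal y" "y \<ge> 0" "emeasure (Q t) D = ennreal z" "z \<ge> 0"
          using Q_finite[OF t] by (metis ennreal_cases infinity_ennreal_def less_irrefl)
        have "3 * \<alpha>\<^sup>2 * y \<le> K * ((\<delta> * \<alpha>)\<^sup>2 * z)"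
          using le yz K by (simp add: ennreal_mult'[symmetric])
        also have "\<dots> = K * \<delta>\<^sup>2 * (\<alpha>\<^sup>2 * z)" by (simp add: power_mult_distrib mult_ac)
        also have "\<dots> = 3 * \<alpha>\<^sup>2 * (\<epsilon> * z)" by (simp add: \<delta>)
        finally have "y \<le> \<epsilon> * z" using \<alpha> by simp
        then show "emeasure (Q t) (A \<inter> disjointed U n) \<le> ennreal \<epsilon> * emeasure (Q t) (disjointed U n)"
          using yz eps unfolding D_def[symmetric] by (simp add: ennreal_mult'[symmetric] ennreal_leI)
      qed
      also have "(\<Union>n. U n) = level (cond_square_fun M F f) \<alpha>" by (simp add: U_def level_cond_square[OF \<alpha>])
      finally have Ale: "emeasure (Q t) A \<le> ennreal \<epsilon> * emeasure (Q t) (level (cond_square_fun M F f) \<alpha>)" .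
      have "emeasure (Q t) (level (cond_square_fun M F f) (2 * \<alpha>)) \<le> emeasure (Q t) (A \<union> level Y (\<delta> * \<alpha>))"
        by (intro emeasure_mono) (auto simp: A_def)
      also have "\<dots> \<le> emeasure (Q t) A + emeasure (Q t) (level Y (\<delta> * \<alpha>))"
        by (intro emeasure_subadditive) auto
      also have "\<dots> \<le> ennreal \<epsilon> * emeasure (Q t) (level (cond_square_fun M F f) \<alpha>)
          + ennreal 1 * (emeasure (Q t) (level Y (\<delta> * \<alpha>)) + emeasure (Q t) (level Y (\<delta> * \<alpha>)))"
        using Ale by (intro add_mono) auto
      finally show "emeasure (Q t) (level (cond_square_fun M F f) (2 * \<alpha>)) \<le> ennreal \<epsilon> * emeasure (Q t) (level (cond_square_fun M F f) \<alpha>)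
          + ennreal 1 * (emeasure (Q t) (level Y (\<delta> * \<alpha>)) + emeasure (Q t) (level Y (\<delta> * \<alpha>)))" .
    qed
    then show "WL_norm M \<phi> (cond_square_fun M F f) \<le> ennreal C * WL_norm M \<phi> (control_limit l)" by (simp add: Y_def)
  qed
qed

text \<open>For the least \<open>k\<close> with \<open>(\<alpha> / 2 ^ Suc k)\<^sup>2\<close> below
  \<open>V\<close>, the summand at \<open>k\<close> alone dominates the minimum: by minimality if
  \<open>k > 0\<close>, and because it equals \<open>\<alpha>\<^sup>2\<close> if
  \<open>k = 0\<close>.\<close>

lemma min_le_dyadic_sum:
  assumes "\<alpha> > 0"
  shows "min (ennreal (\<alpha>\<^sup>2)) V \<le> (\<Sum>k. if ennreal ((\<alpha> / 2 ^ Suc k)\<^sup>2) < V then ennreal ((\<alpha> / 2 ^ k)\<^sup>2) else 0)"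
    (is "_ \<le> (\<Sum>k. ?h k)")
proof (cases "V = 0")
  case False
  have "\<exists>k. ennreal ((\<alpha> / 2 ^ Suc k)\<^sup>2) < V"
  proof -
    have "(\<lambda>k. \<alpha> * (1 / 2) ^ Suc k) \<longlonglongrightarrow> \<alpha> * 0"
      by (intro tendsto_mult_left LIMSEQ_Suc LIMSEQ_power_zero) simp
    then have "(\<lambda>k. ennreal ((\<alpha> * (1 / 2) ^ Suc k)\<^sup>2)) \<longlonglongrightarrow> ennreal ((\<alpha> * 0)\<^sup>2)"
      by (intro tendsto_ennrealI tendsto_power)
    then have "eventually (\<lambda>k. ennreal ((\<alpha> * (1 / 2) ^ Suc k)\<^sup>2) < V) sequentially"
      using False by (intro order_tendstoD(2)) (auto simp: zero_less_iff_neq_zero)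
    then show ?thesis unfolding eventually_sequentially by (auto simp: power_divide)
  qed
  define k where "k = (LEAST k. ennreal ((\<alpha> / 2 ^ Suc k)\<^sup>2) < V)"
  have k: "ennreal ((\<alpha> / 2 ^ Suc k)\<^sup>2) < V" unfolding k_def by (rule LeastI_ex) fact
  have "min (ennreal (\<alpha>\<^sup>2)) V \<le> ennreal ((\<alpha> / 2 ^ k)\<^sup>2)"
  proof (cases k)
    case (Suc j)
    then have "\<not> ennreal ((\<alpha> / 2 ^ Suc j)\<^sup>2) < V" using not_less_Least[of j "\<lambda>k. ennreal ((\<alpha> / 2 ^ Suc k)\<^sup>2) < V"] by (simp add: k_def)
    then show ?thesis using Suc by (simp add: not_less min.coboundedI2)
  qed simp
  also have "\<dots> = (\<Sum>j\<in>{k}. ?h j)" using k by simp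
  also have "\<dots> \<le> (\<Sum>k. ?h k)" by (rule sum_le_suminf) auto
  finally show ?thesis .
qed simp

text \<open>Where \<open>s(f)\<close> does not exceed \<open>\<alpha>\<close>, stopping by the
  partial sums of \<open>csqd\<close> changes nothing, so the mass of
  \<open>{S(f) > \<alpha>}\<close> there is bounded by a stopped weighted second moment. S^+ passes
  from \<open>sqd\<close> to \<open>csqd\<close>, whose stopped sum is at most the minimum of
  \<open>\<alpha>\<^sup>2\<close> and the square of \<open>s(f)\<close>. In the dyadic decomposition
  of this minimum the masses grow at most like \<open>2 powr (pp * k)\<close> while the heights
  shrink like \<open>4 powr (- k)\<close>; the series converges because
  \<open>pp < 2\<close>.\<close>

lemma square_le_cond_square:
  assumes "S_plus M F \<phi>" and pp2: "pp < 2"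
  shows "\<exists>C>0. \<forall>f\<in>martingales0 M F. WHS_norm M \<phi> f \<le> ennreal C * WHs_norm M F \<phi> f"
proof -
  obtain K where K: "K > 0" and swap: "\<And>f u i t. f \<in> martingales0 M F \<Longrightarrow> u \<in> borel_measurable (F i) \<Longrightarrow> 0 < t \<Longrightarrow>
    (\<integral>\<^sup>+x. u x * sqd f i x * ennreal (\<phi> x t) \<partial>M) \<le> ennreal K * (\<integral>\<^sup>+x. u x * csqd f i x * ennreal (\<phi> x t) \<partial>M)"
    by (rule S_plus_integral[OF assms(1)]) (rule that)
  obtain D where D: "D > 0" "\<And>s t A. 1 \<le> s \<Longrightarrow> 0 \<le> t \<Longrightarrow> A \<in> sets M \<Longrightarrow>
    emeasure (Q (s * t)) A \<le> ennreal (D * s powr pp) * emeasure (Q t) A"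
    using upper_typeE by metis
  \<comment> \<open>The ratio of consecutive terms in the dyadic series.\<close>
  define r :: real where "r = 2 powr (pp - 2)"
  have r: "0 < r" "r < 1" using pp2 by (auto simp: r_def powr_less_one)
  define b where "b = K * (D * 2 powr pp * (1 / (1 - r)))"
  have b: "b \<ge> 0" using K D r by (simp add: b_def)
  obtain C where C: "weak_type_bound C (level_bounded (1 + b))"
    using level_bounded_weak_type[of "1 + b"] b by auto
  show ?thesis
  proof (intro exI[of _ C] conjI ballI)
    show "C > 0" by (rule weak_type_boundD(1)[OF C])
    fix f assume f: "f \<in> martingales0 M F"
    have [measurable]: "square_fun f \<in> borel_measurable M" "sqd f i \<in> borel_measurable M" for i using f by simp_all
    let ?s = "cond_square_fun M F f"
    have "WL_norm M \<phi> (square_fun f) \<le> ennreal C * max (WL_norm M \<phi> ?s) (WL_norm M \<phi> ?s)"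
    proof (rule weak_type_boundD(2)[OF C], simp, simp, simp, unfold level_bounded_def, intro allI impI)
      fix l \<alpha> :: real assume l: "bounds ?s l" and \<alpha>: "\<alpha> > 0"
      have lpos: "l > 0" using l by (simp add: bounds_def)
      define t where "t = \<alpha> / l"
      have t: "t > 0" using \<alpha> lpos by (simp add: t_def)
      have [measurable]: "(\<lambda>x. \<phi> x t) \<in> borel_measurable M" using t by simp
      define A where "A = level (square_fun f) \<alpha> - level ?s \<alpha>"
      have [measurable]: "A \<in> sets M" unfolding A_def by measurable
      define p where "p i = {x \<in> space M. (\<Sum>j<Suc i. csqd f j x) \<le> ennreal (\<alpha>\<^sup>2)}" for i
      have p: "p i \<in> sets (F i)" for i unfolding p_def by (rule csqd_sum_set)
      have [measurable]: "p i \<in> sets M" for i using p by (rule sets_F_M)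
      \<comment> \<open>Admissibility of \<open>l\<close> speaks of the weight at
        \<open>\<alpha> / 2 ^ Suc k / l\<close>; the upper type carries the bound to the larger
        argument \<open>t\<close>.\<close>
      have Qs: "emeasure (Q t) (level ?s (\<alpha> / 2 ^ Suc k)) \<le> ennreal (D * (2 ^ Suc k) powr pp)" for k
      proof -
        have "emeasure (Q t) (level ?s (\<alpha> / 2 ^ Suc k)) = emeasure (Q (2 ^ Suc k * (\<alpha> / 2 ^ Suc k / l))) (level ?s (\<alpha> / 2 ^ Suc k))"
          by (simp add: t_def)
        also have "\<dots> \<le> ennreal (D * (2 ^ Suc k) powr pp) * emeasure (Q (\<alpha> / 2 ^ Suc k / l)) (level ?s (\<alpha> / 2 ^ Suc k))"
          using \<alpha> lpos one_le_power[of "2::real" "Suc k"] by (intro D) auto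
        also have "\<dots> \<le> ennreal (D * (2 ^ Suc k) powr pp) * 1"
          using l[unfolded bounds_def, THEN conjunct2, rule_format, of "\<alpha> / 2 ^ Suc k"] \<alpha>
          by (intro mult_left_mono) simp_all
        finally show ?thesis by simp
      qed
      have "ennreal (\<alpha>\<^sup>2) * emeasure (Q t) A = (\<integral>\<^sup>+x. ennreal (\<alpha>\<^sup>2) * (ennreal (\<phi> x t) * indicator A x) \<partial>M)"
        using t by (subst nn_integral_cmult) (auto simp: emeasure_Q)
      also have "\<dots> \<le> (\<integral>\<^sup>+x. (\<Sum>i. indicator (p i) x * sqd f i x) * ennreal (\<phi> x t) \<partial>M)"
      proof (intro nn_integral_mono)
        fix x assume xM: "x \<in> space M"
        show "ennreal (\<alpha>\<^sup>2) * (ennreal (\<phi> x t) * indicator A x) \<le> (\<Sum>i. indicator (p i) x * sqd f i x) * ennreal (\<phi> x t)"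
        proof (cases "x \<in> A")
          case True
          have px: "x \<in> p i" for i
            using True xM by (auto simp: A_def p_def level_cond_square[OF \<alpha>] not_less simp del: sum.lessThan_Suc)
          have "ennreal (\<alpha>\<^sup>2) < (\<Sum>i. sqd f i x)"
            using True by (auto simp: A_def level_square[OF \<alpha>] less_suminf_ennreal_iff)
          also have "(\<Sum>i. sqd f i x) = (\<Sum>i. indicator (p i) x * sqd f i x)" using px by simp
          finally show ?thesis using True by (simp add: mult_right_mono less_imp_le)
        qed simp
      qed
      also have "\<dots> = (\<Sum>i. \<integral>\<^sup>+x. indicator (p i) x * sqd f i x * ennreal (\<phi> x t) \<partial>M)"
        using t by (intro nn_integral_suminf_phi) auto
      also have "\<dots> \<le> (\<Sum>i. ennreal K * (\<integral>\<^sup>+x. indicator (p i) x * csqd f i x * ennreal (\<phi> x t) \<partial>M))"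
        using p by (intro suminf_le swap[OF f _ t]) auto
      also have "\<dots> = ennreal K * (\<Sum>i. \<integral>\<^sup>+x. indicator (p i) x * csqd f i x * ennreal (\<phi> x t) \<partial>M)"
        by (rule ennreal_suminf_cmult)
      also have "(\<Sum>i. \<integral>\<^sup>+x. indicator (p i) x * csqd f i x * ennreal (\<phi> x t) \<partial>M) = (\<integral>\<^sup>+x. (\<Sum>i. indicator (p i) x * csqd f i x) * ennreal (\<phi> x t) \<partial>M)"
        using t by (intro nn_integral_suminf_phi[symmetric]) auto
      also have "\<dots> \<le> (\<integral>\<^sup>+x. (\<Sum>k. ennreal ((\<alpha> / 2 ^ k)\<^sup>2) * indicator (level ?s (\<alpha> / 2 ^ Suc k)) x) * ennreal (\<phi> x t) \<partial>M)"
      proof (intro nn_integral_mono mult_right_mono)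
        fix x assume xM: "x \<in> space M"
        have "(\<Sum>i. indicator (p i) x * csqd f i x) \<le> min (ennreal (\<alpha>\<^sup>2)) (\<Sum>i. csqd f i x)"
        proof (rule suminf_le_const[OF summableI])
          fix N
          have "(\<Sum>i<N. indicator (p i) x * csqd f i x) \<le> (\<Sum>i<N. if (\<Sum>j<Suc i. csqd f j x) \<le> ennreal (\<alpha>\<^sup>2) then csqd f i x else 0)"
            by (intro sum_mono) (auto simp: p_def indicator_def simp del: sum.lessThan_Suc)
          also have "\<dots> \<le> min (ennreal (\<alpha>\<^sup>2)) (\<Sum>i<N. csqd f i x)" by (rule stopped_sum_le)
          also have "\<dots> \<le> min (ennreal (\<alpha>\<^sup>2)) (\<Sum>i. csqd f i x)"
            by (intro min.mono order.refl sum_le_suminf) auto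
          finally show "(\<Sum>i<N. indicator (p i) x * csqd f i x) \<le> min (ennreal (\<alpha>\<^sup>2)) (\<Sum>i. csqd f i x)" .
        qed
        also have "\<dots> \<le> (\<Sum>k. if ennreal ((\<alpha> / 2 ^ Suc k)\<^sup>2) < (\<Sum>i. csqd f i x) then ennreal ((\<alpha> / 2 ^ k)\<^sup>2) else 0)"
          by (rule min_le_dyadic_sum[OF \<alpha>])
        also have "\<dots> = (\<Sum>k. ennreal ((\<alpha> / 2 ^ k)\<^sup>2) * indicator (level ?s (\<alpha> / 2 ^ Suc k)) x)"
        proof (rule suminf_cong)
          fix k
          have "x \<in> level ?s (\<alpha> / 2 ^ Suc k) \<longleftrightarrow> ennreal ((\<alpha> / 2 ^ Suc k)\<^sup>2) < (\<Sum>i. csqd f i x)"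
            using xM \<alpha> less_sqrt_ennreal_iff[of "\<alpha> / 2 ^ Suc k" "\<Sum>i. csqd f i x"] by (simp add: level_def cond_square_fun_eq)
          then show "(if ennreal ((\<alpha> / 2 ^ Suc k)\<^sup>2) < (\<Sum>i. csqd f i x) then ennreal ((\<alpha> / 2 ^ k)\<^sup>2) else 0)
              = ennreal ((\<alpha> / 2 ^ k)\<^sup>2) * indicator (level ?s (\<alpha> / 2 ^ Suc k)) x" by simp
        qed
        finally show "(\<Sum>i. indicator (p i) x * csqd f i x) \<le> (\<Sum>k. ennreal ((\<alpha> / 2 ^ k)\<^sup>2) * indicator (level ?s (\<alpha> / 2 ^ Suc k)) x)" .
      qed simp
      also have "\<dots> = (\<Sum>k. \<integral>\<^sup>+x. ennreal ((\<alpha> / 2 ^ k)\<^sup>2) * indicator (level ?s (\<alpha> / 2 ^ Suc k)) x * ennreal (\<phi> x t) \<partial>M)"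
        using t by (intro nn_integral_suminf_phi) auto
      also have "\<dots> = (\<Sum>k. ennreal ((\<alpha> / 2 ^ k)\<^sup>2) * emeasure (Q t) (level ?s (\<alpha> / 2 ^ Suc k)))"
      proof (rule suminf_cong)
        fix k
        have "(\<integral>\<^sup>+x. ennreal ((\<alpha> / 2 ^ k)\<^sup>2) * indicator (level ?s (\<alpha> / 2 ^ Suc k)) x * ennreal (\<phi> x t) \<partial>M)
          = (\<integral>\<^sup>+x. ennreal ((\<alpha> / 2 ^ k)\<^sup>2) * (ennreal (\<phi> x t) * indicator (level ?s (\<alpha> / 2 ^ Suc k)) x) \<partial>M)"
          by (simp add: mult_ac)
        also have "\<dots> = ennreal ((\<alpha> / 2 ^ k)\<^sup>2) * emeasure (Q t) (level ?s (\<alpha> / 2 ^ Suc k))"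
          using t by (subst nn_integral_cmult) (auto simp: emeasure_Q)
        finally show "(\<integral>\<^sup>+x. ennreal ((\<alpha> / 2 ^ k)\<^sup>2) * indicator (level ?s (\<alpha> / 2 ^ Suc k)) x * ennreal (\<phi> x t) \<partial>M)
          = ennreal ((\<alpha> / 2 ^ k)\<^sup>2) * emeasure (Q t) (level ?s (\<alpha> / 2 ^ Suc k))" .
      qed
      also have "\<dots> \<le> (\<Sum>k. ennreal (\<alpha>\<^sup>2 * (D * 2 powr pp) * r ^ k))"
      proof (intro suminf_le summableI)
        fix k
        have e1: "(2 ^ Suc k) powr pp = 2 powr pp * (2 powr pp) ^ k"
          by (simp add: powr_realpow[symmetric] powr_powr powr_add[symmetric] distrib_left mult.commute del: power_Suc)
        have e2: "r ^ k = (2 powr pp) ^ k / 4 ^ k" by (simp add: r_def powr_diff power_divide)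
        have "ennreal ((\<alpha> / 2 ^ k)\<^sup>2) * emeasure (Q t) (level ?s (\<alpha> / 2 ^ Suc k)) \<le> ennreal ((\<alpha> / 2 ^ k)\<^sup>2) * ennreal (D * (2 ^ Suc k) powr pp)"
          by (intro mult_left_mono Qs) auto
        also have "\<dots> = ennreal ((\<alpha> / 2 ^ k)\<^sup>2 * (D * (2 ^ Suc k) powr pp))"
          using D by (simp add: ennreal_mult'[symmetric])
        also have "(\<alpha> / 2 ^ k)\<^sup>2 * (D * (2 ^ Suc k) powr pp) = \<alpha>\<^sup>2 * (D * 2 powr pp) * r ^ k"
          unfolding e1 e2 by (simp add: power_divide power_mult[symmetric] mult.commute[of k] power_mult)
        finally show "ennreal ((\<alpha> / 2 ^ k)\<^sup>2) * emeasure (Q t) (level ?s (\<alpha> / 2 ^ Suc k)) \<le> ennreal (\<alpha>\<^sup>2 * (D * 2 powr pp) * r ^ k)" .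
      qed
      also have "\<dots> = ennreal (\<alpha>\<^sup>2 * (D * 2 powr pp) * (1 / (1 - r)))"
        using r D by (intro suminf_ennreal_eq sums_mult geometric_sums) auto
      finally have le: "ennreal (\<alpha>\<^sup>2) * emeasure (Q t) A \<le> ennreal K * ennreal (\<alpha>\<^sup>2 * (D * 2 powr pp) * (1 / (1 - r)))"
        by (simp add: mult_left_mono)
      obtain y where y: "emeasure (Q t) A = ennreal y" "y \<ge> 0"
        using Q_finite[OF t] by (metis ennreal_cases infinity_ennreal_def less_irrefl)
      have "\<alpha>\<^sup>2 * y \<le> K * (\<alpha>\<^sup>2 * (D * 2 powr pp) * (1 / (1 - r)))"
        using le y K D r by (simp add: ennreal_mult'[symmetric])
      also have "\<dots> = \<alpha>\<^sup>2 * b" by (simp add: b_def mult_ac)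
      finally have "y \<le> b" using \<alpha> by simp
      then have Ab: "emeasure (Q t) A \<le> ennreal b" using y by (simp add: ennreal_leI)
      have "emeasure (Q t) (level (square_fun f) \<alpha>) \<le> emeasure (Q t) (level ?s \<alpha> \<union> A)"
        by (intro emeasure_mono) (auto simp: A_def)
      also have "\<dots> \<le> emeasure (Q t) (level ?s \<alpha>) + emeasure (Q t) A"
        by (intro emeasure_subadditive) auto
      also have "\<dots> \<le> ennreal 1 + ennreal b"
        using l \<alpha> Ab by (intro add_mono) (auto simp: bounds_def t_def)
      also have "\<dots> = ennreal (1 + b)" using b by (intro ennreal_plus[symmetric]) auto
      finally show "emeasure (Q (\<alpha> / l)) (level (square_fun f) \<alpha>) \<le> ennreal (1 + b)" by (simp add: t_def)
    qed
    then show "WHS_norm M \<phi> f \<le> ennreal C * WHs_norm M F \<phi> f" by (simp add: WHS_norm_def WHs_norm_def)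
  qed
qed

end

section \<open>Predictable controls\<close>

primrec run_max :: "(nat \<Rightarrow> 'a \<Rightarrow> real) \<Rightarrow> nat \<Rightarrow> 'a \<Rightarrow> real" where
  "run_max g 0 x = g 0 x"
| "run_max g (Suc n) x = max (run_max g n x) (g (Suc n) x)"

lemma run_max_incseq: "incseq (\<lambda>n. run_max g n x)"
  by (rule incseq_SucI) simp

lemma run_max_ge: "g n x \<le> run_max g n x"
  by (cases n) auto

lemma less_run_maxD: "\<alpha> < run_max g n x \<Longrightarrow> \<exists>k. \<alpha> < g k x"
  by (induction n) (auto simp: less_max_iff_disj)

lemma run_max_measurable:
  "(\<And>k. k \<le> n \<Longrightarrow> g k \<in> borel_measurable N) \<Longrightarrow> run_max g n \<in> borel_measurable N"
proof (induction n)
  case 0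
  then have "g 0 \<in> borel_measurable N" by simp
  then show ?case by (simp add: measurable_cong[of N "run_max g 0" "g 0"])
next
  case (Suc n)
  then have [measurable]: "run_max g n \<in> borel_measurable N" "g (Suc n) \<in> borel_measurable N" by auto
  have "(\<lambda>x. max (run_max g n x) (g (Suc n) x)) \<in> borel_measurable N" by measurable
  then show ?case by (simp cong: measurable_cong)
qed

context weighted_basis
begin

section \<open>Domination between level sets\<close>

definition level_dominated :: "real \<Rightarrow> real \<Rightarrow> ('a \<Rightarrow> ereal) \<Rightarrow> ('a \<Rightarrow> ereal) \<Rightarrow> ('a \<Rightarrow> ereal) \<Rightarrow> bool" where
  "level_dominated B \<kappa> X Y1 Y2 \<longleftrightarrow> (\<forall>t>0. \<forall>\<alpha>>0. emeasure (Q t) (level X \<alpha>) \<le>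
    ennreal B * (emeasure (Q t) (level Y1 (\<kappa> * \<alpha>)) + emeasure (Q t) (level Y2 (\<kappa> * \<alpha>))))"

text \<open>The exceptional null set may depend on \<open>\<alpha>\<close>: level sets are compared
  one at a time.\<close>

definition AE_dominated :: "real \<Rightarrow> ('a \<Rightarrow> ereal) \<Rightarrow> ('a \<Rightarrow> ereal) \<Rightarrow> ('a \<Rightarrow> ereal) \<Rightarrow> bool" where
  "AE_dominated \<kappa> X Y1 Y2 \<longleftrightarrow> (\<forall>\<alpha>>0. AE x in M. x \<in> level X \<alpha> \<longrightarrow> x \<in> level Y1 (\<kappa> * \<alpha>) \<union> level Y2 (\<kappa> * \<alpha>))"

text \<open>At level \<open>2 * \<alpha>\<close> this is a good-lambda inequality to whose
  right-hand side the absorbing term can be added freely.\<close>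

lemma level_dominated_weak_type:
  assumes "B \<ge> 0" "\<kappa> > 0"
  shows "\<exists>C. weak_type_bound C (level_dominated B \<kappa>)"
proof -
  obtain \<epsilon> :: real where "\<forall>B\<ge>0. \<forall>\<delta>>0. \<exists>C. weak_type_bound C (good_lambda_ineq \<epsilon> B \<delta>)"
    using good_lambda_ineq_weak_type by blast
  then obtain C where C: "weak_type_bound C (good_lambda_ineq \<epsilon> B (2 * \<kappa>))"
    using assms by (metis mult_pos_pos zero_less_numeral)
  have "good_lambda_ineq \<epsilon> B (2 * \<kappa>) X Y1 Y2" if "level_dominated B \<kappa> X Y1 Y2" for X Y1 Y2
    unfolding good_lambda_ineq_def
  proof (intro allI impI)
    fix t \<alpha> :: real assume t: "0 < t" "0 < \<alpha>"
    have "emeasure (Q t) (level X (2 * \<alpha>)) \<le> ennreal B * (emeasure (Q t) (level Y1 (\<kappa> * (2 * \<alpha>))) + emeasure (Q t) (level Y2 (\<kappa> * (2 * \<alpha>))))"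
      using that[unfolded level_dominated_def, rule_format, OF t(1), of "2 * \<alpha>"] t by simp
    also have "\<kappa> * (2 * \<alpha>) = 2 * \<kappa> * \<alpha>" by simp
    finally show "emeasure (Q t) (level X (2 * \<alpha>)) \<le> ennreal \<epsilon> * emeasure (Q t) (level X \<alpha>)
        + ennreal B * (emeasure (Q t) (level Y1 (2 * \<kappa> * \<alpha>)) + emeasure (Q t) (level Y2 (2 * \<kappa> * \<alpha>)))"
      by (rule add_increasing[OF zero_le])
  qed
  then show ?thesis using C unfolding weak_type_bound_def by blast
qed

lemma AE_dominated_weak_type:
  assumes "\<kappa> > 0"
  shows "\<exists>C. weak_type_bound C (AE_dominated \<kappa>)"
proof -
  obtain C where C: "weak_type_bound C (level_dominated 1 \<kappa>)"
    using level_dominated_weak_type[OF zero_le_one assms] by blast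
  have "weak_type_bound C (AE_dominated \<kappa>)"
  proof (rule weak_type_boundI[OF weak_type_boundD(1)[OF C]])
    fix X Y1 Y2 :: "'a \<Rightarrow> ereal"
    assume meas[measurable]: "X \<in> borel_measurable M" "Y1 \<in> borel_measurable M" "Y2 \<in> borel_measurable M"
      and dom: "AE_dominated \<kappa> X Y1 Y2"
    have "level_dominated 1 \<kappa> X Y1 Y2"
      unfolding level_dominated_def
    proof (intro allI impI)
      fix t \<alpha> :: real assume t: "0 < t" "0 < \<alpha>"
      have "emeasure (Q t) (level X \<alpha>) \<le> emeasure (Q t) (level Y1 (\<kappa> * \<alpha>) \<union> level Y2 (\<kappa> * \<alpha>))"
        using t dom[unfolded AE_dominated_def] by (intro Q_mono_AE) auto
      also have "\<dots> \<le> emeasure (Q t) (level Y1 (\<kappa> * \<alpha>)) + emeasure (Q t) (level Y2 (\<kappa> * \<alpha>))"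
        by (intro emeasure_subadditive) auto
      finally show "emeasure (Q t) (level X \<alpha>) \<le> ennreal 1 * (emeasure (Q t) (level Y1 (\<kappa> * \<alpha>)) + emeasure (Q t) (level Y2 (\<kappa> * \<alpha>)))"
        by simp
    qed
    then show "WL_norm M \<phi> X \<le> ennreal C * max (WL_norm M \<phi> Y1) (WL_norm M \<phi> Y2)" by (rule weak_type_boundD(2)[OF C meas])
  qed
  then show ?thesis ..
qed

lemma maximal_le_control:
  shows "\<exists>C>0. \<forall>f\<in>martingales0 M F. \<forall>l. controls l f \<longrightarrow>
    WL_norm M \<phi> (maximal_fun f) \<le> ennreal C * WL_norm M \<phi> (control_limit l)"
proof -
  obtain C where C: "weak_type_bound C (AE_dominated 1)"
    using AE_dominated_weak_type[OF zero_less_one] by blast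
  show ?thesis
  proof (intro exI[of _ C] conjI ballI allI impI)
    show "C > 0" by (rule weak_type_boundD(1)[OF C])
    fix f l assume f: "f \<in> martingales0 M F" and "controls l f"
    then have l: "l \<in> control_seqs M F" and dom: "\<forall>i. AE x in M. \<bar>f (Suc i) x\<bar> \<le> l i x"
      by (simp_all add: controls_def)
    have "AE x in M. \<forall>i. \<bar>f (Suc i) x\<bar> \<le> l i x" using dom by (simp add: AE_all_countable)
    then have "AE x in M. \<forall>\<alpha>>0. x \<in> level (maximal_fun f) \<alpha> \<longrightarrow> x \<in> level (control_limit l) \<alpha>"
      using martingales0D(3)[OF f]
    proof eventually_elim
      case (elim x)
      show ?case
      proof (intro allI impI)
        fix \<alpha> :: real assume \<alpha>: "0 < \<alpha>" and "x \<in> level (maximal_fun f) \<alpha>"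
        then obtain n where n: "x \<in> space M" "\<alpha> < \<bar>f n x\<bar>" by (auto simp: level_maximal)
        then have "n \<noteq> 0" using elim(2) \<alpha> by (metis abs_zero less_asym)
        then obtain k where "n = Suc k" by (cases n) auto
        then have "\<alpha> < l k x" using n elim(1) by (metis less_le_trans)
        then show "x \<in> level (control_limit l) \<alpha>" using n by (auto simp: level_control[OF l])
      qed
    qed
    then have "AE_dominated 1 (maximal_fun f) (control_limit l) (control_limit l)"
      unfolding AE_dominated_def by (auto elim: eventually_mono)
    from weak_type_boundD(2)[OF C maximal_fun_measurable[OF f] control_limit_measurable[OF l] control_limit_measurable[OF l] this]
    show "WL_norm M \<phi> (maximal_fun f) \<le> ennreal C * WL_norm M \<phi> (control_limit l)" by simp
  qed
qed

lemma square_le_square_control: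
  shows "\<exists>C>0. \<forall>f\<in>martingales0 M F. \<forall>l. square_controls l f \<longrightarrow>
    WL_norm M \<phi> (square_fun f) \<le> ennreal C * WL_norm M \<phi> (control_limit l)"
proof -
  obtain C where C: "weak_type_bound C (AE_dominated 1)"
    using AE_dominated_weak_type[OF zero_less_one] by blast
  show ?thesis
  proof (intro exI[of _ C] conjI ballI allI impI)
    show "C > 0" by (rule weak_type_boundD(1)[OF C])
    fix f l assume f: "f \<in> martingales0 M F" and "square_controls l f"
    then have l: "l \<in> control_seqs M F" and dom: "\<forall>i. AE x in M. square_fun_upto f (Suc i) x \<le> l i x"
      by (simp_all add: square_controls_def)
    have "AE x in M. \<forall>i. square_fun_upto f (Suc i) x \<le> l i x" using dom by (simp add: AE_all_countable)
    then have "AE x in M. \<forall>\<alpha>>0. x \<in> level (square_fun f) \<alpha> \<longrightarrow> x \<in> level (control_limit l) \<alpha>"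
    proof eventually_elim
      case (elim x)
      show ?case
      proof (intro allI impI)
        fix \<alpha> :: real assume \<alpha>: "0 < \<alpha>" and "x \<in> level (square_fun f) \<alpha>"
        then obtain n where n: "x \<in> space M" "\<alpha> < square_fun_upto f n x" by (auto simp: level_square'[OF \<alpha>])
        have "\<alpha> < square_fun_upto f (Suc n) x"
          using n(2) square_fun_upto_mono[of n "Suc n" f x] by simp
        then have "\<alpha> < l n x" using elim by (metis less_le_trans)
        then show "x \<in> level (control_limit l) \<alpha>" using n by (auto simp: level_control[OF l])
      qed
    qed
    then have "AE_dominated 1 (square_fun f) (control_limit l) (control_limit l)"
      unfolding AE_dominated_def by (auto elim: eventually_mono)
    from weak_type_boundD(2)[OF C square_fun_measurable[OF f] control_limit_measurable[OF l] control_limit_measurable[OF l] this]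
    show "WL_norm M \<phi> (square_fun f) \<le> ennreal C * WL_norm M \<phi> (control_limit l)" by simp
  qed
qed

section \<open>Passing between the two kinds of control\<close>

lemma cmult_max_le:
  assumes "C > 0" "D > 0" "b \<le> ennreal D * a"
  shows "ennreal C * max b a \<le> ennreal (C * max D 1) * a"
proof -
  have "b \<le> ennreal (max D 1) * a"
    by (rule order.trans[OF assms(3)]) (intro mult_right_mono ennreal_leI, auto)
  moreover have "a \<le> ennreal (max D 1) * a"
    using mult_right_mono[of 1 "ennreal (max D 1)" a] by simp
  ultimately have "ennreal C * max b a \<le> ennreal C * (ennreal (max D 1) * a)"
    by (intro mult_left_mono) auto
  then show ?thesis using assms by (simp add: ennreal_mult mult.assoc)
qed

text \<open>The limit of the new control is at most \<open>S(f)\<close> plus twice the limit of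
  \<open>l\<close>, and \<open>square_le_control\<close> already bounds the norm of
  \<open>S(f)\<close> by that of the limit of \<open>l\<close>.\<close>

lemma square_control_of_control:
  assumes "A_infinity M F \<phi>"
  shows "\<exists>C>0. \<forall>f\<in>martingales0 M F. \<forall>l. controls l f \<longrightarrow>
    (\<exists>m. square_controls m f \<and> WL_norm M \<phi> (control_limit m) \<le> ennreal C * WL_norm M \<phi> (control_limit l))"
proof -
  \<comment> \<open>A sum \<open>s + 2 * l\<close> above \<open>\<alpha> > 0\<close> forces
    \<open>s\<close> or \<open>l\<close> above \<open>\<alpha> / 4\<close>.\<close>
  have q: "0 < (1 / 4 :: real)" by simp
  obtain C where C: "weak_type_bound C (AE_dominated (1 / 4))"
    using AE_dominated_weak_type[OF q] by blast
  obtain D where D: "D > 0" and S_le: "\<forall>f\<in>martingales0 M F. \<forall>l. controls l f \<longrightarrow>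
    WL_norm M \<phi> (square_fun f) \<le> ennreal D * WL_norm M \<phi> (control_limit l)"
    using square_le_control[OF assms] by blast
  show ?thesis
  proof (intro exI[of _ "C * max D 1"] conjI ballI allI impI)
    show "C * max D 1 > 0" using weak_type_boundD(1)[OF C] by (simp add: less_max_iff_disj)
    fix f l assume f: "f \<in> martingales0 M F" and ctl: "controls l f"
    then have l: "l \<in> control_seqs M F" and dom: "\<forall>i. AE x in M. \<bar>f (Suc i) x\<bar> \<le> l i x"
      by (simp_all add: controls_def)
    define m where "m n x = square_fun_upto f n x + 2 * l n x" for n x
    have m: "m \<in> control_seqs M F"
      unfolding control_seqs_def
    proof (intro CollectI conjI allI ballI)
      fix n
      have [measurable]: "l n \<in> borel_measurable (F n)" by (rule control_seqsD[OF l])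
      have [measurable]: "square_fun_upto f n \<in> borel_measurable (F n)" by (rule square_fun_upto_measurable_F[OF f])
      show "m n \<in> borel_measurable (F n)" unfolding m_def[abs_def] by measurable
    next
      fix x n assume x: "x \<in> space M"
      show "0 \<le> m n x" using control_seqsD(3)[OF l x] by (simp add: m_def square_fun_upto_nonneg)
      show "incseq (\<lambda>n. m n x)" unfolding m_def
        by (intro incseq_SucI add_mono square_fun_upto_mono mult_left_mono control_seqsD(4)[OF l x]) auto
    qed
    have ctrl: "AE x in M. \<forall>i. square_fun_upto f (Suc i) x \<le> m i x"
      using control_dominates[OF f l dom]
    proof eventually_elim
      case (elim x)
      have "square_fun_upto f (Suc i) x \<le> m i x" for i
      proof -
        have "\<bar>f i x\<bar> \<le> l i x \<and> \<bar>f (Suc i) x\<bar> \<le> l i x" using elim by blast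
        then have "\<bar>mdiff f (Suc i) x\<bar> \<le> 2 * l i x" unfolding mdiff_Suc by linarith
        then show ?thesis using square_fun_upto_Suc_le[of f i x] by (simp add: m_def)
      qed
      then show ?case by blast
    qed
    have lev: "AE_dominated (1 / 4) (control_limit m) (square_fun f) (control_limit l)"
      unfolding AE_dominated_def
    proof (intro allI impI AE_I2)
      fix \<alpha> :: real and x assume \<alpha>: "\<alpha> > 0" and "x \<in> level (control_limit m) \<alpha>"
      then obtain n where n: "x \<in> space M" "\<alpha> < m n x" by (auto simp: level_control[OF m])
      then have "1 / 4 * \<alpha> < square_fun_upto f n x \<or> 1 / 4 * \<alpha> < l n x" using \<alpha> by (auto simp: m_def)
      then show "x \<in> level (square_fun f) (1 / 4 * \<alpha>) \<union> level (control_limit l) (1 / 4 * \<alpha>)"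
        using n \<alpha> level_square'[of "1 / 4 * \<alpha>" f] by (auto simp: level_control[OF l])
    qed
    have "WL_norm M \<phi> (control_limit m) \<le> ennreal C * max (WL_norm M \<phi> (square_fun f)) (WL_norm M \<phi> (control_limit l))"
      by (rule weak_type_boundD(2)[OF C control_limit_measurable[OF m] square_fun_measurable[OF f] control_limit_measurable[OF l] lev])
    also have "\<dots> \<le> ennreal (C * max D 1) * WL_norm M \<phi> (control_limit l)"
      using S_le f ctl by (intro cmult_max_le[OF weak_type_boundD(1)[OF C] D]) blast
    finally show "\<exists>m. square_controls m f \<and> WL_norm M \<phi> (control_limit m) \<le> ennreal (C * max D 1) * WL_norm M \<phi> (control_limit l)"
      using m ctrl by (auto simp: AE_all_countable square_controls_def)
  qed
qed

text \<open>A control has to be nondecreasing, hence the running maximum of \<open>|f n|\<close>. It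
  is bounded by \<open>M(f)\<close>, whose norm \<open>maximal_le_square_control\<close> compares
  with that of the limit of \<open>l\<close>.\<close>

lemma control_of_square_control:
  assumes "A_infinity M F \<phi>"
  shows "\<exists>C>0. \<forall>f\<in>martingales0 M F. \<forall>l. square_controls l f \<longrightarrow>
    (\<exists>m. controls m f \<and> WL_norm M \<phi> (control_limit m) \<le> ennreal C * WL_norm M \<phi> (control_limit l))"
proof -
  have q: "0 < (1 / 2 :: real)" by simp
  obtain C where C: "weak_type_bound C (AE_dominated (1 / 2))"
    using AE_dominated_weak_type[OF q] by blast
  obtain D where D: "D > 0" and M_le: "\<forall>f\<in>martingales0 M F. \<forall>l. square_controls l f \<longrightarrow>
    WL_norm M \<phi> (maximal_fun f) \<le> ennreal D * WL_norm M \<phi> (control_limit l)"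
    using maximal_le_square_control[OF assms] by blast
  show ?thesis
  proof (intro exI[of _ "C * max D 1"] conjI ballI allI impI)
    show "C * max D 1 > 0" using weak_type_boundD(1)[OF C] by (simp add: less_max_iff_disj)
    fix f l assume f: "f \<in> martingales0 M F" and ctl: "square_controls l f"
    then have l: "l \<in> control_seqs M F" and dom: "\<forall>i. AE x in M. square_fun_upto f (Suc i) x \<le> l i x"
      by (simp_all add: square_controls_def)
    define g where "g n x = \<bar>f n x\<bar>" for n x
    define m where "m n x = run_max g n x + l n x" for n x
    have g0: "0 \<le> run_max g n x" for n x
      using run_max_ge[of g n x] by (simp add: g_def)
    have m: "m \<in> control_seqs M F"
      unfolding control_seqs_def
    proof (intro CollectI conjI allI ballI)
      fix n
      have [measurable]: "l n \<in> borel_measurable (F n)" by (rule control_seqsD[OF l])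
      have [measurable]: "run_max g n \<in> borel_measurable (F n)"
        using mart_measurable_F[OF f] by (intro run_max_measurable) (auto simp: g_def[abs_def])
      show "m n \<in> borel_measurable (F n)" unfolding m_def[abs_def] by measurable
    next
      fix x n assume x: "x \<in> space M"
      show "0 \<le> m n x" using control_seqsD(3)[OF l x] g0 by (simp add: m_def)
      show "incseq (\<lambda>n. m n x)" unfolding m_def
        by (intro incseq_SucI add_mono incseq_SucD[OF run_max_incseq] control_seqsD(4)[OF l x]) auto
    qed
    have "AE x in M. \<forall>i. square_fun_upto f (Suc i) x \<le> l i x" using dom by (simp add: AE_all_countable)
    then have ctrl: "AE x in M. \<forall>i. \<bar>f (Suc i) x\<bar> \<le> m i x"
    proof eventually_elim
      case (elim x)
      have "\<bar>f (Suc i) x\<bar> \<le> m i x" for i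
      proof -
        have "\<bar>mdiff f (Suc i) x\<bar> \<le> l i x" using elim mdiff_le_square_fun_upto[of f i x] by (meson order.trans)
        then show ?thesis using run_max_ge[of g i x] by (simp add: m_def g_def mdiff_Suc)
      qed
      then show ?case by blast
    qed
    have lev: "AE_dominated (1 / 2) (control_limit m) (maximal_fun f) (control_limit l)"
      unfolding AE_dominated_def
    proof (intro allI impI AE_I2)
      fix \<alpha> :: real and x assume \<alpha>: "\<alpha> > 0" and "x \<in> level (control_limit m) \<alpha>"
      then obtain n where n: "x \<in> space M" "\<alpha> < m n x" by (auto simp: level_control[OF m])
      then have "1 / 2 * \<alpha> < run_max g n x \<or> 1 / 2 * \<alpha> < l n x" by (auto simp: m_def)
      then have "(\<exists>k. 1 / 2 * \<alpha> < g k x) \<or> 1 / 2 * \<alpha> < l n x" using less_run_maxD[of "1 / 2 * \<alpha>" g n x] by blast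
      then show "x \<in> level (maximal_fun f) (1 / 2 * \<alpha>) \<union> level (control_limit l) (1 / 2 * \<alpha>)"
        using n by (auto simp: level_control[OF l] level_maximal g_def)
    qed
    have "WL_norm M \<phi> (control_limit m) \<le> ennreal C * max (WL_norm M \<phi> (maximal_fun f)) (WL_norm M \<phi> (control_limit l))"
      by (rule weak_type_boundD(2)[OF C control_limit_measurable[OF m] maximal_fun_measurable[OF f] control_limit_measurable[OF l] lev])
    also have "\<dots> \<le> ennreal (C * max D 1) * WL_norm M \<phi> (control_limit l)"
      using M_le f ctl by (intro cmult_max_le[OF weak_type_boundD(1)[OF C] D]) blast
    finally show "\<exists>m. controls m f \<and> WL_norm M \<phi> (control_limit m) \<le> ennreal (C * max D 1) * WL_norm M \<phi> (control_limit l)"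
      using m ctrl by (auto simp: AE_all_countable controls_def)
  qed
qed

section \<open>Regular bases\<close>

text \<open>Regularity of the martingale closed by an \<open>F (Suc n)\<close>-measurable
  \<open>g\<close> compares \<open>g\<close> with its conditional expectation given
  \<open>F n\<close>. Truncating \<open>h\<close> at \<open>k\<close> makes \<open>g\<close>
  integrable, and the truncation is removed by monotonicity.\<close>

lemma regular_le:
  assumes "regular_basis M F"
  obtains R where "R > 0" "\<And>n h. h \<in> borel_measurable (F (Suc n)) \<Longrightarrow> AE x in M. h x \<le> ennreal R * nn_cond_exp M (F n) h x"
proof -
  obtain R where R: "R > 0" and reg: "\<And>f n. is_martingale M F f \<Longrightarrow> (\<And>n. AE x in M. 0 \<le> f n x) \<Longrightarrow> n \<ge> 1 \<Longrightarrow>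
      AE x in M. f n x \<le> R * f (n - 1) x"
    using assms unfolding regular_basis_def by blast
  show thesis
  proof (rule that[OF R])
    fix n and h :: "'a \<Rightarrow> ennreal" assume h [measurable]: "h \<in> borel_measurable (F (Suc n))"
    have hM [measurable]: "h \<in> borel_measurable M" by (rule measurable_F_M[OF h])
    have bounded: "AE x in M. min (h x) (of_nat k) \<le> ennreal R * nn_cond_exp M (F n) h x" for k :: nat
    proof -
      define g where "g x = enn2real (min (h x) (of_nat k))" for x
      have gk: "ennreal (g x) = min (h x) (of_nat k)" "0 \<le> g x" "g x \<le> real k" for x
      proof -
        have "min (h x) (of_nat k) \<le> of_nat k" by simp
        also have "(of_nat k :: ennreal) < \<infinity>" by (simp add: of_nat_less_top)
        finally show e: "ennreal (g x) = min (h x) (of_nat k)" by (simp add: g_def)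
        show "0 \<le> g x" by (simp add: g_def)
        have "ennreal (g x) \<le> ennreal (real k)" unfolding e by (simp add: ennreal_of_nat_eq_real_of_nat)
        then show "g x \<le> real k" by simp
      qed
      have gF [measurable]: "g \<in> borel_measurable (F (Suc n))" unfolding g_def by measurable
      have gM [measurable]: "g \<in> borel_measurable M" by (rule measurable_F_M[OF gF])
      have gint: "integrable M g"
        using gk by (intro integrable_const_bound[where B="real k"]) auto
      \<comment> \<open>At time \<open>Suc n\<close> this martingale is \<open>g\<close> itself, up
        to a null set.\<close>
      define f where "f m = real_cond_exp M (F m) g" for m
      have mart: "is_martingale M F f"
        unfolding is_martingale_def
      proof (intro conjI allI impI)
        show "f m \<in> borel_measurable (F m)" for m by (simp add: f_def)
        show "integrable M (f m)" for m
          unfolding f_def by (rule sigma_finite_subalgebra.real_cond_exp_int(1)[OF sigma_finite_F gint])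
        show "AE x in M. real_cond_exp M (F i) (f j) x = f i x" if "i \<le> j" for i j
          unfolding f_def
          by (rule sigma_finite_subalgebra.real_cond_exp_nested_subalg[OF sigma_finite_F subalg subalg_mono[OF that] gint])
      qed
      have "AE x in M. f (Suc n) x \<le> R * f (Suc n - 1) x"
      proof (rule reg[OF mart])
        show "AE x in M. 0 \<le> f m x" for m
          unfolding f_def using gk by (intro sigma_finite_subalgebra.real_cond_exp_pos[OF sigma_finite_F]) auto
      qed simp
      moreover have "AE x in M. f (Suc n) x = g x"
        unfolding f_def by (rule sigma_finite_subalgebra.real_cond_exp_F_meas[OF sigma_finite_F gint gF])
      moreover have "AE x in M. nn_cond_exp M (F n) (\<lambda>x. ennreal (g x)) x \<le> nn_cond_exp M (F n) h x"
        using gk by (intro sigma_finite_subalgebra.nn_cond_exp_mono[OF sigma_finite_F]) auto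
      ultimately show ?thesis
      proof eventually_elim
        case (elim x)
        have "f n x \<le> enn2real (nn_cond_exp M (F n) (\<lambda>x. ennreal (g x)) x)"
          by (simp add: f_def real_cond_exp_def)
        then have "g x \<le> R * enn2real (nn_cond_exp M (F n) (\<lambda>x. ennreal (g x)) x)"
          using elim(1,2) R by (metis diff_Suc_1 mult_le_cancel_left_pos order.trans)
        then have "ennreal (g x) \<le> ennreal R * ennreal (enn2real (nn_cond_exp M (F n) (\<lambda>x. ennreal (g x)) x))"
          using R by (simp add: ennreal_mult'[symmetric] ennreal_leI)
        also have "\<dots> \<le> ennreal R * nn_cond_exp M (F n) (\<lambda>x. ennreal (g x)) x"
          by (intro mult_left_mono) (auto simp: ennreal_enn2real_if)
        also have "\<dots> \<le> ennreal R * nn_cond_exp M (F n) h x"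
          using elim(3) by (intro mult_left_mono) auto
        finally show ?case by (simp add: gk)
      qed
    qed
    then have "AE x in M. \<forall>k::nat. min (h x) (of_nat k) \<le> ennreal R * nn_cond_exp M (F n) h x"
      by (simp add: AE_all_countable)
    then show "AE x in M. h x \<le> ennreal R * nn_cond_exp M (F n) h x"
    proof eventually_elim
      case (elim x)
      show ?case
      proof (cases "h x = top")
        case True
        then have "(SUP k::nat. of_nat k) \<le> ennreal R * nn_cond_exp M (F n) h x"
          using elim by (intro SUP_least) simp
        then show ?thesis by (simp add: ennreal_SUP_of_nat_eq_top top_unique)
      next
        case False
        then obtain k :: nat where "h x \<le> of_nat k"
          using ennreal_Ex_less_of_nat[of "h x"] by (auto simp: less_top intro: less_imp_le)
        then show ?thesis using elim by (metis min.absorb1)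
      qed
    qed
  qed
qed

text \<open>By the lower type, the \<open>Q 1\<close>-mass of the set where \<open>X\<close> is
  infinite is at most \<open>D * s powr pm\<close> times its \<open>Q (1 / s)\<close>-mass, and
  admissibility keeps the latter at most 1. As \<open>s\<close> tends to 0 the mass vanishes, and
  \<open>\<phi>\<close> is positive at 1.\<close>

lemma finite_of_WL_norm:
  assumes [measurable]: "X \<in> borel_measurable M" and fin: "WL_norm M \<phi> X < \<infinity>"
  shows "AE x in M. \<bar>X x\<bar> \<noteq> \<infinity>"
proof -
  obtain l where l: "bounds X l"
    using fin by (auto simp: WL_norm_eq Inf_less_iff)
  have lpos: "l > 0" using l by (simp add: bounds_def)
  obtain D where D: "D > 0" "\<And>s t A. 0 < s \<Longrightarrow> s < 1 \<Longrightarrow> 0 \<le> t \<Longrightarrow> A \<in> sets M \<Longrightarrow>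
    emeasure (Q (s * t)) A \<le> ennreal (D * s powr pm) * emeasure (Q t) A"
    using lower_typeE by metis
  define E where "E = {x \<in> space M. \<bar>X x\<bar> = \<infinity>}"
  have E: "E \<in> sets M" unfolding E_def by measurable
  have le: "emeasure (Q 1) E \<le> ennreal (D * (1 / real (Suc (Suc k))) powr pm)" for k
  proof -
    let ?s = "1 / real (Suc (Suc k))"
    have s: "0 < ?s" "?s < 1" by auto
    have "emeasure (Q 1) E = emeasure (Q (?s * real (Suc (Suc k)))) E" by simp
    also have "\<dots> \<le> ennreal (D * ?s powr pm) * emeasure (Q (real (Suc (Suc k)))) E"
      using E by (intro D(2)[OF s]) auto
    also have "emeasure (Q (real (Suc (Suc k)))) E \<le> emeasure (Q (real (Suc (Suc k)))) (level X (real (Suc (Suc k)) * l))"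
      by (intro emeasure_mono) (auto simp: E_def level_def)
    also have "\<dots> \<le> 1"
      using l[unfolded bounds_def, THEN conjunct2, rule_format, of "real (Suc (Suc k)) * l"] lpos by simp
    finally show ?thesis by (simp add: mult_left_mono)
  qed
  have "(\<lambda>k. 1 / real (Suc (Suc k))) \<longlonglongrightarrow> 0"
    by (intro LIMSEQ_Suc lim_1_over_n)
  then have "(\<lambda>k. D * (1 / real (Suc (Suc k))) powr pm) \<longlonglongrightarrow> D * 0 powr pm"
    using pm_pos by (intro tendsto_mult tendsto_const tendsto_powr2) auto
  then have "(\<lambda>k. ennreal (D * (1 / real (Suc (Suc k))) powr pm)) \<longlonglongrightarrow> ennreal 0"
    by (intro tendsto_ennrealI) simp
  then have "emeasure (Q 1) E \<le> ennreal 0" by (rule LIMSEQ_le_const) (use le in auto)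
  then have "(\<integral>\<^sup>+x. ennreal (\<phi> x 1) * indicator E x \<partial>M) = 0" using E by (simp add: emeasure_Q)
  then have "AE x in M. ennreal (\<phi> x 1) * indicator E x = 0"
    using E by (subst (asm) nn_integral_0_iff_AE) auto
  then show ?thesis
    using AE_space
  proof eventually_elim
    case (elim x)
    then show ?case using phi_pos[of x 1] by (auto simp: E_def indicator_def split: if_splits)
  qed
qed

text \<open>Regularity bounds each squared difference by \<open>R\<close> times its conditional
  expectation, so \<open>R\<close> times the partial sum of \<open>csqd\<close> majorises the sum of
  squares through one more step than the time at which it is known. The control is built from
  \<open>s(f)\<close> itself, and level sets are compared directly.\<close>

lemma square_control_of_cond_square:
  assumes "regular_basis M F"
  shows "\<exists>C>0. \<forall>f\<in>martingales0 M F. WHs_norm M F \<phi> f < \<infinity> \<longrightarrow>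
    (\<exists>m. square_controls m f \<and> WL_norm M \<phi> (control_limit m) \<le> ennreal C * WHs_norm M F \<phi> f)"
proof -
  obtain R where R: "R > 0" and reg: "\<And>n h. h \<in> borel_measurable (F (Suc n)) \<Longrightarrow> AE x in M. h x \<le> ennreal R * nn_cond_exp M (F n) h x"
    by (rule regular_le[OF assms]) (rule that)
  have q: "0 < 1 / sqrt R" using R by simp
  obtain C where C: "weak_type_bound C (AE_dominated (1 / sqrt R))"
    using AE_dominated_weak_type[OF q] by blast
  show ?thesis
  proof (intro exI[of _ C] conjI ballI impI)
    show "C > 0" by (rule weak_type_boundD(1)[OF C])
    fix f assume f: "f \<in> martingales0 M F" and "WHs_norm M F \<phi> f < \<infinity>"
    then have fin: "WL_norm M \<phi> (cond_square_fun M F f) < \<infinity>" by (simp add: WHs_norm_def)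
    \<comment> \<open>\<open>enn2real\<close> sends infinity to 0, which would spoil the domination;
      \<open>finite_of_WL_norm\<close> confines this to a null set.\<close>
    define c where "c i x = enn2real (csqd f i x)" for i x
    have c0: "0 \<le> c i x" for i x by (simp add: c_def)
    define m where "m n x = sqrt (R * (\<Sum>i<Suc n. c i x))" for n x
    have m: "m \<in> control_seqs M F"
      unfolding control_seqs_def
    proof (intro CollectI conjI allI ballI)
      fix n
      have "(\<lambda>x. \<Sum>i<Suc n. c i x) \<in> borel_measurable (F n)"
        unfolding c_def
      proof (rule borel_measurable_sum)
        fix i assume "i \<in> {..<Suc n}"
        then have [measurable]: "csqd f i \<in> borel_measurable (F n)" by (intro csqd_measurable_F) auto
        show "(\<lambda>x. enn2real (csqd f i x)) \<in> borel_measurable (F n)" by measurable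
      qed
      then show "m n \<in> borel_measurable (F n)" unfolding m_def[abs_def] by measurable
    next
      fix x n
      show "0 \<le> m n x" unfolding m_def using R c0 by (intro real_sqrt_ge_zero mult_nonneg_nonneg sum_nonneg) auto
      show "incseq (\<lambda>n. m n x)" unfolding m_def
        using R c0 by (intro incseq_SucI real_sqrt_le_mono mult_left_mono sum_mono2) auto
    qed
    have "AE x in M. \<forall>i. sqd f i x \<le> ennreal R * csqd f i x"
      unfolding AE_all_countable csqd_def using sqd_measurable_F[OF f] by (intro allI reg) auto
    then have ctrl: "AE x in M. \<forall>i. square_fun_upto f (Suc i) x \<le> m i x"
      using finite_of_WL_norm[OF cond_square_fun_measurable fin]
    proof eventually_elim
      case (elim x)
      have "(\<Sum>i. csqd f i x) \<noteq> \<infinity>" using elim(2) by (auto simp: cond_square_fun_eq ennreal_powr_def)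
      then have "csqd f i x \<noteq> \<infinity>" for i
        using sum_le_suminf[of "\<lambda>i. csqd f i x" "{i}"] by (auto simp: top_unique)
      then have cc: "csqd f i x = ennreal (c i x)" for i by (simp add: c_def less_top)
      have "(square_fun_upto f (Suc i) x)\<^sup>2 \<le> R * (\<Sum>j<Suc i. c j x)" for i
        unfolding square_fun_upto_squared sum_distrib_left
      proof (intro sum_mono)
        fix j
        have "sqd f j x \<le> ennreal R * csqd f j x" using elim by blast
        then show "\<bar>mdiff f (Suc j) x\<bar>\<^sup>2 \<le> R * c j x"
          using R c0 unfolding sqd_def cc by (simp add: ennreal_mult'[symmetric])
      qed
      then show ?case unfolding m_def by (intro allI real_le_rsqrt)
    qed
    have lev: "AE_dominated (1 / sqrt R) (control_limit m) (cond_square_fun M F f) (cond_square_fun M F f)"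
      unfolding AE_dominated_def
    proof (intro allI impI AE_I2)
      fix \<alpha> :: real and x assume \<alpha>: "\<alpha> > 0" and "x \<in> level (control_limit m) \<alpha>"
      then obtain n where n: "x \<in> space M" "\<alpha> < m n x" by (auto simp: level_control[OF m])
      then have "\<alpha>\<^sup>2 < (sqrt (R * (\<Sum>i<Suc n. c i x)))\<^sup>2"
        using \<alpha> unfolding m_def by (intro power_strict_mono) auto
      also have "\<dots> = R * (\<Sum>i<Suc n. c i x)"
        using R c0 by (intro real_sqrt_pow2 mult_nonneg_nonneg sum_nonneg) auto
      finally have "(1 / sqrt R * \<alpha>)\<^sup>2 < (\<Sum>i<Suc n. c i x)"
        using R by (simp add: power_mult_distrib power_divide field_simps del: sum.lessThan_Suc)
      then have "ennreal ((1 / sqrt R * \<alpha>)\<^sup>2) < ennreal (\<Sum>i<Suc n. c i x)"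
        by (intro ennreal_lessI) (auto intro: le_less_trans[OF zero_le_power2])
      also have "\<dots> = (\<Sum>i<Suc n. ennreal (c i x))" using c0 by (rule_tac sum_ennreal[symmetric])
      also have "\<dots> \<le> (\<Sum>i<Suc n. csqd f i x)"
        unfolding c_def by (intro sum_mono) (auto simp: ennreal_enn2real_if)
      finally show "x \<in> level (cond_square_fun M F f) (1 / sqrt R * \<alpha>) \<union> level (cond_square_fun M F f) (1 / sqrt R * \<alpha>)"
        using n \<alpha> q by (subst level_cond_square, simp, subst level_cond_square, simp) blast
    qed
    show "\<exists>m. square_controls m f \<and> WL_norm M \<phi> (control_limit m) \<le> ennreal C * WHs_norm M F \<phi> f"
      using weak_type_boundD(2)[OF C control_limit_measurable[OF m] cond_square_fun_measurable cond_square_fun_measurable lev]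
        m ctrl by (auto simp: AE_all_countable square_controls_def WHs_norm_def)
  qed
qed

text \<open>This is the weak-type inequality for Doob's maximal function of an indicator, at the
  fixed height \<open>p\<close>. On the event that the conditional probability of \<open>A\<close>
  first reaches \<open>p\<close> at time \<open>n\<close>, the hypothesis of
  \<open>A_infinity_sets\<close> holds, and these events are disjoint.\<close>

lemma A_infinity_maximal:
  assumes "A_infinity M F \<phi>" and p: "p > 0"
  obtains C where "C > 0" "\<And>t A. 0 < t \<Longrightarrow> A \<in> sets M \<Longrightarrow>
    emeasure (Q t) (\<Union>n. {x \<in> space M. ennreal p \<le> nn_cond_exp M (F n) (indicator A) x}) \<le> ennreal C * emeasure (Q t) A"
proof -
  obtain c where c: "c > 0" and AD: "\<And>t n A D. 0 < t \<Longrightarrow> A \<in> sets M \<Longrightarrow> D \<in> sets (F n) \<Longrightarrow>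
    \<forall>C\<in>sets (F n). C \<subseteq> D \<longrightarrow> p * prob C \<le> prob (A \<inter> C) \<Longrightarrow>
    ennreal c * emeasure (Q t) D \<le> emeasure (Q t) (A \<inter> D)"
    by (rule A_infinity_sets[OF assms]) (rule that)
  have c1: "ennreal (1 / c) * ennreal c = 1" using c by (simp add: ennreal_mult'[symmetric])
  show thesis
  proof (rule that)
    show "1 / c > 0" using c by simp
    fix t :: real and A assume t: "0 < t" and A [measurable]: "A \<in> sets M"
    define U where "U n = {x \<in> space M. ennreal p \<le> nn_cond_exp M (F n) (indicator A) x}" for n
    have U: "U n \<in> sets (F n)" for n
    proof -
      have "U n = {x \<in> space (F n). ennreal p \<le> nn_cond_exp M (F n) (indicator A) x}" by (simp add: U_def)
      also have "\<dots> \<in> sets (F n)" by measurable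
      finally show ?thesis .
    qed
    define D where "D = disjointed U"
    have D: "D n \<in> sets (F n)" for n unfolding D_def using U by (rule disjointed_F)
    have [measurable]: "D n \<in> sets M" for n using D by (rule sets_F_M)
    have disj: "disjoint_family D" unfolding D_def by (rule disjoint_family_disjointed)
    have le: "ennreal c * emeasure (Q t) (D n) \<le> emeasure (Q t) (A \<inter> D n)" for n
    proof (rule AD[OF t A D], intro ballI impI)
      fix C assume C: "C \<in> sets (F n)" "C \<subseteq> D n"
      have [measurable]: "C \<in> sets M" using C sets_F_M by auto
      have [measurable]: "nn_cond_exp M (F n) (indicator A) \<in> borel_measurable M"
        by (rule measurable_F_M[OF borel_measurable_nn_cond_exp])
      have "ennreal (p * prob C) = (\<integral>\<^sup>+x. ennreal p * indicator C x \<partial>M)"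
        using p by (simp add: nn_integral_cmult_indicator emeasure_eq_measure ennreal_mult'[symmetric])
      also have "\<dots> \<le> (\<integral>\<^sup>+x. indicator C x * nn_cond_exp M (F n) (indicator A) x \<partial>M)"
        using C disjointed_subset[of U n]
        by (intro nn_integral_mono) (auto simp: D_def U_def split: split_indicator)
      also have "\<dots> = (\<integral>\<^sup>+x. indicator C x * indicator A x \<partial>M)"
        using C by (intro nn_cond_exp_mult_integral) auto
      also have "\<dots> = (\<integral>\<^sup>+x. indicator (A \<inter> C) x \<partial>M)"
        by (intro nn_integral_cong) (auto split: split_indicator)
      also have "\<dots> = ennreal (prob (A \<inter> C))" by (simp add: emeasure_eq_measure)
      finally show "p * prob C \<le> prob (A \<inter> C)" by simp
    qed
    have "(\<Sum>n. emeasure (Q t) (D n)) = emeasure (Q t) (\<Union>n. D n)"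
      using disj by (intro suminf_emeasure) auto
    then have "ennreal c * emeasure (Q t) (\<Union>n. U n) = (\<Sum>n. ennreal c * emeasure (Q t) (D n))"
      by (simp add: D_def UN_disjointed_eq)
    also have "\<dots> \<le> (\<Sum>n. emeasure (Q t) (A \<inter> D n))" by (intro suminf_le le) auto
    also have "\<dots> = emeasure (Q t) (\<Union>n. A \<inter> D n)"
      by (intro suminf_emeasure) (auto intro!: disjoint_family_on_bisimulation[OF disj])
    also have "\<dots> \<le> emeasure (Q t) A" by (intro emeasure_mono) auto
    finally have "ennreal (1 / c) * (ennreal c * emeasure (Q t) (\<Union>n. U n)) \<le> ennreal (1 / c) * emeasure (Q t) A"
      by (intro mult_left_mono) auto
    then show "emeasure (Q t) (\<Union>n. {x \<in> space M. ennreal p \<le> nn_cond_exp M (F n) (indicator A) x}) \<le> ennreal (1 / c) * emeasure (Q t) A"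
      by (simp add: mult.assoc[symmetric] c1 U_def)
  qed
qed

text \<open>Regularity, applied to the indicator of the event that \<open>V\<close> exceeds
  \<open>q\<close>, shows that the conditional probability of this event given \<open>F n\<close> is
  at least \<open>1 / R\<close> wherever the event occurs. Hence the largest \<open>q\<close> with
  this lower bound majorises \<open>V\<close>. The last property of \<open>m\<close> feeds the
  weak-type inequality \<open>A_infinity_maximal\<close>.\<close>

lemma regular_predictable_majorant:
  fixes V :: "'a \<Rightarrow> real"
  assumes R: "R > 0" and reg: "\<And>n h. h \<in> borel_measurable (F (Suc n)) \<Longrightarrow> AE x in M. h x \<le> ennreal R * nn_cond_exp M (F n) h x"
    and V: "V \<in> borel_measurable (F (Suc n))"
  obtains m where "m \<in> borel_measurable (F n)" "\<And>x. 0 \<le> m x" "AE x in M. V x \<le> m x"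
    "\<forall>\<alpha>>0. AE x in M. \<alpha> < m x \<longrightarrow> ennreal (1 / R) \<le> nn_cond_exp M (F n) (indicator {x \<in> space M. \<alpha> < V x}) x"
proof -
  have RR: "ennreal (1 / R) * ennreal R = 1" using R by (simp add: ennreal_mult'[symmetric])
  define A where "A q = {x \<in> space M. q < V x}" for q
  have AF: "A q \<in> sets (F (Suc n))" for q
  proof -
    have "A q = {x \<in> space (F (Suc n)). q < V x}" by (simp add: A_def)
    also have "\<dots> \<in> sets (F (Suc n))" using V by measurable
    finally show ?thesis .
  qed
  have [measurable]: "A q \<in> sets M" for q using AF by (rule sets_F_M)
  define e where "e q = nn_cond_exp M (F n) (indicator (A q))" for q
  have e_meas [measurable]: "e q \<in> borel_measurable (F n)" for q by (simp add: e_def)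
  have eM [measurable]: "e q \<in> borel_measurable M" for q by (rule measurable_F_M[OF e_meas])
  have e_ge: "AE x in M. x \<in> A q \<longrightarrow> ennreal (1 / R) \<le> e q x" for q
  proof -
    have "indicator (A q) \<in> borel_measurable (F (Suc n))" using AF by simp
    from reg[OF this] show ?thesis
    proof eventually_elim
      case (elim x)
      show ?case
      proof
        assume "x \<in> A q"
        then have "1 \<le> ennreal R * e q x" using elim by (simp add: e_def)
        then have "ennreal (1 / R) * 1 \<le> ennreal (1 / R) * (ennreal R * e q x)" by (intro mult_left_mono) auto
        then show "ennreal (1 / R) \<le> e q x" by (simp add: mult.assoc[symmetric] RR)
      qed
    qed
  qed
  \<comment> \<open>Conditional probabilities are antitone in \<open>q\<close> only up to a null set
    for each pair, hence the restriction to countably many \<open>q\<close> below.\<close>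
  have e_anti: "AE x in M. e q x \<le> e r x" if "r \<le> q" for r q
  proof -
    have "A q \<subseteq> A r" using that by (auto simp: A_def)
    then have "AE x in M. indicator (A q) x \<le> (indicator (A r) x :: ennreal)" by (auto split: split_indicator)
    then show ?thesis
      unfolding e_def by (rule sigma_finite_subalgebra.nn_cond_exp_mono[OF sigma_finite_F]) measurable
  qed
  define I where "I = \<rat> \<inter> {0::real<..}"
  have I: "countable I" unfolding I_def using countable_rat by blast
  \<comment> \<open>Rational \<open>q\<close> keep the supremum measurable, and the default value 0
    never passes a level \<open>\<alpha> > 0\<close>.\<close>
  define \<mu> where "\<mu> x = (SUP q\<in>I. if ennreal (1 / R) \<le> e q x then ennreal q else 0)" for x
  have mu_meas [measurable]: "\<mu> \<in> borel_measurable (F n)"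
    unfolding \<mu>_def using I by measurable
  have mu_less: "AE x in M. ennreal \<alpha> < \<mu> x \<longrightarrow> ennreal (1 / R) \<le> e \<alpha> x" if "\<alpha> > 0" for \<alpha>
  proof -
    have "AE x in M. \<forall>q\<in>I. \<alpha> \<le> q \<longrightarrow> e q x \<le> e \<alpha> x"
      using I e_anti by (subst AE_ball_countable) (auto intro: AE_impI)
    then show ?thesis
    proof eventually_elim
      case (elim x)
      show ?case
      proof
        assume "ennreal \<alpha> < \<mu> x"
        then obtain q where q: "q \<in> I" "ennreal \<alpha> < (if ennreal (1 / R) \<le> e q x then ennreal q else 0)"
          unfolding \<mu>_def less_SUP_iff by blast
        then have "ennreal (1 / R) \<le> e q x" "ennreal \<alpha> < ennreal q" by (auto split: if_splits)
        moreover have "\<alpha> \<le> q"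
          using \<open>ennreal \<alpha> < ennreal q\<close> that by (metis ennreal_leI less_imp_le linorder_not_less nle_le)
        ultimately show "ennreal (1 / R) \<le> e \<alpha> x" using elim q(1) by (meson order.trans)
      qed
    qed
  qed
  have mu_ge: "AE x in M. ennreal (V x) \<le> \<mu> x"
  proof -
    have "AE x in M. \<forall>q\<in>I. x \<in> A q \<longrightarrow> ennreal (1 / R) \<le> e q x"
      using I e_ge by (subst AE_ball_countable) auto
    then show ?thesis
      using AE_space
    proof eventually_elim
      case (elim x)
      show ?case
      proof (rule ccontr)
        assume "\<not> ennreal (V x) \<le> \<mu> x"
        then have lt: "\<mu> x < ennreal (V x)" by simp
        then obtain u where u: "\<mu> x = ennreal u" "u \<ge> 0" by (cases "\<mu> x") auto
        then have "u < V x" using lt by (metis ennreal_less_iff)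
        then obtain q where q: "q \<in> \<rat>" "u < q" "q < V x" using Rats_dense_in_real by blast
        then have qI: "q \<in> I" using u by (auto simp: I_def)
        then have "ennreal (1 / R) \<le> e q x" using elim q by (auto simp: A_def)
        then have "ennreal q \<le> \<mu> x" unfolding \<mu>_def by (intro SUP_upper2[OF qI]) simp
        then show False using u q by (simp add: ennreal_le_iff)
      qed
    qed
  qed
  \<comment> \<open>Almost everywhere on the set where \<open>\<mu>\<close> is infinite, every event
    \<open>A (real (Suc k))\<close> has conditional probability at least \<open>1 / R\<close>; these
    events shrink to the empty set because \<open>V\<close> is real-valued.\<close>
  have mu_fin: "AE x in M. \<mu> x \<noteq> \<infinity>"
  proof -
    define E where "E = {x \<in> space M. \<mu> x = \<infinity>}"
    have [measurable]: "\<mu> \<in> borel_measurable M" by (rule measurable_F_M[OF mu_meas])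
    have "\<mu> -` {\<infinity>} \<inter> space M \<in> sets M" by measurable
    then have E: "E \<in> sets M" by (simp add: E_def vimage_def Int_def conj_commute)
    have le: "prob E \<le> R * prob (A (real (Suc k)))" for k
    proof -
      let ?k = "real (Suc k)"
      have "1 / R * prob E \<le> prob (A ?k)"
      proof (rule prob_le_of_integral[OF E])
        show "AE x in M. x \<in> E \<longrightarrow> ennreal (1 / R) \<le> e ?k x"
          using mu_less[of ?k] by (auto simp: E_def elim: eventually_mono)
        have "(\<integral>\<^sup>+x. 1 * e ?k x \<partial>M) = (\<integral>\<^sup>+x. 1 * indicator (A ?k) x \<partial>M)"
          unfolding e_def by (intro nn_cond_exp_mult_integral) auto
        then show "(\<integral>\<^sup>+x. e ?k x \<partial>M) \<le> ennreal (prob (A ?k))" by (simp add: emeasure_eq_measure)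
      qed (use R in auto)
      then show ?thesis using R by (simp add: field_simps)
    qed
    have "decseq (\<lambda>k. A (real (Suc k)))" by (auto simp: decseq_def A_def)
    then have "(\<lambda>k. prob (A (real (Suc k)))) \<longlonglongrightarrow> prob (\<Inter>k. A (real (Suc k)))"
      by (intro finite_Lim_measure_decseq) auto
    also have "(\<Inter>k. A (real (Suc k))) = {}"
    proof -
      have "\<exists>k. x \<notin> A (real (Suc k))" for x
        using reals_Archimedean2[of "V x"] by (auto simp: A_def not_less) (metis add.commute add_increasing less_imp_le of_nat_0_le_iff zero_le_one)
      then show ?thesis by blast
    qed
    finally have "(\<lambda>k. R * prob (A (real (Suc k)))) \<longlonglongrightarrow> R * 0"
      by (intro tendsto_mult_left) simp
    then have "prob E \<le> R * 0" by (rule LIMSEQ_le_const) (use le in auto)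
    then have "prob E = 0" using measure_nonneg[of M E] by linarith
    then have "AE x in M. x \<notin> E" using E by (subst (asm) prob_eq_0) auto
    then show ?thesis using AE_space by eventually_elim (auto simp: E_def)
  qed
  show thesis
  proof (rule that)
    show "(\<lambda>x. enn2real (\<mu> x)) \<in> borel_measurable (F n)" by measurable
    show "0 \<le> enn2real (\<mu> x)" for x by simp
    show "AE x in M. V x \<le> enn2real (\<mu> x)"
      using mu_ge mu_fin
    proof eventually_elim
      case (elim x)
      then obtain u where "\<mu> x = ennreal u" "u \<ge> 0" by (cases "\<mu> x") auto
      then show ?case using elim(1) by (simp add: ennreal_le_iff)
    qed
    show "\<forall>\<alpha>>0. AE x in M. \<alpha> < enn2real (\<mu> x) \<longrightarrow> ennreal (1 / R) \<le> nn_cond_exp M (F n) (indicator {x \<in> space M. \<alpha> < V x}) x"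
    proof (intro allI impI)
      fix \<alpha> :: real assume \<alpha>: "0 < \<alpha>"
      show "AE x in M. \<alpha> < enn2real (\<mu> x) \<longrightarrow> ennreal (1 / R) \<le> nn_cond_exp M (F n) (indicator {x \<in> space M. \<alpha> < V x}) x"
        using mu_less[OF \<alpha>]
      proof eventually_elim
        case (elim x)
        show ?case
        proof
          assume *: "\<alpha> < enn2real (\<mu> x)"
          then have "\<mu> x \<noteq> top" using \<alpha> by auto
          then obtain u where "\<mu> x = ennreal u" "u \<ge> 0" by (cases "\<mu> x") auto
          then have "ennreal \<alpha> < \<mu> x" using * \<alpha> by (simp add: ennreal_lessI)
          then show "ennreal (1 / R) \<le> nn_cond_exp M (F n) (indicator {x \<in> space M. \<alpha> < V x}) x"
            using elim by (simp add: e_def A_def)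
        qed
      qed
    qed
  qed
qed

text \<open>Stated for an arbitrary adapted \<open>V\<close>, it serves \<open>|f n|\<close> with
  \<open>M(f)\<close> as well as the partial square functions with \<open>S(f)\<close>. If the
  running maximum of the predictable majorants passes \<open>\<alpha>\<close>, then almost surely
  some conditional probability of \<open>level X \<alpha>\<close> is at least \<open>1 / R\<close>,
  and \<open>A_infinity_maximal\<close> bounds the weighted mass of that event.\<close>

lemma regular_control:
  assumes "regular_basis M F" "A_infinity M F \<phi>"
  shows "\<exists>C>0. \<forall>V. \<forall>X\<in>borel_measurable M. (\<forall>n. V n \<in> borel_measurable (F n)) \<longrightarrow>
    (\<forall>n. \<forall>\<alpha>>0. {x \<in> space M. \<alpha> < V n x} \<subseteq> level X \<alpha>) \<longrightarrow>
    (\<exists>m\<in>control_seqs M F. (\<forall>i. AE x in M. V (Suc i) x \<le> m i x) \<and>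
      WL_norm M \<phi> (control_limit m) \<le> ennreal C * WL_norm M \<phi> X)"
proof -
  obtain R where R: "R > 0" and reg: "\<And>n h. h \<in> borel_measurable (F (Suc n)) \<Longrightarrow> AE x in M. h x \<le> ennreal R * nn_cond_exp M (F n) h x"
    by (rule regular_le[OF assms(1)]) (rule that)
  have R1: "1 / R > 0" using R by simp
  obtain B where B: "B > 0" and Doob: "\<And>t A. 0 < t \<Longrightarrow> A \<in> sets M \<Longrightarrow>
    emeasure (Q t) (\<Union>n. {x \<in> space M. ennreal (1 / R) \<le> nn_cond_exp M (F n) (indicator A) x}) \<le> ennreal B * emeasure (Q t) A"
    by (rule A_infinity_maximal[OF assms(2) R1]) (rule that)
  obtain C where C: "weak_type_bound C (level_dominated B 1)"
    using level_dominated_weak_type[OF less_imp_le[OF B] zero_less_one] by blast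
  show ?thesis
  proof (intro exI[of _ C] conjI ballI allI impI)
    show "C > 0" by (rule weak_type_boundD(1)[OF C])
    fix V :: "nat \<Rightarrow> 'a \<Rightarrow> real" and X :: "'a \<Rightarrow> ereal"
    assume X [measurable]: "X \<in> borel_measurable M" and "\<forall>n. V n \<in> borel_measurable (F n)"
      and "\<forall>n. \<forall>\<alpha>>0. {x \<in> space M. \<alpha> < V n x} \<subseteq> level X \<alpha>"
    then have V: "\<And>n. V n \<in> borel_measurable (F n)"
      and VX: "\<And>n \<alpha>. 0 < \<alpha> \<Longrightarrow> {x \<in> space M. \<alpha> < V n x} \<subseteq> level X \<alpha>" by blast+
    define P where "P n m \<longleftrightarrow> m \<in> borel_measurable (F n) \<and> (\<forall>x. 0 \<le> m x) \<and> (AE x in M. V (Suc n) x \<le> m x) \<and>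
      (\<forall>\<alpha>>0. AE x in M. \<alpha> < m x \<longrightarrow> ennreal (1 / R) \<le> nn_cond_exp M (F n) (indicator {x \<in> space M. \<alpha> < V (Suc n) x}) x)"
      for n and m :: "'a \<Rightarrow> real"
    have "\<exists>m. P n m" for n
    proof -
      obtain m where "m \<in> borel_measurable (F n)" "\<And>x. 0 \<le> m x" "AE x in M. V (Suc n) x \<le> m x"
        "\<forall>\<alpha>>0. AE x in M. \<alpha> < m x \<longrightarrow> ennreal (1 / R) \<le> nn_cond_exp M (F n) (indicator {x \<in> space M. \<alpha> < V (Suc n) x}) x"
        by (rule regular_predictable_majorant[OF R reg V]) (assumption, rule that)
      then have "P n m" unfolding P_def by (intro conjI allI) (assumption | erule spec)+
      then show ?thesis by blast
    qed
    then obtain g where "\<And>n. P n (g n)" by metis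
    then have g: "g n \<in> borel_measurable (F n)" "0 \<le> g n x" "AE x in M. V (Suc n) x \<le> g n x"
      "0 < \<alpha> \<Longrightarrow> AE x in M. \<alpha> < g n x \<longrightarrow> ennreal (1 / R) \<le> nn_cond_exp M (F n) (indicator {x \<in> space M. \<alpha> < V (Suc n) x}) x"
      for n x \<alpha> unfolding P_def by blast+
    define m where "m = run_max g"
    have m: "m \<in> control_seqs M F"
      unfolding control_seqs_def
    proof (intro CollectI conjI allI ballI)
      show "m n \<in> borel_measurable (F n)" for n
        unfolding m_def using measurable_F_mono[OF _ g(1)] by (intro run_max_measurable) auto
      show "0 \<le> m n x" for n x unfolding m_def using g(2)[of n x] run_max_ge[of g n x] by linarith
      show "incseq (\<lambda>n. m n x)" for x unfolding m_def by (rule run_max_incseq)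
    qed
    have ctrl: "AE x in M. V (Suc i) x \<le> m i x" for i
      using g(3)[of i]
    proof eventually_elim
      case (elim x)
      then show ?case using run_max_ge[of g i x] by (simp add: m_def)
    qed
    have "WL_norm M \<phi> (control_limit m) \<le> ennreal C * max (WL_norm M \<phi> X) (WL_norm M \<phi> X)"
    proof (rule weak_type_boundD(2)[OF C control_limit_measurable[OF m] X X], unfold level_dominated_def, intro allI impI)
      fix t \<alpha> :: real assume t: "0 < t" and \<alpha>: "0 < \<alpha>"
      define T where "T = (\<Union>n. {x \<in> space M. ennreal (1 / R) \<le> nn_cond_exp M (F n) (indicator (level X \<alpha>)) x})"
      have [measurable]: "nn_cond_exp M (F n) (indicator (level X \<alpha>)) \<in> borel_measurable M" for n
        by (rule measurable_F_M[OF borel_measurable_nn_cond_exp])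
      have T: "T \<in> sets M" unfolding T_def by measurable
      have mono: "AE x in M. nn_cond_exp M (F n) (indicator {x \<in> space M. \<alpha> < V (Suc n) x}) x
          \<le> nn_cond_exp M (F n) (indicator (level X \<alpha>)) x" for n
      proof (rule sigma_finite_subalgebra.nn_cond_exp_mono[OF sigma_finite_F])
        have [measurable]: "V (Suc n) \<in> borel_measurable M" by (rule measurable_F_M[OF V])
        show "indicator {x \<in> space M. \<alpha> < V (Suc n) x} \<in> borel_measurable M" by measurable
        show "AE x in M. indicator {x \<in> space M. \<alpha> < V (Suc n) x} x \<le> (indicator (level X \<alpha>) x :: ennreal)"
          using VX[OF \<alpha>, of "Suc n"] by (auto split: split_indicator)
      qed measurable
      have "AE x in M. \<forall>n. \<alpha> < g n x \<longrightarrow> ennreal (1 / R) \<le> nn_cond_exp M (F n) (indicator (level X \<alpha>)) x"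
        unfolding AE_all_countable
      proof
        fix n
        show "AE x in M. \<alpha> < g n x \<longrightarrow> ennreal (1 / R) \<le> nn_cond_exp M (F n) (indicator (level X \<alpha>)) x"
          using g(4)[OF \<alpha>, of n] mono[of n] by eventually_elim (meson order.trans)
      qed
      then have "AE x in M. x \<in> level (control_limit m) \<alpha> \<longrightarrow> x \<in> T"
      proof eventually_elim
        case (elim x)
        show ?case
        proof
          assume "x \<in> level (control_limit m) \<alpha>"
          then obtain n where n: "x \<in> space M" "\<alpha> < m n x" by (auto simp: level_control[OF m])
          then obtain k where "\<alpha> < g k x" using less_run_maxD[of \<alpha> g n x] by (auto simp: m_def)
          then show "x \<in> T" using elim n by (auto simp: T_def)
        qed
      qed
      then have "emeasure (Q t) (level (control_limit m) \<alpha>) \<le> emeasure (Q t) T"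
        using t T m by (intro Q_mono_AE) auto
      also have "\<dots> \<le> ennreal B * emeasure (Q t) (level X \<alpha>)"
        unfolding T_def by (rule Doob[OF t]) measurable
      also have "\<dots> \<le> ennreal B * (emeasure (Q t) (level X (1 * \<alpha>)) + emeasure (Q t) (level X (1 * \<alpha>)))"
        by (intro mult_left_mono) auto
      finally show "emeasure (Q t) (level (control_limit m) \<alpha>) \<le> ennreal B * (emeasure (Q t) (level X (1 * \<alpha>)) + emeasure (Q t) (level X (1 * \<alpha>)))" .
    qed
    then show "\<exists>m\<in>control_seqs M F. (\<forall>i. AE x in M. V (Suc i) x \<le> m i x) \<and>
      WL_norm M \<phi> (control_limit m) \<le> ennreal C * WL_norm M \<phi> X"
      using m ctrl by auto
  qed
qed

section \<open>From controls to the norms of WP and WQ\<close>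

lemma control_WP_iff:
  "l \<in> control_WP M F \<phi> f \<longleftrightarrow> controls l f \<and> WL_norm M \<phi> (control_limit l) < \<infinity>"
proof -
  have "(\<forall>n\<ge>1. AE x in M. \<bar>f n x\<bar> \<le> l (n - 1) x) \<longleftrightarrow> (\<forall>i. AE x in M. \<bar>f (Suc i) x\<bar> \<le> l i x)"
    by (metis One_nat_def Suc_le_D diff_Suc_1 le_add1 plus_1_eq_Suc)
  then show ?thesis by (auto simp: control_WP_def WL_space_def controls_def)
qed

lemma control_WQ_iff:
  "l \<in> control_WQ M F \<phi> f \<longleftrightarrow> square_controls l f \<and> WL_norm M \<phi> (control_limit l) < \<infinity>"
proof -
  have "(\<forall>n\<ge>1. AE x in M. square_fun_upto f n x \<le> l (n - 1) x) \<longleftrightarrow> (\<forall>i. AE x in M. square_fun_upto f (Suc i) x \<le> l i x)"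
    by (metis One_nat_def Suc_le_D diff_Suc_1 le_add1 plus_1_eq_Suc)
  then show ?thesis by (auto simp: control_WQ_def WL_space_def square_controls_def)
qed

text \<open>Moving \<open>C\<close> to the left as \<open>1 / C\<close> makes
  \<open>INF_greatest\<close> applicable, which also covers an empty index set, where the infimum is
  infinite.\<close>

lemma le_cmult_INF:
  fixes g :: "'b \<Rightarrow> ennreal"
  assumes C: "C > 0" and le: "\<And>l. l \<in> A \<Longrightarrow> a \<le> ennreal C * g l"
  shows "a \<le> ennreal C * (INF l\<in>A. g l)"
proof -
  have CC: "ennreal C * ennreal (1 / C) = 1" "ennreal (1 / C) * ennreal C = 1"
    using C by (simp_all add: ennreal_mult'[symmetric])
  have "ennreal (1 / C) * a \<le> (INF l\<in>A. g l)"
  proof (rule INF_greatest)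
    fix l assume "l \<in> A"
    then have "ennreal (1 / C) * a \<le> ennreal (1 / C) * (ennreal C * g l)" by (intro mult_left_mono le) auto
    then show "ennreal (1 / C) * a \<le> g l" by (simp add: mult.assoc[symmetric] CC)
  qed
  then have "ennreal C * (ennreal (1 / C) * a) \<le> ennreal C * (INF l\<in>A. g l)" by (rule mult_left_mono) simp
  then show ?thesis by (simp add: mult.assoc[symmetric] CC)
qed

lemma le_WP_norm:
  assumes "\<exists>C>0. \<forall>f\<in>martingales0 M F. \<forall>l. controls l f \<longrightarrow> N f \<le> ennreal C * WL_norm M \<phi> (control_limit l)"
  shows "\<exists>C>0. \<forall>f\<in>martingales0 M F. N f \<le> ennreal C * WP_norm M F \<phi> f"
proof -
  obtain C where C: "C > 0" "\<forall>f\<in>martingales0 M F. \<forall>l. controls l f \<longrightarrow> N f \<le> ennreal C * WL_norm M \<phi> (control_limit l)"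
    using assms by blast
  then have "N f \<le> ennreal C * WP_norm M F \<phi> f" if "f \<in> martingales0 M F" for f
    unfolding WP_norm_def using that by (intro le_cmult_INF) (auto simp: control_WP_iff)
  then show ?thesis using C by blast
qed

lemma le_WQ_norm:
  assumes "\<exists>C>0. \<forall>f\<in>martingales0 M F. \<forall>l. square_controls l f \<longrightarrow> N f \<le> ennreal C * WL_norm M \<phi> (control_limit l)"
  shows "\<exists>C>0. \<forall>f\<in>martingales0 M F. N f \<le> ennreal C * WQ_norm M F \<phi> f"
proof -
  obtain C where C: "C > 0" "\<forall>f\<in>martingales0 M F. \<forall>l. square_controls l f \<longrightarrow> N f \<le> ennreal C * WL_norm M \<phi> (control_limit l)"
    using assms by blast
  then have "N f \<le> ennreal C * WQ_norm M F \<phi> f" if "f \<in> martingales0 M F" for f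
    unfolding WQ_norm_def using that by (intro le_cmult_INF) (auto simp: control_WQ_iff)
  then show ?thesis using C by blast
qed

lemma cmult_finite: "a \<le> ennreal C * b \<Longrightarrow> b < \<infinity> \<Longrightarrow> a < \<infinity>"
  using ennreal_mult_less_top[of "ennreal C" b] by (auto intro: le_less_trans)

lemma WP_norm_leI:
  assumes "controls m f" "WL_norm M \<phi> (control_limit m) \<le> ennreal C * b"
  shows "WP_norm M F \<phi> f \<le> ennreal C * b"
proof (cases "ennreal C * b < \<infinity>")
  case True
  \<comment> \<open>Membership in \<open>control_WP\<close> includes finiteness of the norm of the
    limit, hence the case distinction.\<close>
  then have "m \<in> control_WP M F \<phi> f" using assms by (auto simp: control_WP_iff intro: le_less_trans)
  then have "WP_norm M F \<phi> f \<le> WL_norm M \<phi> (control_limit m)" unfolding WP_norm_def by (rule INF_lower)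
  then show ?thesis using assms(2) by simp
qed (simp add: less_top[symmetric])

lemma WQ_norm_leI:
  assumes "square_controls m f" "WL_norm M \<phi> (control_limit m) \<le> ennreal C * b"
  shows "WQ_norm M F \<phi> f \<le> ennreal C * b"
proof (cases "ennreal C * b < \<infinity>")
  case True
  then have "m \<in> control_WQ M F \<phi> f" using assms by (auto simp: control_WQ_iff intro: le_less_trans)
  then have "WQ_norm M F \<phi> f \<le> WL_norm M \<phi> (control_limit m)" unfolding WQ_norm_def by (rule INF_lower)
  then show ?thesis using assms(2) by simp
qed (simp add: less_top[symmetric])

section \<open>Norm inequalities and equality of the spaces\<close>

lemma WHM_le_WP:
  "\<exists>C>0. \<forall>f\<in>martingales0 M F. WHM_norm M \<phi> f \<le> ennreal C * WP_norm M F \<phi> f"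
  unfolding WHM_norm_def by (rule le_WP_norm[OF maximal_le_control])

lemma WHS_le_WQ:
  "\<exists>C>0. \<forall>f\<in>martingales0 M F. WHS_norm M \<phi> f \<le> ennreal C * WQ_norm M F \<phi> f"
  unfolding WHS_norm_def by (rule le_WQ_norm[OF square_le_square_control])

lemma WHS_le_WP:
  "A_infinity M F \<phi> \<Longrightarrow> \<exists>C>0. \<forall>f\<in>martingales0 M F. WHS_norm M \<phi> f \<le> ennreal C * WP_norm M F \<phi> f"
  unfolding WHS_norm_def by (rule le_WP_norm[OF square_le_control])

lemma WHs_le_WP:
  "A_infinity M F \<phi> \<Longrightarrow> \<exists>C>0. \<forall>f\<in>martingales0 M F. WHs_norm M F \<phi> f \<le> ennreal C * WP_norm M F \<phi> f"
  unfolding WHs_norm_def by (rule le_WP_norm[OF cond_square_le_control])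

lemma WHM_le_WQ:
  "A_infinity M F \<phi> \<Longrightarrow> \<exists>C>0. \<forall>f\<in>martingales0 M F. WHM_norm M \<phi> f \<le> ennreal C * WQ_norm M F \<phi> f"
  unfolding WHM_norm_def by (rule le_WQ_norm[OF maximal_le_square_control])

lemma WHs_le_WQ:
  "S_minus M F \<phi> \<Longrightarrow> \<exists>C>0. \<forall>f\<in>martingales0 M F. WHs_norm M F \<phi> f \<le> ennreal C * WQ_norm M F \<phi> f"
  unfolding WHs_norm_def by (rule le_WQ_norm[OF cond_square_le_square_control])

lemma WQ_le_WP:
  assumes "A_infinity M F \<phi>"
  shows "\<exists>C>0. \<forall>f\<in>martingales0 M F. WQ_norm M F \<phi> f \<le> ennreal C * WP_norm M F \<phi> f"
  by (rule le_WP_norm) (meson square_control_of_control[OF assms] WQ_norm_leI)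

lemma WP_le_WQ:
  assumes "A_infinity M F \<phi>"
  shows "\<exists>C>0. \<forall>f\<in>martingales0 M F. WP_norm M F \<phi> f \<le> ennreal C * WQ_norm M F \<phi> f"
  by (rule le_WQ_norm) (meson control_of_square_control[OF assms] WP_norm_leI)

text \<open>The square function on the right of \<open>maximal_le_square_and_cond_square\<close> is
  replaced by the conditional one through \<open>square_le_cond_square\<close>.\<close>

lemma WHM_le_WHs:
  assumes "A_infinity M F \<phi>" "S_plus M F \<phi>" "pp < 2"
  shows "\<exists>C>0. \<forall>f\<in>martingales0 M F. WHM_norm M \<phi> f \<le> ennreal C * WHs_norm M F \<phi> f"
proof -
  obtain D where D: "D > 0" "\<And>f. f \<in> martingales0 M F \<Longrightarrow> WHS_norm M \<phi> f \<le> ennreal D * WHs_norm M F \<phi> f"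
    using square_le_cond_square[OF assms(2,3)] by blast
  obtain C where C: "C > 0" "\<And>f. f \<in> martingales0 M F \<Longrightarrow>
    WHM_norm M \<phi> f \<le> ennreal C * max (WHS_norm M \<phi> f) (WHs_norm M F \<phi> f)"
    using maximal_le_square_and_cond_square[OF assms(1)] by blast
  have "WHM_norm M \<phi> f \<le> ennreal (C * max D 1) * WHs_norm M F \<phi> f" if f: "f \<in> martingales0 M F" for f
    by (rule order.trans[OF C(2)[OF f] cmult_max_le[OF C(1) D(1) D(2)[OF f]]])
  moreover have "C * max D 1 > 0" using C by (simp add: less_max_iff_disj)
  ultimately show ?thesis by blast
qed

lemma finite_norm_transfer:
  assumes "\<exists>C>0. \<forall>f\<in>martingales0 M F. N1 f \<le> ennreal C * N2 f"
  shows "{f \<in> martingales0 M F. N2 f < \<infinity>} \<subseteq> {f \<in> martingales0 M F. N1 f < \<infinity>}"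
  using assms cmult_finite by blast

lemma regular_WP_le_WHM:
  assumes "regular_basis M F" "A_infinity M F \<phi>"
  shows "\<exists>C>0. \<forall>f\<in>martingales0 M F. WP_norm M F \<phi> f \<le> ennreal C * WHM_norm M \<phi> f"
proof -
  obtain C where C: "C > 0" and main: "\<forall>V. \<forall>X\<in>borel_measurable M. (\<forall>n. V n \<in> borel_measurable (F n)) \<longrightarrow>
    (\<forall>n. \<forall>\<alpha>>0. {x \<in> space M. \<alpha> < V n x} \<subseteq> level X \<alpha>) \<longrightarrow>
    (\<exists>m\<in>control_seqs M F. (\<forall>i. AE x in M. V (Suc i) x \<le> m i x) \<and>
      WL_norm M \<phi> (control_limit m) \<le> ennreal C * WL_norm M \<phi> X)"
    using regular_control[OF assms] by blast
  have "WP_norm M F \<phi> f \<le> ennreal C * WHM_norm M \<phi> f" if f: "f \<in> martingales0 M F" for f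
  proof -
    have "\<exists>m\<in>control_seqs M F. (\<forall>i. AE x in M. \<bar>f (Suc i) x\<bar> \<le> m i x) \<and>
      WL_norm M \<phi> (control_limit m) \<le> ennreal C * WL_norm M \<phi> (maximal_fun f)"
      using martingales0D(1)[OF f] f by (intro main[rule_format]) (auto simp: level_maximal)
    then show ?thesis unfolding WHM_norm_def by (auto intro: WP_norm_leI simp: controls_def)
  qed
  then show ?thesis using C by blast
qed

lemma regular_WQ_le_WHS:
  assumes "regular_basis M F" "A_infinity M F \<phi>"
  shows "\<exists>C>0. \<forall>f\<in>martingales0 M F. WQ_norm M F \<phi> f \<le> ennreal C * WHS_norm M \<phi> f"
proof -
  obtain C where C: "C > 0" and main: "\<forall>V. \<forall>X\<in>borel_measurable M. (\<forall>n. V n \<in> borel_measurable (F n)) \<longrightarrow>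
    (\<forall>n. \<forall>\<alpha>>0. {x \<in> space M. \<alpha> < V n x} \<subseteq> level X \<alpha>) \<longrightarrow>
    (\<exists>m\<in>control_seqs M F. (\<forall>i. AE x in M. V (Suc i) x \<le> m i x) \<and>
      WL_norm M \<phi> (control_limit m) \<le> ennreal C * WL_norm M \<phi> X)"
    using regular_control[OF assms] by blast
  have "WQ_norm M F \<phi> f \<le> ennreal C * WHS_norm M \<phi> f" if f: "f \<in> martingales0 M F" for f
  proof -
    have "\<exists>m\<in>control_seqs M F. (\<forall>i. AE x in M. square_fun_upto f (Suc i) x \<le> m i x) \<and>
      WL_norm M \<phi> (control_limit m) \<le> ennreal C * WL_norm M \<phi> (square_fun f)"
      using square_fun_upto_measurable_F[OF f] f by (intro main[rule_format]) (auto simp: level_square')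
    then show ?thesis unfolding WHS_norm_def by (auto intro: WQ_norm_leI simp: square_controls_def)
  qed
  then show ?thesis using C by blast
qed

text \<open>\<open>WHM\<close> joins the circle through \<open>WP\<close>, and \<open>WHS\<close>
  through \<open>WQ\<close>. For \<open>WHs\<close> the inclusions go round: it contains
  \<open>WP\<close> and lies in \<open>WQ\<close>, and these two coincide.\<close>

lemma regular_spaces_eq:
  assumes reg: "regular_basis M F" and A: "A_infinity M F \<phi>"
  shows "WHs_space M F \<phi> = WQ_space M F \<phi>" "WHM_space M F \<phi> = WP_space M F \<phi>"
    "WHS_space M F \<phi> = WQ_space M F \<phi>" "WP_space M F \<phi> = WQ_space M F \<phi>"
proof -
  show PQ: "WP_space M F \<phi> = WQ_space M F \<phi>"
    unfolding WP_space_def WQ_space_def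
    using finite_norm_transfer[OF WP_le_WQ[OF A]] finite_norm_transfer[OF WQ_le_WP[OF A]] by blast
  show "WHM_space M F \<phi> = WP_space M F \<phi>"
    unfolding WP_space_def WHM_space_def
    using finite_norm_transfer[OF WHM_le_WP] finite_norm_transfer[OF regular_WP_le_WHM[OF assms]] by blast
  show "WHS_space M F \<phi> = WQ_space M F \<phi>"
    unfolding WQ_space_def WHS_space_def
    using finite_norm_transfer[OF WHS_le_WQ] finite_norm_transfer[OF regular_WQ_le_WHS[OF assms]] by blast
  have "WP_space M F \<phi> \<subseteq> WHs_space M F \<phi>"
    unfolding WP_space_def WHs_space_def by (rule finite_norm_transfer[OF WHs_le_WP[OF A]])
  moreover have "WHs_space M F \<phi> \<subseteq> WQ_space M F \<phi>"
  proof
    fix f assume "f \<in> WHs_space M F \<phi>"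
    then have f: "f \<in> martingales0 M F" "WHs_norm M F \<phi> f < \<infinity>"
      by (auto simp: WHs_space_def)
    then obtain C where "WQ_norm M F \<phi> f \<le> ennreal C * WHs_norm M F \<phi> f"
      using square_control_of_cond_square[OF reg] WQ_norm_leI by meson
    then show "f \<in> WQ_space M F \<phi>" using f cmult_finite by (auto simp: WQ_space_def)
  qed
  ultimately show "WHs_space M F \<phi> = WQ_space M F \<phi>" using PQ by blast
qed

end

theorem theorem4p6:
  fixes M :: "'a measure" and F :: "nat \<Rightarrow> 'a measure"
    and \<phi> :: "'a \<Rightarrow> real \<Rightarrow> real" and pm pp :: real
  assumes "prob_space M"
    and "stochastic_basis M F"
    and "musielak_orlicz M \<phi>"
    and "0 < pm" and "uniformly_lower_type M \<phi> pm"
    and "0 < pp" and "uniformly_upper_type M \<phi> pp"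
  shows
    "(S_plus M F \<phi> \<and> pp < 2 \<longrightarrow>
        (\<exists>C::real. 0 < C \<and> (\<forall>f\<in>WHs_space M F \<phi>.
           WHS_norm M \<phi> f \<le> ennreal C * WHs_norm M F \<phi> f)))
     \<and>
     (A_infinity M F \<phi> \<and> S_class M F \<phi> \<and> pp < 2 \<longrightarrow>
        (\<exists>C::real. 0 < C \<and> (\<forall>f\<in>WHs_space M F \<phi>.
           WHM_norm M \<phi> f \<le> ennreal C * WHs_norm M F \<phi> f)))
     \<and>
     ((\<exists>C::real. 0 < C \<and> (\<forall>f\<in>WP_space M F \<phi>.
           WHM_norm M \<phi> f \<le> ennreal C * WP_norm M F \<phi> f)) \<and>
      (\<exists>C::real. 0 < C \<and> (\<forall>f\<in>WQ_space M F \<phi>.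
           WHS_norm M \<phi> f \<le> ennreal C * WQ_norm M F \<phi> f)))
     \<and>
     (A_infinity M F \<phi> \<and> S_class M F \<phi> \<longrightarrow>
        (\<exists>C::real. 0 < C \<and> (\<forall>f\<in>WP_space M F \<phi>.
           WHS_norm M \<phi> f \<le> ennreal C * WP_norm M F \<phi> f \<and>
           WHs_norm M F \<phi> f \<le> ennreal C * WP_norm M F \<phi> f)) \<and>
        (\<exists>C::real. 0 < C \<and> (\<forall>f\<in>WQ_space M F \<phi>.
           WHM_norm M \<phi> f \<le> ennreal C * WQ_norm M F \<phi> f)))
     \<and>
     (S_minus M F \<phi> \<longrightarrow>
        (\<exists>C::real. 0 < C \<and> (\<forall>f\<in>WQ_space M F \<phi>.
           WHs_norm M F \<phi> f \<le> ennreal C * WQ_norm M F \<phi> f)))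
     \<and>
     (A_infinity M F \<phi> \<and> S_class M F \<phi> \<and> pp < 2 \<longrightarrow>
        (\<exists>C::real. 0 < C \<and> (\<forall>f\<in>WQ_space M F \<phi>.
           ennreal (1 / C) * WQ_norm M F \<phi> f \<le> WP_norm M F \<phi> f \<and>
           WP_norm M F \<phi> f \<le> ennreal C * WQ_norm M F \<phi> f)))
     \<and>
     (regular_basis M F \<and> A_infinity M F \<phi> \<longrightarrow>
        WHs_space M F \<phi> = WHM_space M F \<phi> \<and>
        WHM_space M F \<phi> = WHS_space M F \<phi> \<and>
        WHS_space M F \<phi> = WP_space M F \<phi> \<and>
        WP_space M F \<phi> = WQ_space M F \<phi>)"
proof -
  interpret prob_space M by fact
  interpret weighted_basis M F \<phi> pm pp by unfold_locales fact+
  have mart: "f \<in> martingales0 M F" if "f \<in> WHs_space M F \<phi> \<or> f \<in> WP_space M F \<phi> \<or> f \<in> WQ_space M F \<phi>" for f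
    using that by (auto simp: WHs_space_def WP_space_def WQ_space_def)
  \<comment> \<open>One constant has to serve both inequalities.\<close>
  have two: "\<exists>C>0. \<forall>f\<in>martingales0 M F. N1 f \<le> ennreal C * N2 f \<and> N3 f \<le> ennreal C * N4 f"
    if 1: "\<exists>C>0. \<forall>f\<in>martingales0 M F. N1 f \<le> ennreal C * N2 f"
      and 2: "\<exists>C>0. \<forall>f\<in>martingales0 M F. N3 f \<le> ennreal C * N4 f" for N1 N2 N3 N4
  proof -
    obtain C D where C: "C > 0" "\<And>f. f \<in> martingales0 M F \<Longrightarrow> N1 f \<le> ennreal C * N2 f"
      and D: "D > 0" "\<And>f. f \<in> martingales0 M F \<Longrightarrow> N3 f \<le> ennreal D * N4 f"
      using 1 2 by blast
    have "N1 f \<le> ennreal (max C D) * N2 f \<and> N3 f \<le> ennreal (max C D) * N4 f" if f: "f \<in> martingales0 M F" for f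
      using C(2)[OF f] D(2)[OF f]
        mult_right_mono[OF ennreal_leI[of C "max C D"], of "N2 f"] mult_right_mono[OF ennreal_leI[of D "max C D"], of "N4 f"]
      by (meson max.cobounded1 max.cobounded2 order.trans zero_le)
    then show ?thesis using C(1) by (intro exI[of _ "max C D"]) (auto simp: less_max_iff_disj)
  qed
  have inv: "ennreal (1 / C) * a \<le> b" if "a \<le> ennreal C * b" "C > 0" for C :: real and a b
  proof -
    have "ennreal (1 / C) * a \<le> ennreal (1 / C) * (ennreal C * b)" using that by (intro mult_left_mono) auto
    also have "\<dots> = ennreal (1 / C * C) * b" using that by (simp add: mult.assoc[symmetric] ennreal_mult'[symmetric])
    finally show ?thesis using that by simp
  qed
  show ?thesis
  proof (intro conjI impI; (elim conjE)?)
    assume "S_plus M F \<phi>" "pp < 2"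
    from square_le_cond_square[OF this]
    show "\<exists>C::real. 0 < C \<and> (\<forall>f\<in>WHs_space M F \<phi>. WHS_norm M \<phi> f \<le> ennreal C * WHs_norm M F \<phi> f)"
      using mart by blast
  next
    assume "A_infinity M F \<phi>" "S_class M F \<phi>" "pp < 2"
    then show "\<exists>C::real. 0 < C \<and> (\<forall>f\<in>WHs_space M F \<phi>. WHM_norm M \<phi> f \<le> ennreal C * WHs_norm M F \<phi> f)"
      using WHM_le_WHs mart unfolding S_class_def by blast
  next
    show "\<exists>C::real. 0 < C \<and> (\<forall>f\<in>WP_space M F \<phi>. WHM_norm M \<phi> f \<le> ennreal C * WP_norm M F \<phi> f)"
      using WHM_le_WP mart by blast
  next
    show "\<exists>C::real. 0 < C \<and> (\<forall>f\<in>WQ_space M F \<phi>. WHS_norm M \<phi> f \<le> ennreal C * WQ_norm M F \<phi> f)"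
      using WHS_le_WQ mart by blast
  next
    assume A: "A_infinity M F \<phi>"
    show "\<exists>C::real. 0 < C \<and> (\<forall>f\<in>WP_space M F \<phi>. WHS_norm M \<phi> f \<le> ennreal C * WP_norm M F \<phi> f \<and>
           WHs_norm M F \<phi> f \<le> ennreal C * WP_norm M F \<phi> f)"
      using two[OF WHS_le_WP[OF A] WHs_le_WP[OF A]] mart by blast
    show "\<exists>C::real. 0 < C \<and> (\<forall>f\<in>WQ_space M F \<phi>. WHM_norm M \<phi> f \<le> ennreal C * WQ_norm M F \<phi> f)"
      using WHM_le_WQ[OF A] mart by blast
  next
    assume "S_minus M F \<phi>"
    from WHs_le_WQ[OF this]
    show "\<exists>C::real. 0 < C \<and> (\<forall>f\<in>WQ_space M F \<phi>. WHs_norm M F \<phi> f \<le> ennreal C * WQ_norm M F \<phi> f)"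
      using mart by blast
  next
    assume A: "A_infinity M F \<phi>"
    show "\<exists>C::real. 0 < C \<and> (\<forall>f\<in>WQ_space M F \<phi>. ennreal (1 / C) * WQ_norm M F \<phi> f \<le> WP_norm M F \<phi> f \<and>
           WP_norm M F \<phi> f \<le> ennreal C * WQ_norm M F \<phi> f)"
      using two[OF WQ_le_WP[OF A] WP_le_WQ[OF A]] mart inv by blast
  qed (use regular_spaces_eq in simp_all)
qed

end
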